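(* Let $1\le r\le\infty$, let $\mathcal{F}$ and $\mathcal{F}'$ be $C^r$ foliations on $C^r$ manifolds $M$ and $M'$, respectively, and let $A$ be a $C^r$ embedded submanifold of $M'$. If $A$ is transverse to $\mathcal{F}'$ (that is, $T_{x'}M'=T_{x'}A+T_{x'}\mathcal{F}'$ for all $x'\in A$), then the set $$\{\phi\in C^r(\mathcal{F},\mathcal{F}')\ :\ \phi \text{ is transverse to } A\}$$ is residual in $C^r_{SP}(\mathcal{F},\mathcal{F}')$.
   Context: A $C^r$ foliation of dimension $p$ and codimension $q$ has foliation charts $\theta:U\to T\times B$ with $T\subset\mathbb{R}^q$ open and $B\subset\mathbb{R}^p$ convex open; the composite $U\to T$ is the local projection. $T\mathcal{F}'\subset TM'$ is the tangent bundle to the leaves of $\mathcal{F}'$. $C^r(\mathcal{F},\mathcal{F}')$ is the set of $C^r$ foliation maps, i.e. $C^r$ maps $M\to M'$ sending each leaf of $\mathcal{F}$ into a leaf of $\mathcal{F}'$. A map $\phi:M\to M'$ is transverse to $A$ if $T_{\phi(x)}M'=T_{\phi(x)}A+\phi_*(T_xM)$ for all $x\in\phi^{-1}(A)$. A subset of a topological space is residual if it contains a countable intersection of dense open subsets. $C^r_{SP}(\mathcal{F},\mathcal{F}')$ is $C^r(\mathcal{F},\mathcal{F}')$ with the strong plaquewise topology (sp-topology): for $r$ finite, a base is given by the sets $\mathcal{N}^r(\phi,\Theta,\Theta',\mathcal{K},\mathcal{E})$, where $\phi\in C^r(\mathcal{F},\mathcal{F}')$, $\Theta=\{(U_i,\theta_i)\}$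 is a locally finite family of foliation charts of $\mathcal{F}$, $\Theta'=\{(U'_i,\theta'_i)\}$ is a family of foliation charts of $\mathcal{F}'$ with the same index set and with local projections $\pi'_i$, $\mathcal{K}=\{K_i\}$ is a family of compact sets with $K_i\subset U_i$ and $\phi(K_i)\subset U'_i$, and $\mathcal{E}=\{\epsilon_i\}$ is a family of positive numbers. It consists of the $\psi\in C^r(\mathcal{F},\mathcal{F}')$ such that, for all $i$, $x\in K_i$ and $0\le k\le r$: $\psi(K_i)\subset U'_i$, $\pi'_i\psi(x)=\pi'_i\phi(x)$, and $\|D^k(\theta'_i\psi\theta_i^{-1})(\theta_i(x))-D^k(\theta'_i\phi\theta_i^{-1})(\theta_i(x))\|<\epsilon_i$. For $r=\infty$, a base is given by all sets $C^\infty(\mathcal{F},\mathcal{F}')\cap\mathcal{N}^s(\phi,\Theta,\Theta',\mathcal{K},\mathcal{E})$ with $s\in\mathbb{N}$ arbitrary. *)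

theory Defs
  imports "HOL-Analysis.Analysis" "HOL-Library.Extended_Nat"
begin

section \<open>Calculus on open subsets of R^n\<close>

text \<open>
  A type of class \<open>euclidean_space\<close> has dimension at least 1, so R^n with n \<ge> 0 is
  rendered as an n-dimensional linear subspace \<open>V\<close> of such a type. This includes manifolds,
  leaves and transversals of dimension 0. For \<open>x \<in> V\<close>, for \<open>f\<close> differentiable at \<open>x\<close>
  within \<open>V\<close>, and for \<open>v \<in> V\<close>, the value \<open>frechet_derivative f (at x within V) v\<close> is
  uniquely determined, and depends only on the restriction of \<open>f\<close> to a neighbourhood of \<open>x\<close>
  in \<open>V\<close>.
\<close>

primrec Ck_on :: "nat \<Rightarrow> 'e::euclidean_space set \<Rightarrow> ('e \<Rightarrow> 'f::euclidean_space) \<Rightarrow> 'e set \<Rightarrow> bool"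
where
  "Ck_on 0 V f S \<longleftrightarrow> continuous_on S f"
| "Ck_on (Suc k) V f S \<longleftrightarrow>
     (\<forall>x\<in>S. f differentiable (at x within V)) \<and>
     (\<forall>v\<in>V. Ck_on k V (\<lambda>x. frechet_derivative f (at x within V) v) S)"

definition Cr_on :: "enat \<Rightarrow> 'e::euclidean_space set \<Rightarrow> ('e \<Rightarrow> 'f::euclidean_space) \<Rightarrow> 'e set \<Rightarrow> bool"
where
  "Cr_on r V f S \<longleftrightarrow> (\<forall>k. enat k \<le> r \<longrightarrow> Ck_on k V f S)"

text \<open>
  \<open>iter_deriv V [v1, \<dots>, vk] f x\<close> is the value of the k-th derivative \<open>D^k f (x)\<close>, a symmetric
  k-linear map on \<open>V\<close>, at \<open>(v1, \<dots>, vk)\<close>; \<open>Dk_dist\<close> is the operator norm of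
  \<open>D^k f (x) - D^k g (x)\<close>.
\<close>

primrec iter_deriv ::
  "'e::euclidean_space set \<Rightarrow> 'e list \<Rightarrow> ('e \<Rightarrow> 'f::euclidean_space) \<Rightarrow> 'e \<Rightarrow> 'f"
where
  "iter_deriv V [] f = f"
| "iter_deriv V (v # vs) f = iter_deriv V vs (\<lambda>x. frechet_derivative f (at x within V) v)"

definition Dk_dist ::
  "nat \<Rightarrow> 'e::euclidean_space set \<Rightarrow> ('e \<Rightarrow> 'f::euclidean_space) \<Rightarrow> ('e \<Rightarrow> 'f) \<Rightarrow> 'e \<Rightarrow> real"
where
  "Dk_dist k V f g x =
     (SUP vs\<in>{vs. length vs = k \<and> set vs \<subseteq> V \<inter> cball 0 1}.
        norm (iter_deriv V vs f x - iter_deriv V vs g x))"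


section \<open>Manifolds\<close>

text \<open>
  A chart is a pair \<open>(U, \<theta>)\<close>; the values of \<open>\<theta>\<close> outside \<open>U\<close> are irrelevant.
\<close>

type_synonym ('a, 'e) chart = "'a set \<times> ('a \<Rightarrow> 'e)"

record ('a, 'e) mfd =
  mf_top :: "'a topology"
  mf_model :: "'e set"
  mf_atlas :: "('a, 'e) chart set"

text \<open>The local representation \<open>\<theta>' \<circ> f \<circ> \<theta>\<inverse>\<close>; for \<open>f = id\<close> it is the coordinate change.\<close>

definition local_rep :: "('a, 'e) chart \<Rightarrow> ('a \<Rightarrow> 'b) \<Rightarrow> ('b, 'f) chart \<Rightarrow> 'e \<Rightarrow> 'f" where
  "local_rep c f c' = snd c' \<circ> f \<circ> inv_into (fst c) (snd c)"

definition is_chart :: "('a, 'e::euclidean_space) mfd \<Rightarrow> ('a, 'e) chart \<Rightarrow> bool" where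
  "is_chart M c \<longleftrightarrow>
     openin (mf_top M) (fst c) \<and>
     openin (top_of_set (mf_model M)) (snd c ` fst c) \<and>
     homeomorphic_map (subtopology (mf_top M) (fst c)) (top_of_set (snd c ` fst c)) (snd c)"

definition Cr_compatible ::
  "enat \<Rightarrow> ('a, 'e::euclidean_space) mfd \<Rightarrow> ('a, 'e) chart \<Rightarrow> ('a, 'e) chart \<Rightarrow> bool"
where
  "Cr_compatible r M c c' \<longleftrightarrow>
     Cr_on r (mf_model M) (local_rep c id c') (snd c ` (fst c \<inter> fst c')) \<and>
     Cr_on r (mf_model M) (local_rep c' id c) (snd c' ` (fst c \<inter> fst c'))"

text \<open>
  Manifolds are Hausdorff, second countable and without boundary, and are given by their
  maximal atlas. The dimension is \<open>dim (mf_model M)\<close>.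
\<close>

definition Cr_manifold :: "enat \<Rightarrow> ('a, 'e::euclidean_space) mfd \<Rightarrow> bool" where
  "Cr_manifold r M \<longleftrightarrow>
     Hausdorff_space (mf_top M) \<and> second_countable (mf_top M) \<and>
     subspace (mf_model M) \<and>
     (\<forall>c\<in>mf_atlas M. is_chart M c) \<and>
     topspace (mf_top M) = \<Union>(fst ` mf_atlas M) \<and>
     (\<forall>c\<in>mf_atlas M. \<forall>c'\<in>mf_atlas M. Cr_compatible r M c c') \<and>
     (\<forall>c. is_chart M c \<and> (\<forall>c'\<in>mf_atlas M. Cr_compatible r M c c') \<longrightarrow> c \<in> mf_atlas M)"

definition charts_at :: "('a, 'e) mfd \<Rightarrow> 'a \<Rightarrow> ('a, 'e) chart set" where
  "charts_at M x = {c \<in> mf_atlas M. x \<in> fst c}"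

text \<open>
  Maps between manifolds are total functions in HOL; they are made unique by \<open>\<rightarrow>\<^sub>E\<close> to be
  \<open>undefined\<close> off the source manifold.
\<close>

definition Cr_maps ::
  "enat \<Rightarrow> ('a, 'e::euclidean_space) mfd \<Rightarrow> ('b, 'f::euclidean_space) mfd \<Rightarrow> ('a \<Rightarrow> 'b) set"
where
  "Cr_maps r M M' =
     {\<phi> \<in> topspace (mf_top M) \<rightarrow>\<^sub>E topspace (mf_top M').
        continuous_map (mf_top M) (mf_top M') \<phi> \<and>
        (\<forall>c\<in>mf_atlas M. \<forall>c'\<in>mf_atlas M'.
           Cr_on r (mf_model M) (local_rep c \<phi> c') (snd c ` (fst c \<inter> \<phi> -` fst c')))}"


section \<open>Foliations\<close>

text \<open>
  A chart \<open>\<theta> : U \<rightarrow> T \<times> B\<close> as in the definition of a foliation; its local projection is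
  \<open>fst \<circ> \<theta>\<close>.
\<close>

definition product_chart ::
  "'t::euclidean_space set \<Rightarrow> 'b::euclidean_space set \<Rightarrow> ('a, 't \<times> 'b) chart \<Rightarrow> bool"
where
  "product_chart Q P c \<longleftrightarrow>
     (\<exists>T B. openin (top_of_set Q) T \<and> openin (top_of_set P) B \<and> convex B \<and>
            snd c ` fst c = T \<times> B)"

definition local_proj :: "('a, 't \<times> 'b) chart \<Rightarrow> 'a \<Rightarrow> 't" where
  "local_proj c x = fst (snd c x)"

text \<open>The coordinate change from \<open>c\<close> to \<open>c'\<close> has locally the form \<open>(t, b) \<mapsto> (h t, g (t, b))\<close>.\<close>

definition foliated_change ::
  "('a, 't \<times> 'b) mfd \<Rightarrow> ('a, 't \<times> 'b) chart \<Rightarrow> ('a, 't \<times> 'b) chart \<Rightarrow> bool"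
where
  "foliated_change M c c' \<longleftrightarrow>
     (\<forall>x\<in>fst c \<inter> fst c'. \<exists>W h. openin (mf_top M) W \<and> x \<in> W \<and> W \<subseteq> fst c \<inter> fst c' \<and>
        (\<forall>y\<in>W. local_proj c' y = h (local_proj c y)))"

text \<open>
  A \<open>C^r\<close> foliation on a \<open>C^r\<close> manifold is given by the set \<open>F\<close> of all of its foliation
  charts. The model \<open>R^n\<close> of the manifold is split as \<open>Q \<times> P\<close>, where \<open>dim Q\<close> is the
  codimension and \<open>dim P\<close> the dimension of the foliation.
\<close>

definition Cr_foliation ::
  "enat \<Rightarrow> ('a, 't::euclidean_space \<times> 'b::euclidean_space) mfd \<Rightarrow> ('a, 't \<times> 'b) chart set \<Rightarrow> bool"
where
  "Cr_foliation r M F \<longleftrightarrow>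
     Cr_manifold r M \<and>
     (\<exists>Q P. subspace Q \<and> subspace P \<and> mf_model M = Q \<times> P \<and>
        F \<subseteq> mf_atlas M \<and> (\<forall>c\<in>F. product_chart Q P c) \<and>
        topspace (mf_top M) = \<Union>(fst ` F) \<and>
        (\<forall>c\<in>F. \<forall>c'\<in>F. foliated_change M c c') \<and>
        (\<forall>c\<in>mf_atlas M. product_chart Q P c \<and>
            (\<forall>c'\<in>F. foliated_change M c c' \<and> foliated_change M c' c) \<longrightarrow> c \<in> F))"

definition same_plaque :: "('a, 't \<times> 'b) chart set \<Rightarrow> 'a \<Rightarrow> 'a \<Rightarrow> bool" where
  "same_plaque F x y \<longleftrightarrow>
     (\<exists>c\<in>F. x \<in> fst c \<and> y \<in> fst c \<and> local_proj c x = local_proj c y)"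

text \<open>Leaves are the classes of points that can be joined by a finite chain of plaques.\<close>

definition leaves :: "('a, 't \<times> 'b) chart set \<Rightarrow> 'a set set" where
  "leaves F = {{y. (same_plaque F)\<^sup>*\<^sup>* x y} | x. x \<in> \<Union>(fst ` F)}"

definition foliation_maps ::
  "enat \<Rightarrow> ('a, 't::euclidean_space \<times> 'b::euclidean_space) mfd \<Rightarrow> ('a, 't \<times> 'b) chart set \<Rightarrow>
   ('c, 'u::euclidean_space \<times> 'd::euclidean_space) mfd \<Rightarrow> ('c, 'u \<times> 'd) chart set \<Rightarrow> ('a \<Rightarrow> 'c) set"
where
  "foliation_maps r M F M' F' =
     {\<phi> \<in> Cr_maps r M M'. \<forall>L\<in>leaves F. \<exists>L'\<in>leaves F'. \<phi> ` L \<subseteq> L'}"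


section \<open>Tangent spaces and transversality\<close>

text \<open>
  A tangent vector at \<open>x\<close> is a family of vectors of the model space, one for each chart at \<open>x\<close>,
  related by the derivatives of the coordinate changes. It is \<open>0\<close> at all other charts, so that
  vectors are added pointwise.
\<close>

definition tangent_space ::
  "('a, 'e::euclidean_space) mfd \<Rightarrow> 'a \<Rightarrow> (('a, 'e) chart \<Rightarrow> 'e) set"
where
  "tangent_space M x =
     {v. (\<forall>c. c \<notin> charts_at M x \<longrightarrow> v c = 0) \<and>
         (\<forall>c\<in>charts_at M x. v c \<in> mf_model M) \<and>
         (\<forall>c\<in>charts_at M x. \<forall>c'\<in>charts_at M x.
            v c' = frechet_derivative (local_rep c id c') (at (snd c x) within mf_model M) (v c))}"

definition tangent_sum :: "('k \<Rightarrow> 'e::euclidean_space) set \<Rightarrow> ('k \<Rightarrow> 'e) set \<Rightarrow> ('k \<Rightarrow> 'e) set" where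
  "tangent_sum X Y = {(\<lambda>c. v c + w c) | v w. v \<in> X \<and> w \<in> Y}"

text \<open>
  The differential \<open>\<phi>_*\<close> at \<open>x\<close>. By the chain rule it does not depend on the chosen chart \<open>c\<close>
  at \<open>x\<close>.
\<close>

definition differential ::
  "('a, 'e::euclidean_space) mfd \<Rightarrow> ('b, 'f::euclidean_space) mfd \<Rightarrow> ('a \<Rightarrow> 'b) \<Rightarrow> 'a \<Rightarrow>
   (('a, 'e) chart \<Rightarrow> 'e) \<Rightarrow> ('b, 'f) chart \<Rightarrow> 'f"
where
  "differential M M' \<phi> x v =
     (\<lambda>c'. if c' \<in> charts_at M' (\<phi> x)
           then let c = (SOME c. c \<in> charts_at M x)
                in frechet_derivative (local_rep c \<phi> c') (at (snd c x) within mf_model M) (v c)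
           else 0)"

text \<open>In the chart \<open>c\<close>, the set \<open>A\<close> is the slice by the linear subspace \<open>L\<close> of the model.\<close>

definition slice_chart ::
  "('a, 'e::euclidean_space) mfd \<Rightarrow> 'a set \<Rightarrow> ('a, 'e) chart \<Rightarrow> 'e set \<Rightarrow> bool"
where
  "slice_chart M A c L \<longleftrightarrow>
     c \<in> mf_atlas M \<and> subspace L \<and> L \<subseteq> mf_model M \<and>
     snd c ` (fst c \<inter> A) = snd c ` fst c \<inter> L"

definition embedded_submanifold :: "('a, 'e::euclidean_space) mfd \<Rightarrow> 'a set \<Rightarrow> bool" where
  "embedded_submanifold M A \<longleftrightarrow>
     A \<subseteq> topspace (mf_top M) \<and>
     (\<exists>k. \<forall>x\<in>A. \<exists>c L. x \<in> fst c \<and> slice_chart M A c L \<and> dim L = k)"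

definition submanifold_tangent_space ::
  "('a, 'e::euclidean_space) mfd \<Rightarrow> 'a set \<Rightarrow> 'a \<Rightarrow> (('a, 'e) chart \<Rightarrow> 'e) set"
where
  "submanifold_tangent_space M A x =
     {v \<in> tangent_space M x. \<forall>c L. x \<in> fst c \<and> slice_chart M A c L \<longrightarrow> v c \<in> L}"

text \<open>The tangent space at \<open>x\<close> to the leaf through \<open>x\<close>: the vectors tangent to the plaques.\<close>

definition leaf_tangent_space ::
  "('a, 't::euclidean_space \<times> 'b::euclidean_space) mfd \<Rightarrow> ('a, 't \<times> 'b) chart set \<Rightarrow> 'a \<Rightarrow>
   (('a, 't \<times> 'b) chart \<Rightarrow> 't \<times> 'b) set"
where
  "leaf_tangent_space M F x =
     {v \<in> tangent_space M x. \<forall>c\<in>F. x \<in> fst c \<longrightarrow> fst (v c) = 0}"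

definition submanifold_transverse_to_foliation ::
  "('a, 't::euclidean_space \<times> 'b::euclidean_space) mfd \<Rightarrow> ('a, 't \<times> 'b) chart set \<Rightarrow> 'a set \<Rightarrow> bool"
where
  "submanifold_transverse_to_foliation M F A \<longleftrightarrow>
     (\<forall>x\<in>A. tangent_space M x =
              tangent_sum (submanifold_tangent_space M A x) (leaf_tangent_space M F x))"

definition map_transverse_to ::
  "('a, 'e::euclidean_space) mfd \<Rightarrow> ('b, 'f::euclidean_space) mfd \<Rightarrow> ('a \<Rightarrow> 'b) \<Rightarrow> 'b set \<Rightarrow> bool"
where
  "map_transverse_to M M' \<phi> A \<longleftrightarrow>
     (\<forall>x\<in>topspace (mf_top M). \<phi> x \<in> A \<longrightarrow>
        tangent_space M' (\<phi> x) =
          tangent_sum (submanifold_tangent_space M' A (\<phi> x))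
                      (differential M M' \<phi> x ` tangent_space M x))"


section \<open>The strong plaquewise topology\<close>

text \<open>
  The sets \<open>N^s(\<phi>, \<Theta>, \<Theta>', K, \<epsilon>)\<close>. Countable index sets \<open>I\<close> suffice: a locally finite
  family in a second countable space has only countably many nonempty members, and an index
  \<open>i\<close> with \<open>U i = {}\<close> imposes no condition. The charts are those of the given foliations,
  also when \<open>s\<close> is smaller than their class.
\<close>

definition sp_nbhd ::
  "nat \<Rightarrow> ('a, 't::euclidean_space \<times> 'b::euclidean_space) mfd \<Rightarrow> ('a, 't \<times> 'b) chart set \<Rightarrow>
   ('c, 'u::euclidean_space \<times> 'd::euclidean_space) mfd \<Rightarrow> ('c, 'u \<times> 'd) chart set \<Rightarrow>
   ('a \<Rightarrow> 'c) \<Rightarrow> nat set \<Rightarrow> (nat \<Rightarrow> ('a, 't \<times> 'b) chart) \<Rightarrow> (nat \<Rightarrow> ('c, 'u \<times> 'd) chart) \<Rightarrow>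
   (nat \<Rightarrow> 'a set) \<Rightarrow> (nat \<Rightarrow> real) \<Rightarrow> ('a \<Rightarrow> 'c) set"
where
  "sp_nbhd s M F M' F' \<phi> I \<Theta> \<Theta>' K \<epsilon> =
     {\<psi> \<in> foliation_maps (enat s) M F M' F'. \<forall>i\<in>I.
        \<psi> ` K i \<subseteq> fst (\<Theta>' i) \<and>
        (\<forall>x\<in>K i. local_proj (\<Theta>' i) (\<psi> x) = local_proj (\<Theta>' i) (\<phi> x) \<and>
           (\<forall>k\<le>s. Dk_dist k (mf_model M) (local_rep (\<Theta> i) \<psi> (\<Theta>' i))
                     (local_rep (\<Theta> i) \<phi> (\<Theta>' i)) (snd (\<Theta> i) x) < \<epsilon> i))}"

definition sp_base ::
  "nat \<Rightarrow> ('a, 't::euclidean_space \<times> 'b::euclidean_space) mfd \<Rightarrow> ('a, 't \<times> 'b) chart set \<Rightarrow>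
   ('c, 'u::euclidean_space \<times> 'd::euclidean_space) mfd \<Rightarrow> ('c, 'u \<times> 'd) chart set \<Rightarrow>
   ('a \<Rightarrow> 'c) set set"
where
  "sp_base s M F M' F' =
     {sp_nbhd s M F M' F' \<phi> I \<Theta> \<Theta>' K \<epsilon> | \<phi> I \<Theta> \<Theta>' K \<epsilon>.
        \<phi> \<in> foliation_maps (enat s) M F M' F' \<and>
        (\<forall>i\<in>I. \<Theta> i \<in> F \<and> \<Theta>' i \<in> F' \<and> compactin (mf_top M) (K i) \<and> K i \<subseteq> fst (\<Theta> i) \<and>
                \<phi> ` K i \<subseteq> fst (\<Theta>' i) \<and> \<epsilon> i > 0) \<and>
        (\<forall>x\<in>topspace (mf_top M). \<exists>W. openin (mf_top M) W \<and> x \<in> W \<and>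
                finite {i \<in> I. fst (\<Theta> i) \<inter> W \<noteq> {}})}"

definition sp_topology ::
  "enat \<Rightarrow> ('a, 't::euclidean_space \<times> 'b::euclidean_space) mfd \<Rightarrow> ('a, 't \<times> 'b) chart set \<Rightarrow>
   ('c, 'u::euclidean_space \<times> 'd::euclidean_space) mfd \<Rightarrow> ('c, 'u \<times> 'd) chart set \<Rightarrow>
   ('a \<Rightarrow> 'c) topology"
where
  "sp_topology r M F M' F' =
     topology_generated_by
       (case r of
          enat s \<Rightarrow> sp_base s M F M' F'
        | \<infinity> \<Rightarrow> {foliation_maps \<infinity> M F M' F' \<inter> N | s N. N \<in> sp_base s M F M' F'})"


section \<open>Residual sets\<close>

definition residual_in :: "'a topology \<Rightarrow> 'a set \<Rightarrow> bool" where
  "residual_in X S \<longleftrightarrow>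
     S \<subseteq> topspace X \<and>
     (\<exists>\<G>. countable \<G> \<and> (\<forall>G\<in>\<G>. openin X G \<and> X closure_of G = topspace X) \<and>
          topspace X \<inter> \<Inter>\<G> \<subseteq> S)"

end

theory Submission
  imports Defs
begin

text \<open>
  Near a point of \<open>A\<close> there is a foliation chart of \<open>F'\<close> in which \<open>A\<close> is given by the vanishing of
  the component of the leaf coordinate in a subspace \<open>E\<close>; its existence is the inverse function
  theorem and uses that \<open>A\<close> is transverse to \<open>F'\<close>. In such a chart, transversality of \<open>\<phi>\<close> to \<open>A\<close>
  means that \<open>0\<close> is a regular value of the \<open>E\<close>-component \<open>f\<close> of \<open>\<phi>\<close>, and \<open>f\<close> may be changed freely
  without leaving the plaques. By second countability it therefore suffices that, for a small compact
  ball \<open>K\<close> of \<open>M\<close> and a compact set \<open>W\<close> in such a chart, the maps \<open>\<phi>\<close> which are transverse on \<open>K\<close>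
  or do not send \<open>K\<close> into \<open>W\<close> form a dense open set.

  For the density, \<open>f\<close> is first replaced by a nearby map of class C^2 (only needed for \<open>r = 1\<close>) and then
  by \<open>f + L + v\<close> with \<open>(L, v)\<close> a small affine map. If \<open>f + L + v\<close> is not regular at a zero \<open>x\<close>, then some
  row of \<open>L\<close> and the vector \<open>v\<close> are determined by \<open>x\<close>, the other rows, and the coefficients of a linear
  relation between the rows of the derivative. These data have one dimension less than \<open>(L, v)\<close>, so
  the bad \<open>(L, v)\<close> form a null set. Unlike for a generic constant \<open>v\<close>, which needs Sard's theorem
  and many derivatives, class C^2 suffices here.
\<close>

section \<open>Orthogonal projection onto a subspace\<close>

text \<open>A neighbourhood in the sp-topology imposes infinitely many conditions, in charts
  unrelated to the one in which a map is perturbed. They survive small perturbations for two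
  reasons: the perturbation has compact support, which meets only finitely many charts of a locally
  finite family, and the perturbed map depends continuously on its parameter together with its
  derivatives in x, so that a strict inequality on a compact set persists. The equality of local
  projections is not an open condition; it is kept because the displacement follows the plaques.
  Hence the calculus is done for families of maps with a parameter (\<epsilon>, L, v), in which they
  are continuous but not differentiated. The smoothing has to belong to the same family, continuous
  in class C^1 down to \<epsilon> = 0; iterated averages over coordinate segments of length
  |\<epsilon>| have this property. The model spaces are subspaces V, possibly {0}. A derivative
  within V is determined only on V, so directions are projected onto V, and the projected basis
  vectors take the place of coordinates.\<close>

definition oproj :: "'e::euclidean_space set \<Rightarrow> 'e \<Rightarrow> 'e" where
  "oproj V x = (SOME y. y \<in> V \<and> (\<forall>w\<in>V. (x - y) \<bullet> w = 0))"

context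
  fixes V :: "'e::euclidean_space set"
  assumes V: "subspace V"
begin

lemma oproj_spec: "oproj V x \<in> V \<and> (\<forall>w\<in>V. (x - oproj V x) \<bullet> w = 0)"
proof -
  obtain y z where "y \<in> span V" "\<And>w. w \<in> span V \<Longrightarrow> orthogonal z w" "x = y + z"
    using orthogonal_subspace_decomp_exists[of V x] by blast
  then have "y \<in> V \<and> (\<forall>w\<in>V. (x - y) \<bullet> w = 0)"
    using V by (simp add: orthogonal_def span_eq_iff[THEN iffD2])
  then show ?thesis
    unfolding oproj_def by (rule someI)
qed

lemma oproj_in [simp]: "oproj V x \<in> V"
  using oproj_spec by blast

lemma oproj_orth: "w \<in> V \<Longrightarrow> (x - oproj V x) \<bullet> w = 0"
  using oproj_spec by blast

lemma oproj_unique: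
  assumes "y \<in> V" "\<And>w. w \<in> V \<Longrightarrow> (x - y) \<bullet> w = 0"
  shows "oproj V x = y"
proof -
  have "oproj V x - y \<in> V"
    by (simp add: V assms(1) subspace_diff)
  then have "(x - y) \<bullet> (oproj V x - y) - (x - oproj V x) \<bullet> (oproj V x - y) = 0"
    using assms(2) oproj_orth by simp
  then have "(oproj V x - y) \<bullet> (oproj V x - y) = 0"
    by (simp add: inner_diff_left)
  then show ?thesis by simp
qed

lemma oproj_id [simp]: "x \<in> V \<Longrightarrow> oproj V x = x"
  by (rule oproj_unique) auto

lemma linear_oproj: "linear (oproj V)"
proof (rule linearI)
  fix x y show "oproj V (x + y) = oproj V x + oproj V y"
  proof (rule oproj_unique)
    show "oproj V x + oproj V y \<in> V" by (simp add: V subspace_add)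
    fix w assume "w \<in> V"
    then show "(x + y - (oproj V x + oproj V y)) \<bullet> w = 0"
      using oproj_orth[of w x] oproj_orth[of w y] by (simp add: inner_simps)
  qed
next
  fix c x show "oproj V (c *\<^sub>R x) = c *\<^sub>R oproj V x"
  proof (rule oproj_unique)
    show "c *\<^sub>R oproj V x \<in> V" by (simp add: V subspace_scale)
    fix w assume "w \<in> V"
    then show "(c *\<^sub>R x - c *\<^sub>R oproj V x) \<bullet> w = 0"
      using oproj_orth[of w x] by (simp add: inner_simps)
  qed
qed

lemma oproj_inner: "w \<in> V \<Longrightarrow> oproj V x \<bullet> w = x \<bullet> w"
  using oproj_orth[of w x] by (simp add: inner_simps)

lemma oproj_adjoint: "oproj V x \<bullet> y = x \<bullet> oproj V y"
  by (metis inner_commute oproj_in oproj_inner)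

lemma norm_oproj: "norm (oproj V x) \<le> norm x"
proof -
  have "norm (oproj V x) * norm (oproj V x) = x \<bullet> oproj V x"
    by (metis oproj_adjoint oproj_id oproj_in power2_norm_eq_inner power2_eq_square)
  also have "\<dots> \<le> norm x * norm (oproj V x)" by (rule norm_cauchy_schwarz)
  finally show ?thesis
    by (metis mult_le_cancel_right norm_ge_zero order_antisym_conv linorder_not_le norm_le_zero_iff norm_zero)
qed

text \<open>The projection fixes v, so applying it to the basis expansion of v expresses v through
  vectors of V. Thus the finitely many directions \<open>oproj V b\<close> determine a derivative
  within V, although the basis vectors themselves need not lie in V.\<close>

lemma linear_oproj_expand:
  assumes "linear D" "v \<in> V"
  shows "D v = (\<Sum>b\<in>Basis. (v \<bullet> b) *\<^sub>R D (oproj V b))"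
proof -
  have "v = oproj V (\<Sum>b\<in>Basis. (v \<bullet> b) *\<^sub>R b)"
    using assms(2) by (simp add: euclidean_representation)
  also have "\<dots> = (\<Sum>b\<in>Basis. (v \<bullet> b) *\<^sub>R oproj V b)"
    using linear_oproj by (simp add: linear_sum linear_scale)
  finally have "D v = D (\<Sum>b\<in>Basis. (v \<bullet> b) *\<^sub>R oproj V b)" by (rule arg_cong)
  then show ?thesis
    using assms(1) by (simp add: linear_sum linear_scale)
qed

text \<open>Along the line through x in direction v, which stays in V, the question becomes one
  about a function of a real variable, where derivatives are unique. Nothing follows for directions
  outside V.\<close>

lemma frechet_unique_subspace:
  fixes f :: "'e \<Rightarrow> 'f::euclidean_space"
  assumes "(f has_derivative D) (at x within V)" "(f has_derivative D') (at x within V)"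
    and x: "x \<in> V" and v: "v \<in> V"
  shows "D v = D' v"
proof -
  have line: "((\<lambda>t. f (x + t *\<^sub>R v)) has_derivative (\<lambda>t. E (t *\<^sub>R v))) (at 0)"
    if E: "(f has_derivative E) (at x within V)" for E
  proof (rule has_derivative_in_compose[where g = f and f = "\<lambda>t. x + t *\<^sub>R v" and s = UNIV])
    show "((\<lambda>t. x + t *\<^sub>R v) has_derivative (\<lambda>t. t *\<^sub>R v)) (at (0::real) within UNIV)"
      by (auto intro!: derivative_eq_intros)
    have "range (\<lambda>t. x + t *\<^sub>R v) \<subseteq> V"
      using x v V by (auto simp: subspace_add subspace_scale)
    then show "(f has_derivative E) (at (x + 0 *\<^sub>R v) within range (\<lambda>t. x + t *\<^sub>R v))"
      using has_derivative_subset[OF E] by simp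
  qed
  have "(\<lambda>t. D (t *\<^sub>R v)) = (\<lambda>t. D' (t *\<^sub>R v))"
    by (rule has_derivative_unique[OF line[OF assms(1)] line[OF assms(2)]])
  then have "D (1 *\<^sub>R v) = D' (1 *\<^sub>R v)" by (rule fun_cong)
  then show ?thesis by simp
qed

lemma frechet_derivative_eq:
  fixes f :: "'e \<Rightarrow> 'f::euclidean_space"
  assumes "(f has_derivative D) (at x within V)" "x \<in> V" "v \<in> V"
  shows "frechet_derivative f (at x within V) v = D v"
  using assms frechet_unique_subspace frechet_derivative_works differentiableI by metis

end

text \<open>The map \<open>oproj W \<circ> f\<close> agrees with f near x and has the derivative
  \<open>oproj W \<circ> D\<close>; uniqueness on V forces D v to be its own projection.\<close>

lemma has_derivative_in_subspace:
  fixes f :: "'e::euclidean_space \<Rightarrow> 'f::euclidean_space"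
  assumes V: "subspace V" and W: "subspace W"
    and D: "(f has_derivative D) (at x within V)" "x \<in> V" "v \<in> V"
    and e: "e > 0" "\<And>y. y \<in> V \<Longrightarrow> dist y x < e \<Longrightarrow> f y \<in> W"
  shows "D v \<in> W"
proof -
  have "bounded_linear (oproj W)"
    using linear_oproj[OF W] linear_conv_bounded_linear by blast
  then have "((\<lambda>y. oproj W (f y)) has_derivative (\<lambda>v. oproj W (D v))) (at x within V)"
    using D(1) by (rule bounded_linear.has_derivative)
  then have "(f has_derivative (\<lambda>v. oproj W (D v))) (at x within V)"
    by (rule has_derivative_transform_within[OF _ e(1) D(2)]) (simp add: e(2) W)
  then have "D v = oproj W (D v)"
    using frechet_unique_subspace[OF V D(1)] D by blast
  then show ?thesis
    by (metis W oproj_in)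
qed

section \<open>Parametrised maps of class C^k\<close>

text \<open>
  The parameter \<open>p\<close> is never differentiated: the iterated derivatives in the direction of \<open>V\<close> exist
  and are jointly continuous. For a one-point parameter space this is \<open>Ck_on\<close>.
\<close>

primrec pCk :: "nat \<Rightarrow> 'e::euclidean_space set \<Rightarrow> ('p::metric_space \<Rightarrow> 'e \<Rightarrow> 'f::euclidean_space) \<Rightarrow>
  ('p \<times> 'e) set \<Rightarrow> bool"
where
  "pCk 0 V f T \<longleftrightarrow> continuous_on T (\<lambda>z. f (fst z) (snd z))"
| "pCk (Suc k) V f T \<longleftrightarrow> continuous_on T (\<lambda>z. f (fst z) (snd z)) \<and>
     (\<forall>z\<in>T. f (fst z) differentiable (at (snd z) within V)) \<and>
     (\<forall>v\<in>V. pCk k V (\<lambda>p x. frechet_derivative (f p) (at x within V) v) T)"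

text \<open>Only the slices at a fixed parameter have to be open in V, since derivatives are taken
  in the second variable alone. A product \<open>P \<times> S\<close> therefore qualifies for every
  parameter set P if S is open in V.\<close>

definition secs_open :: "'e::euclidean_space set \<Rightarrow> ('p \<times> 'e) set \<Rightarrow> bool" where
  "secs_open V T \<longleftrightarrow> (\<forall>z\<in>T. snd z \<in> V \<and> (\<exists>e>0. \<forall>y\<in>V. dist y (snd z) < e \<longrightarrow> (fst z, y) \<in> T))"

lemma secs_openE:
  assumes "secs_open V T" "(p, x) \<in> T"
  obtains e where "e > 0" "\<And>y. y \<in> V \<Longrightarrow> dist y x < e \<Longrightarrow> (p, y) \<in> T" "x \<in> V"
proof -
  have "snd (p, x) \<in> V \<and> (\<exists>e>0. \<forall>y\<in>V. dist y (snd (p, x)) < e \<longrightarrow> (fst (p, x), y) \<in> T)"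
    using assms unfolding secs_open_def by blast
  then show ?thesis using that by auto
qed

lemma secs_open_in: "secs_open V T \<Longrightarrow> (p, x) \<in> T \<Longrightarrow> x \<in> V"
  unfolding secs_open_def by (drule (1) bspec) simp

lemma pCk_continuous: "pCk k V f T \<Longrightarrow> continuous_on T (\<lambda>z. f (fst z) (snd z))"
  by (cases k) auto

lemma pCk_SucD: "pCk (Suc k) V f T \<Longrightarrow> pCk k V f T"
proof (induction k arbitrary: f)
  case (Suc k)
  have "pCk (Suc k) V (\<lambda>p x. frechet_derivative (f p) (at x within V) v) T" if "v \<in> V" for v
    using Suc.prems that by (subst (asm) pCk.simps(2)) blast
  with Suc.prems show ?case
    by (subst pCk.simps(2), subst (asm) pCk.simps(2)) (blast intro: Suc.IH)
qed simp

lemma pCk_mono: "pCk k V f T \<Longrightarrow> j \<le> k \<Longrightarrow> pCk j V f T"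
proof (induction k)
  case (Suc k)
  then show ?case using pCk_SucD[of k V f T] by (auto simp: le_Suc_eq simp del: pCk.simps)
qed simp

lemma pCk_subset: "pCk k V f T \<Longrightarrow> T' \<subseteq> T \<Longrightarrow> pCk k V f T'"
proof (induction k arbitrary: f)
  case 0
  then show ?case by (auto intro: continuous_on_subset)
next
  case (Suc k)
  have "continuous_on T' (\<lambda>z. f (fst z) (snd z))"
    by (rule continuous_on_subset[OF _ Suc.prems(2)]) (use Suc.prems in simp)
  moreover have "pCk k V (\<lambda>p x. frechet_derivative (f p) (at x within V) v) T'" if "v \<in> V" for v
    by (rule Suc.IH) (use Suc.prems that in simp_all)
  ultimately show ?case using Suc.prems by auto
qed

lemma pCk_has_derivative:
  assumes "pCk (Suc k) V f T" "z \<in> T"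
  shows "(f (fst z) has_derivative frechet_derivative (f (fst z)) (at (snd z) within V)) (at (snd z) within V)"
  using assms frechet_derivative_works by auto

lemma pCk_has_derivative':
  assumes "pCk (Suc k) V f T" "(p, x) \<in> T"
  shows "(f p has_derivative frechet_derivative (f p) (at x within V)) (at x within V)"
  using pCk_has_derivative[OF assms] by simp

lemma pCk_linear_frechet:
  assumes "pCk (Suc k) V f T" "z \<in> T"
  shows "linear (frechet_derivative (f (fst z)) (at (snd z) within V))"
  using has_derivative_linear[OF pCk_has_derivative[OF assms]] .

text \<open>Only continuity is a statement relative to T. The derivatives are taken within V, hence
  are the same maps on every piece.\<close>

lemma pCk_local:
  assumes "\<And>z. z \<in> T \<Longrightarrow> \<exists>T'. z \<in> T' \<and> openin (top_of_set T) T' \<and> pCk k V f T'"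
  shows "pCk k V f T"
  using assms
proof (induction k arbitrary: f)
  case 0
  have "continuous (at z within T) (\<lambda>z. f (fst z) (snd z))" if z: "z \<in> T" for z
  proof -
    obtain T' where T': "z \<in> T'" "openin (top_of_set T) T'" "pCk 0 V f T'"
      using 0 z by blast
    then obtain O' where O': "open O'" "T' = T \<inter> O'" by (auto simp: openin_open)
    have "continuous (at z within T') (\<lambda>z. f (fst z) (snd z))"
      using T' continuous_on_eq_continuous_within by fastforce
    moreover have "at z within T' = at z within T"
      by (rule at_within_nhd[where S = O']) (use O' T'(1) in auto)
    ultimately show ?thesis by simp
  qed
  then show ?case unfolding pCk.simps(1) continuous_on_eq_continuous_within by blast
next
  case (Suc k)
  have c: "continuous_on T (\<lambda>z. f (fst z) (snd z))"
  proof (rule pCk_continuous[OF Suc.IH])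
    fix z assume "z \<in> T"
    then obtain T' where "z \<in> T'" "openin (top_of_set T) T'" "pCk (Suc k) V f T'"
      using Suc.prems by blast
    then show "\<exists>T'. z \<in> T' \<and> openin (top_of_set T) T' \<and> pCk k V f T'"
      using pCk_SucD[of k V f T'] by blast
  qed
  have "f (fst z) differentiable (at (snd z) within V)" if "z \<in> T" for z
    using Suc.prems[OF that] unfolding pCk.simps(2) by blast
  moreover have "pCk k V (\<lambda>p x. frechet_derivative (f p) (at x within V) v) T" if "v \<in> V" for v
  proof (rule Suc.IH)
    fix z assume "z \<in> T"
    then show "\<exists>T'. z \<in> T' \<and> openin (top_of_set T) T' \<and>
        pCk k V (\<lambda>p x. frechet_derivative (f p) (at x within V) v) T'"
      using Suc.prems[of z] that unfolding pCk.simps(2) by blast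
  qed
  ultimately show ?case using c by simp
qed

lemma pCk_iter_continuous:
  assumes "pCk k V f T" "set vs \<subseteq> V" "length vs \<le> k"
  shows "continuous_on T (\<lambda>z. iter_deriv V vs (f (fst z)) (snd z))"
  using assms
proof (induction vs arbitrary: f k)
  case Nil
  then show ?case by (simp add: pCk_continuous)
next
  case (Cons v vs)
  then obtain j where j: "k = Suc j" by (cases k) auto
  then have "pCk j V (\<lambda>p x. frechet_derivative (f p) (at x within V) v) T"
    using Cons.prems by simp
  from Cons.IH[OF this] show ?case using Cons.prems j by simp
qed

text \<open>\<open>Ck_on\<close> records continuity of the derivatives of top order only; in lower
  orders it comes back from differentiability within V, restricted to S.\<close>

lemma Ck_on_imp_pCk:
  assumes "Ck_on k V f S" "S \<subseteq> V" "\<And>z. z \<in> T \<Longrightarrow> snd z \<in> S"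
  shows "pCk k V (\<lambda>_. f) T"
  using assms
proof (induction k arbitrary: f)
  case 0
  then have "continuous_on (snd ` T) f"
    by (auto intro: continuous_on_subset)
  then have "continuous_on T (f \<circ> snd)"
    by (intro continuous_on_compose continuous_on_snd continuous_on_id)
  then show ?case by (simp add: o_def)
next
  case (Suc k)
  have "continuous_on S f"
    unfolding continuous_on_eq_continuous_within
  proof
    fix x assume "x \<in> S"
    then have "continuous (at x within V) f"
      using Suc.prems(1) by (intro differentiable_imp_continuous_within) simp
    then show "continuous (at x within S) f"
      using Suc.prems(2) by (rule continuous_within_subset)
  qed
  then have "continuous_on (snd ` T) f" using Suc.prems(3) by (auto intro: continuous_on_subset)
  then have "continuous_on T (f \<circ> snd)"
    by (intro continuous_on_compose continuous_on_snd continuous_on_id)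
  then have "continuous_on T (\<lambda>z. f (snd z))" by (simp add: o_def)
  moreover have "pCk k V (\<lambda>_ x. frechet_derivative f (at x within V) v) T" if "v \<in> V" for v
    using Suc.IH[of "\<lambda>x. frechet_derivative f (at x within V) v"] Suc.prems that by auto
  ultimately show ?case using Suc.prems by auto
qed

lemma pCk_imp_Ck_on:
  assumes "pCk k V f T" "\<And>x. x \<in> S \<Longrightarrow> (p, x) \<in> T"
  shows "Ck_on k V (f p) S"
  using assms
proof (induction k arbitrary: f)
  case 0
  have "continuous_on S (\<lambda>x. (p, x))" by (intro continuous_intros)
  then have "continuous_on S ((\<lambda>z. f (fst z) (snd z)) \<circ> (\<lambda>x. (p, x)))"
    by (rule continuous_on_compose) (use 0 in \<open>auto intro: continuous_on_subset\<close>)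
  then show ?case by (simp add: o_def)
next
  case (Suc k)
  then show ?case by fastforce
qed

section \<open>Rules of calculus for parametrised maps\<close>

context
  fixes V :: "'e::euclidean_space set" and T :: "('p::metric_space \<times> 'e) set"
  assumes V: "subspace V" and T: "secs_open V T"
begin

lemma has_derivative_cong_section:
  assumes "(p, x) \<in> T" "\<And>y. (p, y) \<in> T \<Longrightarrow> f y = g y"
  shows "(f has_derivative D) (at x within V) = (g has_derivative D) (at x within V)"
proof -
  obtain e where e: "e > 0" "\<And>y. y \<in> V \<Longrightarrow> dist y x < e \<Longrightarrow> (p, y) \<in> T" and x: "x \<in> V"
    using secs_openE[OF T assms(1)] by blast
  show ?thesis
  proof
    assume "(f has_derivative D) (at x within V)"
    then show "(g has_derivative D) (at x within V)"
      by (rule has_derivative_transform_within[OF _ e(1) x]) (use e assms(2) in blast)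
  next
    assume "(g has_derivative D) (at x within V)"
    then show "(f has_derivative D) (at x within V)"
      by (rule has_derivative_transform_within[OF _ e(1) x]) (use e assms(2) in simp)
  qed
qed

lemma pCk_cong:
  assumes "pCk k V f T" "\<And>z. z \<in> T \<Longrightarrow> f (fst z) (snd z) = g (fst z) (snd z)"
  shows "pCk k V g T"
  using assms
proof (induction k arbitrary: f g)
  case 0
  then show ?case
    unfolding pCk.simps(1) by (rule continuous_on_eq)
next
  case (Suc k)
  have d: "(f p has_derivative D) (at x within V) = (g p has_derivative D) (at x within V)"
    if "(p, x) \<in> T" for p x D
    by (rule has_derivative_cong_section[OF that]) (use Suc.prems(2) in force)
  \<comment> \<open>\<open>frechet_derivative\<close> is a choice. Since f p and g p admit the same
    derivatives at x, the choices coincide as functions, off V as well.\<close>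
  have fr: "frechet_derivative (f p) (at x within V) = frechet_derivative (g p) (at x within V)"
    if "(p, x) \<in> T" for p x
    unfolding frechet_derivative_def d[OF that] ..
  have "continuous_on T (\<lambda>z. g (fst z) (snd z))"
    by (rule continuous_on_eq[OF pCk_continuous[OF Suc.prems(1)] Suc.prems(2)])
  moreover have "g (fst z) differentiable (at (snd z) within V)" if z: "z \<in> T" for z
  proof -
    obtain D where "(f (fst z) has_derivative D) (at (snd z) within V)"
      using pCk_has_derivative[OF Suc.prems(1) z] by blast
    then have "(g (fst z) has_derivative D) (at (snd z) within V)"
      using d[of "fst z" "snd z" D] z by simp
    then show ?thesis by (rule differentiableI)
  qed
  moreover have "pCk k V (\<lambda>p x. frechet_derivative (g p) (at x within V) v) T" if "v \<in> V" for v
  proof (rule Suc.IH)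
    show "pCk k V (\<lambda>p x. frechet_derivative (f p) (at x within V) v) T"
      using Suc.prems(1) that unfolding pCk.simps(2) by blast
    show "frechet_derivative (f (fst z)) (at (snd z) within V) v =
        frechet_derivative (g (fst z)) (at (snd z) within V) v" if "z \<in> T" for z
      using fr[of "fst z" "snd z"] that by simp
  qed
  ultimately show ?case unfolding pCk.simps(2) by blast
qed

text \<open>Any family D of derivatives may be supplied: it agrees with the chosen
  \<open>frechet_derivative\<close> on V, and only directions in V are ever evaluated.\<close>

lemma pCk_SucI:
  assumes "continuous_on T (\<lambda>z. f (fst z) (snd z))"
    and D: "\<And>p x. (p, x) \<in> T \<Longrightarrow> (f p has_derivative D p x) (at x within V)"
    and "\<And>v. v \<in> V \<Longrightarrow> pCk k V (\<lambda>p x. D p x v) T"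
  shows "pCk (Suc k) V f T"
proof -
  have "pCk k V (\<lambda>p x. frechet_derivative (f p) (at x within V) v) T" if "v \<in> V" for v
  proof (rule pCk_cong[OF assms(3)[OF that]])
    fix z assume "z \<in> T"
    then have "(f (fst z) has_derivative D (fst z) (snd z)) (at (snd z) within V)" "snd z \<in> V"
      using D[of "fst z" "snd z"] T by (auto simp: secs_open_def)
    then show "D (fst z) (snd z) v = frechet_derivative (f (fst z)) (at (snd z) within V) v"
      using frechet_derivative_eq[OF V _ _ that] by metis
  qed
  moreover have "f (fst z) differentiable (at (snd z) within V)" if "z \<in> T" for z
    using differentiableI[OF D[of "fst z" "snd z"]] that by simp
  ultimately show ?thesis using assms(1) unfolding pCk.simps(2) by blast
qed

lemma pCk_param: "continuous_on T (\<lambda>z. h (fst z)) \<Longrightarrow> pCk k V (\<lambda>p x. h p) T"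
proof (induction k arbitrary: h)
  case (Suc k)
  have "pCk k V (\<lambda>p x. 0 :: 'a) T"
    by (rule Suc.IH) (rule continuous_on_const)
  with Suc.prems show ?case
    by (intro pCk_SucI[where D = "\<lambda>_ _ _. 0"] has_derivative_const)
qed simp

lemma pCk_const: "pCk k V (\<lambda>p x. c) T"
  by (rule pCk_param) simp

lemma pCk_ident: "pCk k V (\<lambda>p x. x) T"
proof (cases k)
  case 0
  then show ?thesis by (simp add: continuous_on_snd)
next
  case (Suc j)
  show ?thesis unfolding Suc
    by (rule pCk_SucI[where D = "\<lambda>_ _ v. v"]) (auto simp: pCk_const intro!: continuous_intros)
qed

lemma pCk_add:
  assumes "pCk k V f T" "pCk k V g T"
  shows "pCk k V (\<lambda>p x. f p x + g p x) T"
  using assms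
proof (induction k arbitrary: f g)
  case 0
  then show ?case by (auto intro: continuous_intros)
next
  case (Suc k)
  show ?case
  proof (rule pCk_SucI)
    show "continuous_on T (\<lambda>z. f (fst z) (snd z) + g (fst z) (snd z))"
      using Suc.prems by (auto intro: continuous_intros)
    fix p x assume "(p, x) \<in> T"
    then show "((\<lambda>x. f p x + g p x) has_derivative (\<lambda>v. frechet_derivative (f p) (at x within V) v +
       frechet_derivative (g p) (at x within V) v)) (at x within V)"
      using Suc.prems by (intro has_derivative_add pCk_has_derivative')
  next
    fix v assume "v \<in> V"
    then show "pCk k V (\<lambda>p x. frechet_derivative (f p) (at x within V) v +
       frechet_derivative (g p) (at x within V) v) T"
      using Suc.prems by (intro Suc.IH) simp_all
  qed
qed

lemma pCk_bilinear:
  fixes B :: "'f::euclidean_space \<Rightarrow> 'g::euclidean_space \<Rightarrow> 'h::euclidean_space"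
  assumes B: "bounded_bilinear B" and "pCk k V f T" "pCk k V g T"
  shows "pCk k V (\<lambda>p x. B (f p x) (g p x)) T"
  using assms(2,3)
proof (induction k arbitrary: f g)
  case 0
  then show ?case unfolding pCk.simps(1) by (rule bounded_bilinear.continuous_on[OF B])
next
  case (Suc k)
  show ?case
  proof (rule pCk_SucI)
    show "continuous_on T (\<lambda>z. B (f (fst z) (snd z)) (g (fst z) (snd z)))"
      by (rule bounded_bilinear.continuous_on[OF B pCk_continuous[OF Suc.prems(1)] pCk_continuous[OF Suc.prems(2)]])
    fix p x assume "(p, x) \<in> T"
    then show "((\<lambda>x. B (f p x) (g p x)) has_derivative
       (\<lambda>v. B (f p x) (frechet_derivative (g p) (at x within V) v) +
         B (frechet_derivative (f p) (at x within V) v) (g p x))) (at x within V)"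
      using Suc.prems by (intro bounded_bilinear.FDERIV[OF B] pCk_has_derivative')
  next
    fix v assume "v \<in> V"
    then show "pCk k V (\<lambda>p x. B (f p x) (frechet_derivative (g p) (at x within V) v) +
         B (frechet_derivative (f p) (at x within V) v) (g p x)) T"
      using Suc.prems by (intro pCk_add Suc.IH) (simp_all add: pCk_SucD[OF Suc.prems(1)] pCk_SucD[OF Suc.prems(2)])
  qed
qed

lemma pCk_linear:
  fixes B :: "'f::euclidean_space \<Rightarrow> 'g::euclidean_space"
  assumes B: "linear B" and "pCk k V f T"
  shows "pCk k V (\<lambda>p x. B (f p x)) T"
  using assms(2)
proof (induction k arbitrary: f)
  case 0
  have "bounded_linear B" using B linear_conv_bounded_linear by blast
  with 0 show ?case unfolding pCk.simps(1) by (rule bounded_linear.continuous_on[rotated])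
next
  case (Suc k)
  have bl: "bounded_linear B" using B linear_conv_bounded_linear by blast
  show ?case
  proof (rule pCk_SucI)
    show "continuous_on T (\<lambda>z. B (f (fst z) (snd z)))"
      by (rule bounded_linear.continuous_on[OF bl pCk_continuous[OF Suc.prems]])
    fix p x assume "(p, x) \<in> T"
    then show "((\<lambda>x. B (f p x)) has_derivative (\<lambda>v. B (frechet_derivative (f p) (at x within V) v))) (at x within V)"
      using Suc.prems by (intro bounded_linear.has_derivative[OF bl] pCk_has_derivative')
  next
    fix v assume "v \<in> V"
    then show "pCk k V (\<lambda>p x. B (frechet_derivative (f p) (at x within V) v)) T"
      using Suc.prems by (intro Suc.IH) simp
  qed
qed

lemma pCk_uminus:
  assumes "pCk k V f T"
  shows "pCk k V (\<lambda>p x. - f p x) T"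
  by (rule pCk_linear[of uminus, OF _ assms]) (rule linearI; simp)

lemma pCk_diff:
  assumes "pCk k V f T" "pCk k V g T"
  shows "pCk k V (\<lambda>p x. f p x - g p x) T"
  using pCk_add[OF assms(1) pCk_uminus[OF assms(2)]] by simp

lemma pCk_sum:
  "(\<And>i. i \<in> I \<Longrightarrow> pCk k V (f i) T) \<Longrightarrow> pCk k V (\<lambda>p x. \<Sum>i\<in>I. f i p x) T"
  by (induction I rule: infinite_finite_induct) (auto simp: pCk_const pCk_add)

lemma pCk_scaleR:
  assumes "pCk k V f T" "pCk k V g T"
  shows "pCk k V (\<lambda>p x. f p x *\<^sub>R g p x) T"
  by (rule pCk_bilinear[OF bounded_bilinear_scaleR assms])

lemma pCk_inner:
  assumes "pCk k V f T" "pCk k V g T"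
  shows "pCk k V (\<lambda>p x. f p x \<bullet> g p x) T"
  by (rule pCk_bilinear[OF bounded_bilinear_inner assms])

lemma at_within_section:
  assumes "(p, x) \<in> T"
  shows "at x within {y. (p, y) \<in> T} = at x within V"
proof -
  obtain e where e: "e > 0" "\<And>y. y \<in> V \<Longrightarrow> dist y x < e \<Longrightarrow> (p, y) \<in> T" and "x \<in> V"
    using secs_openE[OF T assms] by blast
  have "{y. (p, y) \<in> T} \<subseteq> V" using secs_open_in[OF T] by blast
  then show ?thesis
    by (intro at_within_nhd[where S = "ball x e"]) (use e in \<open>auto simp: dist_commute\<close>)
qed

text \<open>The chain rule evaluates the derivative of g in a direction that moves with x. Expanding
  this direction over the projected basis of W leaves derivatives of g in constant directions, to
  which the induction hypothesis applies. The expansion requires the direction to lie in W, as f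
  takes its values there on every slice of T.\<close>

lemma pCk_compose:
  fixes g :: "'p \<Rightarrow> 'w::euclidean_space \<Rightarrow> 'h::euclidean_space"
  assumes W: "subspace W" and U: "secs_open W U"
    and "pCk k V f T" "pCk k W g U"
    and fT: "\<And>p x. (p, x) \<in> T \<Longrightarrow> (p, f p x) \<in> U"
  shows "pCk k V (\<lambda>p x. g p (f p x)) T"
  using assms(3,4)
proof (induction k arbitrary: g)
  case 0
  have "continuous_on T ((\<lambda>z. g (fst z) (snd z)) \<circ> (\<lambda>z. (fst z, f (fst z) (snd z))))"
  proof (rule continuous_on_compose)
    show "continuous_on T (\<lambda>z. (fst z, f (fst z) (snd z)))"
      by (intro continuous_on_Pair continuous_on_fst continuous_on_id pCk_continuous[OF 0(1)])
    have "(\<lambda>z. (fst z, f (fst z) (snd z))) ` T \<subseteq> U" using fT by auto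
    then show "continuous_on ((\<lambda>z. (fst z, f (fst z) (snd z))) ` T) (\<lambda>z. g (fst z) (snd z))"
      by (rule continuous_on_subset[OF pCk_continuous[OF 0(2)]])
  qed
  then show ?case by (simp add: o_def)
next
  case (Suc k)
  have fW: "f p x \<in> W" if "(p, x) \<in> T" for p x
    by (rule secs_open_in[OF U fT[OF that]])
  have D: "frechet_derivative (f p) (at x within V) v \<in> W" if px: "(p, x) \<in> T" "v \<in> V" for p x v
  proof -
    obtain e where e: "e > 0" "\<And>y. y \<in> V \<Longrightarrow> dist y x < e \<Longrightarrow> (p, y) \<in> T" and "x \<in> V"
      using secs_openE[OF T px(1)] by blast
    show ?thesis
      by (rule has_derivative_in_subspace[OF V W pCk_has_derivative'[OF Suc.prems(1) px(1)] \<open>x \<in> V\<close> px(2) e(1)])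
        (use e(2) fW in blast)
  qed
  show ?case
  proof (rule pCk_SucI)
    have "pCk k V (\<lambda>p x. g p (f p x)) T"
      by (rule Suc.IH[OF pCk_SucD[OF Suc.prems(1)] pCk_SucD[OF Suc.prems(2)]])
    then show "continuous_on T (\<lambda>z. g (fst z) (f (fst z) (snd z)))"
      by (rule pCk_continuous)
  next
    fix p x assume px: "(p, x) \<in> T"
    \<comment> \<open>On the slice f p takes values in W; elsewhere in V it may not. Near x the
      slice is all of V, so the two filters agree.\<close>
    let ?S = "{y. (p, y) \<in> T}"
    have "((\<lambda>x. g p (f p x)) has_derivative (\<lambda>v. frechet_derivative (g p) (at (f p x) within W)
        (frechet_derivative (f p) (at x within V) v))) (at x within ?S)"
    proof (rule has_derivative_in_compose[where f = "f p" and g = "g p"])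
      show "(f p has_derivative frechet_derivative (f p) (at x within V)) (at x within ?S)"
        unfolding at_within_section[OF px] by (rule pCk_has_derivative'[OF Suc.prems(1) px])
      show "(g p has_derivative frechet_derivative (g p) (at (f p x) within W)) (at (f p x) within f p ` ?S)"
        by (rule has_derivative_subset[OF pCk_has_derivative'[OF Suc.prems(2) fT[OF px]]]) (use fW in auto)
    qed
    then show "((\<lambda>x. g p (f p x)) has_derivative (\<lambda>v. frechet_derivative (g p) (at (f p x) within W)
        (frechet_derivative (f p) (at x within V) v))) (at x within V)"
      unfolding at_within_section[OF px] .
  next
    fix v assume v: "v \<in> V"
    have "pCk k V (\<lambda>p x. \<Sum>b\<in>Basis. (frechet_derivative (f p) (at x within V) v \<bullet> b) *\<^sub>R
        frechet_derivative (g p) (at (f p x) within W) (oproj W b)) T"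
    proof (intro pCk_sum pCk_scaleR pCk_inner pCk_const)
      show "pCk k V (\<lambda>p x. frechet_derivative (f p) (at x within V) v) T"
        using Suc.prems(1) v unfolding pCk.simps(2) by blast
      show "pCk k V (\<lambda>p x. frechet_derivative (g p) (at (f p x) within W) (oproj W b)) T" for b
        using Suc.prems(2) oproj_in[OF W] unfolding pCk.simps(2)
        by (intro Suc.IH pCk_SucD[OF Suc.prems(1)]) blast
    qed
    then show "pCk k V (\<lambda>p x. frechet_derivative (g p) (at (f p x) within W)
        (frechet_derivative (f p) (at x within V) v)) T"
    proof (rule pCk_cong, goal_cases)
      case (1 z)
      then have "(fst z, f (fst z) (snd z)) \<in> U" using fT by simp
      from linear_oproj_expand[OF W pCk_linear_frechet[OF Suc.prems(2) this], symmetric]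
      show ?case using D[of "fst z" "snd z" v] v 1 by simp
    qed
  qed
qed

end

section \<open>Inverses\<close>

text \<open>A lower bound c for A z0 survives as c / 2 for A z with z near z0, because \<delta> z
  bounds the operator norm of A z - A z0. It is applied to v = B z u - B z0 u, for which A z v = A
  z0 w - A z w with the fixed vector w = B z0 u.\<close>

lemma continuous_on_inverse_linear:
  fixes A B :: "'z::metric_space \<Rightarrow> 'f::euclidean_space \<Rightarrow> 'f"
  assumes A: "\<And>z. z \<in> T \<Longrightarrow> linear (A z)" and B: "\<And>z. z \<in> T \<Longrightarrow> linear (B z)"
    and BA: "\<And>z u. z \<in> T \<Longrightarrow> B z (A z u) = u" and AB: "\<And>z u. z \<in> T \<Longrightarrow> A z (B z u) = u"
    and cont: "\<And>u. continuous_on T (\<lambda>z. A z u)"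
  shows "continuous_on T (\<lambda>z. B z u)"
  unfolding continuous_on_def
proof
  fix z0 assume z0: "z0 \<in> T"
  have "inj (A z0)" using BA[OF z0] by (rule inj_on_inverseI)
  then obtain c where c: "c > 0" "\<And>v. c * norm v \<le> norm (A z0 v)"
    using linear_inj_bounded_below_pos[OF A[OF z0]] by blast
  define w where "w = B z0 u"
  define \<delta> where "\<delta> z = (\<Sum>b\<in>Basis. norm (A z b - A z0 b))" for z
  have lim: "((\<lambda>z. A z v) \<longlongrightarrow> A z0 v) (at z0 within T)" for v
    using cont z0 unfolding continuous_on_def by blast
  have "(\<delta> \<longlongrightarrow> (\<Sum>b\<in>(Basis::'f set). norm (A z0 b - A z0 b))) (at z0 within T)"
    unfolding \<delta>_def by (intro tendsto_intros lim)
  then have "(\<delta> \<longlongrightarrow> 0) (at z0 within T)" by simp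
  then have ev: "eventually (\<lambda>z. \<delta> z < c / 2) (at z0 within T)"
    by (rule order_tendstoD) (use c in simp)
  have bound: "norm (B z u - B z0 u) \<le> norm (A z0 w - A z w) * (2 / c)" if z: "z \<in> T" "\<delta> z < c / 2" for z
  proof -
    define v where "v = B z u - B z0 u"
    have "norm (A z v - A z0 v) \<le> \<delta> z * norm v"
    proof -
      have "A z v - A z0 v = (\<Sum>b\<in>Basis. (v \<bullet> b) *\<^sub>R (A z b - A z0 b))"
        using linear_oproj_expand[of UNIV "A z" v] linear_oproj_expand[of UNIV "A z0" v] A[OF z(1)] A[OF z0]
        by (simp add: scaleR_right_diff_distrib sum_subtractf)
      also have "norm \<dots> \<le> (\<Sum>b\<in>Basis. norm ((v \<bullet> b) *\<^sub>R (A z b - A z0 b)))"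
        by (rule norm_sum)
      also have "\<dots> \<le> (\<Sum>b\<in>Basis. norm v * norm (A z b - A z0 b))"
        by (rule sum_mono) (auto simp: Basis_le_norm intro!: mult_right_mono)
      finally show ?thesis by (simp add: \<delta>_def sum_distrib_left mult.commute)
    qed
    also have "\<dots> \<le> c / 2 * norm v" using z by (intro mult_right_mono) auto
    finally have 1: "norm (A z v - A z0 v) \<le> c / 2 * norm v" .
    have 2: "norm (A z0 v) \<le> norm (A z v) + norm (A z v - A z0 v)"
      by (metis norm_minus_commute norm_triangle_sub)
    have 3: "A z v = A z0 w - A z w"
      using linear_diff[OF A[OF z(1)]] AB[OF z(1)] AB[OF z0] by (simp add: v_def w_def)
    from c(2)[of v] 1 2 have "c / 2 * norm v \<le> norm (A z v)" by simp
    then have "norm v * c \<le> norm (A z v) * 2" by (simp add: mult.commute)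
    then have "norm v \<le> norm (A z v) * 2 / c" using c(1) by (simp add: pos_le_divide_eq)
    then show ?thesis by (simp add: v_def[symmetric] 3)
  qed
  have "((\<lambda>z. B z u - B z0 u) \<longlongrightarrow> 0) (at z0 within T)"
  proof (rule Lim_null_comparison)
    show "eventually (\<lambda>z. norm (B z u - B z0 u) \<le> norm (A z0 w - A z w) * (2 / c)) (at z0 within T)"
    proof -
      have "eventually (\<lambda>z. z \<in> T) (at z0 within T)" by (simp add: eventually_at_filter)
      with ev show ?thesis by eventually_elim (rule bound)
    qed
    have "((\<lambda>z. norm (A z0 w - A z w) * (2 / c)) \<longlongrightarrow> norm (A z0 w - A z0 w) * (2 / c)) (at z0 within T)"
      by (intro tendsto_intros lim)
    then show "((\<lambda>z. norm (A z0 w - A z w) * (2 / c)) \<longlongrightarrow> 0) (at z0 within T)" by simp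
  qed
  then show "((\<lambda>z. B z u) \<longlongrightarrow> B z0 u) (at z0 within T)"
    by (simp add: LIM_zero_iff)
qed

text \<open>Near x the scalar factor is O(|y - x|) and the other one is o(1), so the product is o(|y
  - x|) although h is only continuous. This is the error term in the derivative of an
  inverse.\<close>

lemma has_derivative_scaleR_null:
  fixes g :: "'e::real_normed_vector \<Rightarrow> real" and h :: "'e \<Rightarrow> 'f::real_normed_vector"
  assumes g: "(g has_derivative g') (at x within S)" "g x = 0"
    and h: "continuous (at x within S) h" "h x = 0" and "x \<in> S"
  shows "((\<lambda>y. g y *\<^sub>R h y) has_derivative (\<lambda>_. 0)) (at x within S)"
proof -
  have bl: "bounded_linear g'" using g(1) by (rule has_derivative_bounded_linear)
  then obtain K where K: "K > 0" "\<And>z. norm (g' z) \<le> norm z * K"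
    using bounded_linear.pos_bounded by blast
  obtain d where d: "d > 0" "\<And>y. y \<in> S \<Longrightarrow> norm (y - x) < d \<Longrightarrow> norm (g y - g x - g' (y - x)) \<le> 1 * norm (y - x)"
    using g(1) unfolding has_derivative_within_alt by (metis zero_less_one)
  have gb: "norm (g y) \<le> (K + 1) * norm (y - x)" if "y \<in> S" "norm (y - x) < d" for y
  proof -
    have "norm (g y) \<le> norm (g' (y - x)) + norm (g y - g' (y - x))"
      by (rule norm_triangle_sub)
    also have "\<dots> \<le> norm (y - x) * K + norm (y - x)"
      using d(2)[OF that] K(2)[of "y - x"] g(2) by simp
    finally show ?thesis by (simp add: algebra_simps)
  qed
  show ?thesis
    unfolding has_derivative_within_alt
  proof (intro conjI allI impI)
    show "bounded_linear (\<lambda>_::'e. 0::'f)" by simp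
    fix e :: real assume e: "e > 0"
    then have "e / (K + 1) > 0" using K by simp
    then obtain d2 where d2: "d2 > 0" "\<And>y. y \<in> S \<Longrightarrow> dist y x < d2 \<Longrightarrow> dist (h y) (h x) < e / (K + 1)"
      using h(1) unfolding continuous_within_eps_delta by metis
    show "\<exists>d>0. \<forall>y\<in>S. norm (y - x) < d \<longrightarrow> norm (g y *\<^sub>R h y - g x *\<^sub>R h x - 0) \<le> e * norm (y - x)"
    proof (intro exI[of _ "min d d2"] conjI ballI impI)
      show "min d d2 > 0" using d d2 by simp
      fix y assume y: "y \<in> S" "norm (y - x) < min d d2"
      then have "norm (h y) \<le> e / (K + 1)" using d2(2)[of y] h(2) by (simp add: dist_norm)
      then have "norm (g y) * norm (h y) \<le> ((K + 1) * norm (y - x)) * (e / (K + 1))"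
        using gb[of y] y by (intro mult_mono) (use K in auto)
      also have "\<dots> = e * norm (y - x)" using K by simp
      finally show "norm (g y *\<^sub>R h y - g x *\<^sub>R h x - 0) \<le> e * norm (y - x)"
        using g(2) by simp
    qed
  qed
qed

text \<open>With a y = A_y (B_x u) one has a x = u and B_y u = B_x u - B_x (a y - a x) - (B_y - B_x)
  (a y - a x). The middle term is differentiable because A is, and the last one, expanded over a
  basis, is a sum of products of a differentiable and a continuous factor both vanishing at x. So
  continuity of B already gives its derivative v \<mapsto> - B_x (A'_x(v) (B_x u)), which is built
  from B and A' and hence again of class k.\<close>

lemma pCk_inverse_linear:
  fixes A B :: "'p::metric_space \<Rightarrow> 'e::euclidean_space \<Rightarrow> 'f::euclidean_space \<Rightarrow> 'f"
  assumes V: "subspace V" and T: "secs_open V T"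
    and A: "\<And>p x. (p, x) \<in> T \<Longrightarrow> linear (A p x)" and B: "\<And>p x. (p, x) \<in> T \<Longrightarrow> linear (B p x)"
    and BA: "\<And>p x u. (p, x) \<in> T \<Longrightarrow> B p x (A p x u) = u" and AB: "\<And>p x u. (p, x) \<in> T \<Longrightarrow> A p x (B p x u) = u"
    and "\<And>u. pCk k V (\<lambda>p x. A p x u) T"
  shows "pCk k V (\<lambda>p x. B p x u) T"
  using assms(7)
proof (induction k arbitrary: u)
  case 0
  show ?case unfolding pCk.simps(1)
    by (rule continuous_on_inverse_linear[where A = "\<lambda>z. A (fst z) (snd z)"])
      (use A B BA AB 0 in \<open>auto\<close>)
next
  case (Suc k)
  have Bk: "pCk k V (\<lambda>p x. B p x u) T" for u
    by (rule Suc.IH[OF pCk_SucD[OF Suc.prems]])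
  have Bcont: "continuous_on T (\<lambda>z. B (fst z) (snd z) u)" for u
    by (rule pCk_continuous[OF Bk])
  define A' where "A' p x b v = frechet_derivative (\<lambda>y. A p y b) (at x within V) v" for p x b v
  have A'k: "pCk k V (\<lambda>p x. A' p x b v) T" if "v \<in> V" for b v
    using Suc.prems[of b] that unfolding pCk.simps(2) A'_def by blast
  have A'd: "((\<lambda>y. A p y b) has_derivative A' p x b) (at x within V)" if "(p, x) \<in> T" for p x b
    using pCk_has_derivative'[OF Suc.prems that] unfolding A'_def .
  \<comment> \<open>This is A'_x(v) applied to the vector B_x u, expanded over the basis because
    only the maps \<open>A p x b\<close> with constant b are known to be differentiable.\<close>
  define z where "z p x v = (\<Sum>b\<in>Basis. (B p x u \<bullet> b) *\<^sub>R A' p x b v)" for p x v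
  show ?case
  proof (rule pCk_SucI[OF V T])
    show "continuous_on T (\<lambda>z. B (fst z) (snd z) u)" by (rule Bcont)
  next
    fix p x assume px: "(p, x) \<in> T"
    let ?S = "{y. (p, y) \<in> T}"
    note sec = at_within_section[OF V T px]
    have "x \<in> ?S" using px by simp
    define w where "w = B p x u"
    define a where "a y = (\<Sum>b\<in>Basis. (w \<bullet> b) *\<^sub>R A p y b)" for y
    have a: "a y = A p y w" if "y \<in> ?S" for y
      using linear_oproj_expand[of UNIV "A p y" w] A[of p y] that by (simp add: a_def)
    have a': "(a has_derivative z p x) (at x within ?S)"
      unfolding a_def z_def w_def sec
      by (intro has_derivative_sum has_derivative_scaleR_right A'd px)
    have ad: "((\<lambda>y. a y - a x) has_derivative z p x) (at x within ?S)"
      using has_derivative_diff[OF a' has_derivative_const[of "a x"]] by simp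
    have bl: "bounded_linear (B p x)" using B[OF px] linear_conv_bounded_linear by blast
    have Bc: "continuous (at x within ?S) (\<lambda>y. B p y c - B p x c)" for c
    proof -
      have "continuous_on ?S ((\<lambda>z. B (fst z) (snd z) c) \<circ> (\<lambda>y. (p, y)))"
        by (intro continuous_on_compose continuous_intros continuous_on_subset[OF Bcont]) auto
      then have "continuous_on ?S (\<lambda>y. B p y c)" by (simp add: o_def)
      then show ?thesis
        using \<open>x \<in> ?S\<close> by (auto simp: continuous_on_eq_continuous_within intro!: continuous_intros)
    qed
    have rest: "((\<lambda>y. ((a y - a x) \<bullet> c) *\<^sub>R (B p y c - B p x c)) has_derivative (\<lambda>_. 0)) (at x within ?S)" for c
      by (rule has_derivative_scaleR_null[OF has_derivative_inner_left[OF ad]])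
        (use Bc \<open>x \<in> ?S\<close> in auto)
    have "((\<lambda>y. B p x u - B p x (a y - a x) - (\<Sum>c\<in>Basis. ((a y - a x) \<bullet> c) *\<^sub>R (B p y c - B p x c)))
       has_derivative (\<lambda>v. 0 - B p x (z p x v) - (\<Sum>c\<in>(Basis::'f set). 0))) (at x within ?S)"
      by (intro has_derivative_diff has_derivative_sum rest has_derivative_const
          bounded_linear.has_derivative[OF bl ad])
    then have "((\<lambda>y. B p y u) has_derivative (\<lambda>v. 0 - B p x (z p x v) - (\<Sum>c\<in>(Basis::'f set). 0))) (at x within ?S)"
    proof (rule has_derivative_transform_within[OF _ zero_less_one \<open>x \<in> ?S\<close>])
      fix y assume y: "y \<in> ?S"
      then have py: "(p, y) \<in> T" by simp
      have ax: "a x = u" using a[OF \<open>x \<in> ?S\<close>] AB[OF px] by (simp add: w_def)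
      have "B p y (a y - a x) = (\<Sum>c\<in>Basis. ((a y - a x) \<bullet> c) *\<^sub>R B p y c)"
        using linear_oproj_expand[of UNIV "B p y" "a y - a x"] B[OF py] by simp
      moreover have "B p x (a y - a x) = (\<Sum>c\<in>Basis. ((a y - a x) \<bullet> c) *\<^sub>R B p x c)"
        using linear_oproj_expand[of UNIV "B p x" "a y - a x"] B[OF px] by simp
      ultimately have "(\<Sum>c\<in>Basis. ((a y - a x) \<bullet> c) *\<^sub>R (B p y c - B p x c)) =
          B p y (a y - a x) - B p x (a y - a x)"
        by (simp add: scaleR_right_diff_distrib sum_subtractf)
      moreover have "B p y (a y - a x) = w - B p y u"
        using linear_diff[OF B[OF py]] a[OF y] BA[OF py] ax by simp
      ultimately show "B p x u - B p x (a y - a x) - (\<Sum>c\<in>Basis. ((a y - a x) \<bullet> c) *\<^sub>R (B p y c - B p x c)) = B p y u"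
        by (simp add: w_def)
    qed
    then show "((\<lambda>y. B p y u) has_derivative (\<lambda>v. - B p x (z p x v))) (at x within V)"
      by (simp add: sec)
  next
    fix v assume v: "v \<in> V"
    have zk: "pCk k V (\<lambda>p x. z p x v) T"
      unfolding z_def by (intro pCk_sum pCk_scaleR pCk_inner pCk_const Bk A'k V T v)
    have "pCk k V (\<lambda>p x. - (\<Sum>c\<in>Basis. (z p x v \<bullet> c) *\<^sub>R B p x c)) T"
      by (intro pCk_uminus pCk_sum pCk_scaleR pCk_inner pCk_const Bk zk V T)
    then show "pCk k V (\<lambda>p x. - B p x (z p x v)) T"
    proof (rule pCk_cong[OF V T])
      fix y assume "y \<in> T"
      then show "- (\<Sum>c\<in>Basis. (z (fst y) (snd y) v \<bullet> c) *\<^sub>R B (fst y) (snd y) c) =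
          - B (fst y) (snd y) (z (fst y) (snd y) v)"
        using linear_oproj_expand[of UNIV "B (fst y) (snd y)" "z (fst y) (snd y) v"] B[of "fst y" "snd y"] by simp
    qed
  qed
qed

text \<open>The number f p x is regarded as the linear map u \<mapsto> f p x u of the real
  line.\<close>

lemma pCk_inverse:
  fixes f :: "'p::metric_space \<Rightarrow> 'e::euclidean_space \<Rightarrow> real"
  assumes V: "subspace V" and T: "secs_open V T" and f: "pCk k V f T"
    and nz: "\<And>p x. (p, x) \<in> T \<Longrightarrow> f p x \<noteq> 0"
  shows "pCk k V (\<lambda>p x. inverse (f p x)) T"
proof -
  have "pCk k V (\<lambda>p x. inverse (f p x) *\<^sub>R (1::real)) T"
  proof (rule pCk_inverse_linear[OF V T, where A = "\<lambda>p x u. f p x *\<^sub>R u" and B = "\<lambda>p x u. inverse (f p x) *\<^sub>R u"])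
    show "pCk k V (\<lambda>p x. f p x *\<^sub>R u) T" for u :: real
      by (intro pCk_scaleR pCk_const f V T)
  qed (use nz in \<open>auto intro!: linearI simp: algebra_simps\<close>)
  then show ?thesis by simp
qed

section \<open>The inverse function theorem in class C^r\<close>

lemma secs_open_Times: "openin (top_of_set V) S \<Longrightarrow> secs_open V (P \<times> S)"
  unfolding secs_open_def openin_euclidean_subtopology_iff by force

lemma secs_open_UNIV: "open S \<Longrightarrow> secs_open UNIV (P \<times> S)"
  by (rule secs_open_Times) simp

text \<open>The C^1 theorem provides H and the formula H' y = (G' (H y))^(-1). The class is then
  raised by induction: if H is of class k, so is y \<mapsto> G' (H y), hence also its pointwise
  inverse H', and H is of class k + 1.\<close>

lemma Cr_inverse_function:
  fixes G :: "'f::euclidean_space \<Rightarrow> 'f"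
  assumes "1 \<le> r" and U: "open U" and G: "Cr_on r UNIV G U" and z0: "z0 \<in> U"
    and inj: "\<And>v. frechet_derivative G (at z0) v = 0 \<Longrightarrow> v = 0"
  obtains S S' H where "open S" "z0 \<in> S" "S \<subseteq> U" "open S'" "G z0 \<in> S'"
    "homeomorphism S S' G H" "Cr_on r UNIV H S'"
proof -
  have Gk: "Ck_on k UNIV G U" if "enat k \<le> r" for k
    using G that unfolding Cr_on_def by blast
  define G' where "G' x = frechet_derivative G (at x)" for x
  have "enat 1 \<le> r" using \<open>1 \<le> r\<close> by (simp add: one_enat_def)
  from Gk[OF this] have Gd: "G differentiable (at x)" and Gc: "continuous_on U (\<lambda>x. G' x v)" if "x \<in> U" for x v
    using that unfolding G'_def One_nat_def Ck_on.simps by blast+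
  have G'd: "(G has_derivative G' x) (at x)" if "x \<in> U" for x
    using Gd[OF that] unfolding G'_def frechet_derivative_works .
  have G'bl: "bounded_linear (G' x)" if "x \<in> U" for x
    by (rule has_derivative_bounded_linear[OF G'd[OF that]])
  have G'B: "blinfun_apply (Blinfun (G' x)) = G' x" if "x \<in> U" for x
    by (rule bounded_linear_Blinfun_apply[OF G'bl[OF that]])
  have "inj (G' z0)"
    using inj G'bl[OF z0] by (simp add: G'_def linear_injective_0 bounded_linear.linear)
  then obtain J where J: "linear J" "J \<circ> G' z0 = id"
    using linear_injective_left_inverse G'bl[OF z0] bounded_linear.linear by blast
  have JB: "blinfun_apply (Blinfun J) = J"
    using J linear_conv_bounded_linear bounded_linear_Blinfun_apply by blast
  obtain S S' H H' where S: "open S" "S \<subseteq> U" "z0 \<in> S" "open S'" "G z0 \<in> S'" and hom: "homeomorphism S S' G H"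
    and Hd: "\<And>y. y \<in> S' \<Longrightarrow> (H has_derivative (H' y)) (at y)"
    and H'eq: "\<And>y. y \<in> S' \<Longrightarrow> H' y = inv (blinfun_apply (Blinfun (G' (H y))))"
    and bij: "\<And>y. y \<in> S' \<Longrightarrow> bij (blinfun_apply (Blinfun (G' (H y))))"
  proof (rule inverse_function_theorem[OF U, of G "\<lambda>x. Blinfun (G' x)" z0 "Blinfun J"])
    show "(G has_derivative blinfun_apply (Blinfun (G' x))) (at x)" if "x \<in> U" for x
      using G'd[OF that] G'B[OF that] by simp
    show "continuous_on U (\<lambda>x. Blinfun (G' x))"
    proof (rule continuous_on_blinfun_componentwise)
      fix i :: 'f
      have "continuous_on U (\<lambda>x. G' x i)" using Gc z0 by blast
      then show "continuous_on U (\<lambda>x. blinfun_apply (Blinfun (G' x)) i)"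
        by (rule continuous_on_eq) (simp add: G'B)
    qed
    show "z0 \<in> U" by fact
    show "Blinfun J o\<^sub>L Blinfun (G' z0) = id_blinfun"
      using J(2) by (intro blinfun_eqI) (simp add: JB G'B[OF z0] fun_eq_iff)
  qed blast
  have HU: "H y \<in> U" if "y \<in> S'" for y
    using hom S(2) that unfolding homeomorphism_def by blast
  \<comment> \<open>The parameter of type \<open>real\<close> is a dummy, by which the parametrised
    calculus applies to a single map.\<close>
  have so: "secs_open UNIV ((UNIV::real set) \<times> S')" by (rule secs_open_UNIV) fact
  have Hk: "pCk k UNIV (\<lambda>_::real. H) (UNIV \<times> S')" if "enat k \<le> r" for k
    using that
  proof (induction k)
    case 0
    have "continuous_on S' H" using hom unfolding homeomorphism_def by blast
    then show ?case using Ck_on_imp_pCk[of 0 UNIV H S' "UNIV \<times> S'"] by auto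
  next
    case (Suc k)
    then have Hk: "pCk k UNIV (\<lambda>_::real. H) (UNIV \<times> S')"
      by (metis Suc_ile_eq order_less_imp_le)
    show ?case
    proof (rule pCk_SucI[OF subspace_UNIV so, where D = "\<lambda>p. H'"])
      show "continuous_on (UNIV \<times> S') (\<lambda>z::real \<times> 'f. H (snd z))"
        using pCk_continuous[OF Hk] .
      show "(H has_derivative H' x) (at x)" if "(p, x) \<in> (UNIV::real set) \<times> S'" for p x
        using Hd that by blast
      fix v :: 'f
      show "pCk k UNIV (\<lambda>p x. H' x v) ((UNIV::real set) \<times> S')"
      proof (rule pCk_inverse_linear[OF subspace_UNIV so, where A = "\<lambda>p y. G' (H y)"])
        fix p :: real and y u assume "(p, y) \<in> UNIV \<times> S'"
        then have y: "y \<in> S'" by simp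
        note H'y = H'eq[OF y, unfolded G'B[OF HU[OF y]]] and b = bij[OF y, unfolded G'B[OF HU[OF y]]]
        show "linear (G' (H y))" using G'bl HU y bounded_linear.linear by blast
        show "linear (H' y)" using Hd[OF y] has_derivative_linear by blast
        show "H' y (G' (H y) u) = u" "G' (H y) (H' y u) = u"
          unfolding H'y using b by (simp_all add: bij_is_inj bij_is_surj surj_f_inv_f)
      next
        fix u
        have "Ck_on k UNIV (\<lambda>x. G' x u) U"
          using Gk[OF Suc.prems] unfolding G'_def Ck_on.simps by blast
        then have "pCk k UNIV (\<lambda>_::real. \<lambda>x. G' x u) (UNIV \<times> U)"
          by (rule Ck_on_imp_pCk) auto
        from pCk_compose[OF subspace_UNIV so subspace_UNIV secs_open_UNIV[OF U] Hk this]
        show "pCk k UNIV (\<lambda>p y. G' (H y) u) ((UNIV::real set) \<times> S')"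
          using HU by auto
      qed
    qed
  qed
  have "Cr_on r UNIV H S'"
    unfolding Cr_on_def using pCk_imp_Ck_on[OF Hk] by blast
  with S hom that show thesis by blast
qed

section \<open>Bump functions\<close>

text \<open>The function exp(-1/t) t^(-j), extended by 0. The derivative of a member of this family
  is a linear combination of members, so smoothness of the case j = 0 is proved by an induction over
  all j at once.\<close>

definition flat_exp :: "nat \<Rightarrow> real \<Rightarrow> real" where
  "flat_exp j t = (if t > 0 then exp (- inverse t) * inverse t ^ j else 0)"

lemma flat_exp_tendsto_0: "((\<lambda>s. flat_exp j s / s) \<longlongrightarrow> 0) (at 0)"
proof (rule filterlim_split_at)
  have "eventually (\<lambda>s::real. 0 = flat_exp j s / s) (at_left 0)"
    unfolding eventually_at_filter by (auto simp: flat_exp_def)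
  then show "((\<lambda>s. flat_exp j s / s) \<longlongrightarrow> 0) (at_left 0)"
    by (rule Lim_transform_eventually[OF tendsto_const])
  have "((\<lambda>s. inverse s ^ Suc j / exp (inverse s)) \<longlongrightarrow> 0) (at_right (0::real))"
    by (rule filterlim_compose[OF tendsto_power_div_exp_0 filterlim_inverse_at_top_right])
  moreover have "eventually (\<lambda>s::real. inverse s ^ Suc j / exp (inverse s) = flat_exp j s / s) (at_right 0)"
    unfolding eventually_at_filter
    by (auto simp: flat_exp_def exp_minus field_simps)
  ultimately show "((\<lambda>s. flat_exp j s / s) \<longlongrightarrow> 0) (at_right 0)"
    by (rule Lim_transform_eventually)
qed

lemma DERIV_flat_exp:
  "(flat_exp j has_real_derivative flat_exp (j + 2) t - real j * flat_exp (j + 1) t) (at t)"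
proof -
  consider "t > 0" | "t < 0" | "t = 0" by linarith
  then show ?thesis
  proof cases
    case 1
    have "((\<lambda>t. exp (- inverse t) * inverse t ^ j) has_real_derivative
        flat_exp (j + 2) t - real j * flat_exp (j + 1) t) (at t)"
    proof -
      have inv: "(inverse has_real_derivative - (inverse t ^ Suc (Suc 0))) (at t)"
        by (rule DERIV_inverse) (use 1 in simp)
      have "((\<lambda>t. inverse t ^ j) has_real_derivative - (real j * inverse t ^ (j + 1))) (at t)"
        using DERIV_power[OF inv, of j] by (cases j) (simp_all add: mult.assoc mult.left_commute)
      moreover have "((\<lambda>t. exp (- inverse t)) has_real_derivative exp (- inverse t) * inverse t ^ 2) (at t)"
        using 1 by (auto intro!: derivative_eq_intros simp: power2_eq_square)
      ultimately have "((\<lambda>t. exp (- inverse t) * inverse t ^ j) has_real_derivative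
          exp (- inverse t) * inverse t ^ 2 * inverse t ^ j +
          - (real j * inverse t ^ (j + 1)) * exp (- inverse t)) (at t)"
        by (intro DERIV_mult)
      then show ?thesis
        using 1 by (simp add: flat_exp_def power_add power2_eq_square mult.commute mult.left_commute)
    qed
    then show ?thesis
      by (rule has_field_derivative_transform_within_open[where S = "{0<..}"])
        (use 1 in \<open>auto simp: flat_exp_def\<close>)
  next
    case 2
    have "((\<lambda>t. 0) has_real_derivative flat_exp (j + 2) t - real j * flat_exp (j + 1) t) (at t)"
      using 2 by (simp add: flat_exp_def)
    then show ?thesis
      by (rule has_field_derivative_transform_within_open[where S = "{..<0}"])
        (use 2 in \<open>auto simp: flat_exp_def\<close>)
  next
    case 3
    then show ?thesis
      unfolding DERIV_def using flat_exp_tendsto_0[of j] by (simp add: flat_exp_def)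
  qed
qed

lemma pCk_flat_exp: "pCk k UNIV (\<lambda>_::'p::metric_space. flat_exp j) UNIV"
proof (induction k arbitrary: j)
  case 0
  have "continuous_on UNIV (flat_exp j)"
    by (rule DERIV_continuous_on[OF has_field_derivative_at_within[OF DERIV_flat_exp]])
  then have "continuous_on UNIV (flat_exp j \<circ> snd)"
    by (intro continuous_on_compose continuous_on_snd continuous_on_id) (auto intro: continuous_on_subset)
  then show ?case by (simp add: o_def)
next
  case (Suc k)
  have so: "secs_open UNIV (UNIV :: ('p \<times> real) set)" by (auto simp: secs_open_def intro: exI[of _ 1])
  show ?case
  proof (rule pCk_SucI[OF subspace_UNIV so])
    show "continuous_on UNIV (\<lambda>z::'p \<times> real. flat_exp j (snd z))"
      using pCk_continuous[OF Suc.IH] .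
    show "(flat_exp j has_derivative (\<lambda>v. (flat_exp (j + 2) x - real j * flat_exp (j + 1) x) * v)) (at x)" for x
      using DERIV_flat_exp has_field_derivative_imp_has_derivative by blast
    fix v :: real
    have "pCk k UNIV (\<lambda>_::'p. \<lambda>x. v *\<^sub>R (flat_exp (j + 2) x - real j *\<^sub>R flat_exp (j + 1) x)) UNIV"
      by (intro pCk_scaleR pCk_diff pCk_const Suc.IH subspace_UNIV so)
    then show "pCk k UNIV (\<lambda>_::'p. \<lambda>x. (flat_exp (j + 2) x - real j * flat_exp (j + 1) x) * v) UNIV"
      by (simp add: mult.commute)
  qed
qed

lemma flat_exp_pos: "t > 0 \<Longrightarrow> flat_exp 0 t > 0" and flat_exp_nonpos: "t \<le> 0 \<Longrightarrow> flat_exp 0 t = 0"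
  by (simp_all add: flat_exp_def)

lemma flat_exp_nonneg: "flat_exp 0 t \<ge> 0"
  by (simp add: flat_exp_def)

text \<open>The usual quotient of flat functions for the radii a < b. Its arguments are squared
  distances, which are polynomial in x, so the centre c causes no trouble.\<close>

definition bump :: "'e::euclidean_space \<Rightarrow> real \<Rightarrow> real \<Rightarrow> 'e \<Rightarrow> real" where
  "bump c a b x = flat_exp 0 (b\<^sup>2 - (x - c) \<bullet> (x - c)) *\<^sub>R
     inverse (flat_exp 0 (b\<^sup>2 - (x - c) \<bullet> (x - c)) + flat_exp 0 ((x - c) \<bullet> (x - c) - a\<^sup>2))"

lemma bump_eq_1:
  assumes "0 \<le> a" "a < b" "dist x c \<le> a"
  shows "bump c a b x = 1"
proof -
  have "(x - c) \<bullet> (x - c) \<le> a\<^sup>2"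
    using assms by (metis dist_norm norm_ge_zero power2_norm_eq_inner power_mono)
  moreover have "a\<^sup>2 < b\<^sup>2" using assms by (simp add: power_strict_mono)
  ultimately show ?thesis
    using flat_exp_pos[of "b\<^sup>2 - (x - c) \<bullet> (x - c)"] flat_exp_nonpos[of "(x - c) \<bullet> (x - c) - a\<^sup>2"]
    by (simp add: bump_def)
qed

lemma bump_eq_0:
  assumes "0 \<le> b" "b \<le> dist x c"
  shows "bump c a b x = 0"
proof -
  have "b\<^sup>2 \<le> (x - c) \<bullet> (x - c)"
    using assms by (metis dist_norm power2_norm_eq_inner power_mono)
  then show ?thesis by (simp add: bump_def flat_exp_nonpos)
qed

lemma pCk_bump:
  fixes T :: "('p::metric_space \<times> 'e::euclidean_space) set"
  assumes V: "subspace V" and T: "secs_open V T" and ab: "0 \<le> a" "a < b"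
  shows "pCk k V (\<lambda>_. bump c a b) T"
proof -
  have so: "secs_open UNIV (UNIV :: ('p \<times> real) set)" by (auto simp: secs_open_def intro: exI[of _ 1])
  have fl: "pCk k V (\<lambda>p x. flat_exp 0 (u p x)) T" if "pCk k V u T" for u :: "'p \<Rightarrow> 'e \<Rightarrow> real"
    by (rule pCk_compose[OF V T subspace_UNIV so that pCk_flat_exp]) simp
  have pos: "flat_exp 0 (b\<^sup>2 - s) + flat_exp 0 (s - a\<^sup>2) \<noteq> 0" for s
  proof -
    have "a\<^sup>2 < b\<^sup>2" using ab by (simp add: power_strict_mono)
    then have "b\<^sup>2 - s > 0 \<or> s - a\<^sup>2 > 0" by linarith
    then show ?thesis
      using flat_exp_pos flat_exp_nonneg by (metis add_nonneg_pos add_pos_nonneg less_irrefl)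
  qed
  show ?thesis
    unfolding bump_def
    by (intro pCk_scaleR pCk_inverse pCk_add fl pCk_diff pCk_inner pCk_ident pCk_const V T pos)
qed

section \<open>Iterated derivatives\<close>

lemma iter_deriv_cong:
  fixes f g :: "'e::euclidean_space \<Rightarrow> 'f::euclidean_space"
  assumes V: "subspace V" and S: "openin (top_of_set V) S" and "x \<in> S" "\<And>y. y \<in> S \<Longrightarrow> f y = g y"
  shows "iter_deriv V vs f x = iter_deriv V vs g x"
  using assms(4)
proof (induction vs arbitrary: f g)
  case Nil
  then show ?case using assms(3) by simp
next
  case (Cons v vs)
  have "frechet_derivative f (at y within V) = frechet_derivative g (at y within V)" if "y \<in> S" for y
  proof -
    have "(f has_derivative D) (at y within V) = (g has_derivative D) (at y within V)" for D
      by (rule has_derivative_cong_section[OF V secs_open_Times[OF S, of "UNIV::real set"], of 0])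
        (use that Cons.prems in auto)
    then show ?thesis unfolding frechet_derivative_def by simp
  qed
  then show ?case
    unfolding iter_deriv.simps by (intro Cons.IH) simp
qed

lemma iter_deriv_sum:
  fixes h :: "'i \<Rightarrow> 'e::euclidean_space \<Rightarrow> 'f::euclidean_space"
  assumes V: "subspace V" and S: "openin (top_of_set V) S" and x: "x \<in> S" and vs: "set vs \<subseteq> V"
    and "\<And>b. b \<in> B \<Longrightarrow> Ck_on (length vs) V (h b) S"
  shows "iter_deriv V vs (\<lambda>x. \<Sum>b\<in>B. c b *\<^sub>R h b x) x = (\<Sum>b\<in>B. c b *\<^sub>R iter_deriv V vs (h b) x)"
  using vs assms(5)
proof (induction vs arbitrary: h)
  case (Cons v vs)
  have d: "frechet_derivative (\<lambda>x. \<Sum>b\<in>B. c b *\<^sub>R h b x) (at y within V) v =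
      (\<Sum>b\<in>B. c b *\<^sub>R frechet_derivative (h b) (at y within V) v)" if y: "y \<in> S" for y
  proof (rule frechet_derivative_eq[OF V])
    have "(h b has_derivative frechet_derivative (h b) (at y within V)) (at y within V)" if "b \<in> B" for b
      using Cons.prems(2)[OF that] y by (simp add: frechet_derivative_works)
    then show "((\<lambda>x. \<Sum>b\<in>B. c b *\<^sub>R h b x) has_derivative
        (\<lambda>v. \<Sum>b\<in>B. c b *\<^sub>R frechet_derivative (h b) (at y within V) v)) (at y within V)"
      by (intro has_derivative_sum has_derivative_scaleR_right)
    show "y \<in> V" "v \<in> V" using y openin_imp_subset[OF S] Cons.prems(1) by auto
  qed
  have "iter_deriv V (v # vs) (\<lambda>x. \<Sum>b\<in>B. c b *\<^sub>R h b x) x =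
      iter_deriv V vs (\<lambda>y. \<Sum>b\<in>B. c b *\<^sub>R frechet_derivative (h b) (at y within V) v) x"
    unfolding iter_deriv.simps by (rule iter_deriv_cong[OF V S x d])
  also have "\<dots> = (\<Sum>b\<in>B. c b *\<^sub>R iter_deriv V vs (\<lambda>y. frechet_derivative (h b) (at y within V) v) x)"
    by (rule Cons.IH) (use Cons.prems in auto)
  finally show ?case by simp
qed simp

abbreviation basis_lists :: "nat \<Rightarrow> 'e::euclidean_space list set" where
  "basis_lists k \<equiv> {bs. set bs \<subseteq> Basis \<and> length bs = k}"

text \<open>Multilinearity of the k-th derivative, expanding one direction after the other; the
  coordinates of a vector of the unit ball are at most 1 in absolute value. The coefficients depend
  on the directions only, so the same ones serve for different maps and points. This bounds
  differences of derivatives in all directions by one finite sum over basis lists.\<close>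

lemma iter_deriv_expand:
  fixes V :: "'e::euclidean_space set"
  assumes V: "subspace V" and "set vs \<subseteq> V \<inter> cball 0 1"
  shows "\<exists>c. (\<forall>bs. \<bar>c bs\<bar> \<le> 1) \<and>
    (\<forall>(f::'e \<Rightarrow> 'f::euclidean_space) S x. openin (top_of_set V) S \<longrightarrow> Ck_on (length vs) V f S \<longrightarrow> x \<in> S \<longrightarrow>
      iter_deriv V vs f x = (\<Sum>bs\<in>basis_lists (length vs). c bs *\<^sub>R iter_deriv V (map (oproj V) bs) f x))"
  using assms(2)
proof (induction vs)
  case Nil
  have "basis_lists 0 = {[]::'e list}" by auto
  then show ?case by (intro exI[of _ "\<lambda>_. 1"]) simp
next
  case (Cons v vs)
  then have "set vs \<subseteq> V \<inter> cball 0 1" by simp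
  from Cons.IH[OF this] obtain c where c: "\<forall>bs. \<bar>c bs\<bar> \<le> 1"
    "\<forall>(f::'e \<Rightarrow> 'f) S x. openin (top_of_set V) S \<longrightarrow> Ck_on (length vs) V f S \<longrightarrow> x \<in> S \<longrightarrow>
      iter_deriv V vs f x = (\<Sum>bs\<in>basis_lists (length vs). c bs *\<^sub>R iter_deriv V (map (oproj V) bs) f x)"
    by (elim exE conjE)
  note c = c[rule_format]
  have v: "v \<in> V" "norm v \<le> 1" using Cons.prems by auto
  \<comment> \<open>The coordinate of the new direction v times the coefficient for the remaining
    directions. The value 0 elsewhere keeps the bound valid for every list.\<close>
  define d where "d bs = (case bs of [] \<Rightarrow> 0 | b # bs' \<Rightarrow> if b \<in> Basis then (v \<bullet> b) * c bs' else 0)" for bs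
  have "\<bar>d bs\<bar> \<le> 1" for bs
  proof (cases bs)
    case (Cons b bs')
    show ?thesis
    proof (cases "b \<in> Basis")
      case True
      then have "\<bar>v \<bullet> b\<bar> \<le> 1" using Basis_le_norm[OF True, of v] v(2) by linarith
      then show ?thesis using c(1)[of bs'] Cons by (simp add: d_def abs_mult mult_le_one)
    qed (simp add: d_def Cons)
  qed (simp add: d_def)
  moreover have "iter_deriv V (v # vs) f x =
      (\<Sum>bs\<in>basis_lists (length (v # vs)). d bs *\<^sub>R iter_deriv V (map (oproj V) bs) f x)"
    if S: "openin (top_of_set V) S" and f: "Ck_on (length (v # vs)) V f S" and x: "x \<in> S" for f :: "'e \<Rightarrow> 'f" and S x
  proof -
    let ?D = "\<lambda>w y. frechet_derivative f (at y within V) w"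
    have fk: "Ck_on (length vs) V (?D w) S" if "w \<in> V" for w
      using f that by simp
    have "iter_deriv V (v # vs) f x =
        (\<Sum>bs\<in>basis_lists (length vs). c bs *\<^sub>R iter_deriv V (map (oproj V) bs) (?D v) x)"
      unfolding iter_deriv.simps by (rule c(2)[OF S fk[OF v(1)] x])
    also have "\<dots> = (\<Sum>bs\<in>basis_lists (length vs). c bs *\<^sub>R
        (\<Sum>b\<in>Basis. (v \<bullet> b) *\<^sub>R iter_deriv V (map (oproj V) bs) (?D (oproj V b)) x))"
    proof (rule sum.cong[OF refl])
      fix bs :: "'e list" assume bs: "bs \<in> basis_lists (length vs)"
      have "iter_deriv V (map (oproj V) bs) (?D v) x =
          iter_deriv V (map (oproj V) bs) (\<lambda>y. \<Sum>b\<in>Basis. (v \<bullet> b) *\<^sub>R ?D (oproj V b) y) x"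
      proof (rule iter_deriv_cong[OF V S x])
        fix y assume "y \<in> S"
        then have "linear (frechet_derivative f (at y within V))"
          using f by (simp add: linear_frechet_derivative)
        then show "?D v y = (\<Sum>b\<in>Basis. (v \<bullet> b) *\<^sub>R ?D (oproj V b) y)"
          by (rule linear_oproj_expand[OF V _ v(1)])
      qed
      also have "\<dots> = (\<Sum>b\<in>Basis. (v \<bullet> b) *\<^sub>R iter_deriv V (map (oproj V) bs) (?D (oproj V b)) x)"
        by (rule iter_deriv_sum[OF V S x]) (use bs fk oproj_in[OF V] in auto)
      finally show "c bs *\<^sub>R iter_deriv V (map (oproj V) bs) (?D v) x =
          c bs *\<^sub>R (\<Sum>b\<in>Basis. (v \<bullet> b) *\<^sub>R iter_deriv V (map (oproj V) bs) (?D (oproj V b)) x)"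
        by simp
    qed
    also have "\<dots> = (\<Sum>bs\<in>basis_lists (length vs). \<Sum>b\<in>Basis.
        d (b # bs) *\<^sub>R iter_deriv V (map (oproj V) (b # bs)) f x)"
      by (intro sum.cong refl) (simp add: scaleR_sum_right d_def mult.commute)
    also have "\<dots> = (\<Sum>(bs, b)\<in>basis_lists (length vs) \<times> Basis.
        d (b # bs) *\<^sub>R iter_deriv V (map (oproj V) (b # bs)) f x)"
      by (rule sum.cartesian_product)
    also have "\<dots> = (\<Sum>bs\<in>basis_lists (length (v # vs)). d bs *\<^sub>R iter_deriv V (map (oproj V) bs) f x)"
      unfolding length_Cons lists_length_Suc_eq
      by (subst sum.reindex) (auto simp: inj_on_def intro!: sum.cong)
    finally show ?thesis .
  qed
  ultimately show ?case by blast
qed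

lemma iter_deriv_diff_bound:
  fixes f g :: "'e::euclidean_space \<Rightarrow> 'f::euclidean_space"
  assumes V: "subspace V" and vs: "set vs \<subseteq> V \<inter> cball 0 1"
    and S: "openin (top_of_set V) S" "Ck_on (length vs) V f S" "x \<in> S"
    and S': "openin (top_of_set V) S'" "Ck_on (length vs) V g S'" "y \<in> S'"
  shows "norm (iter_deriv V vs f x - iter_deriv V vs g y) \<le>
    (\<Sum>bs\<in>basis_lists (length vs). norm (iter_deriv V (map (oproj V) bs) f x - iter_deriv V (map (oproj V) bs) g y))"
proof -
  from iter_deriv_expand[OF V vs] obtain c where c: "\<forall>bs. \<bar>c bs\<bar> \<le> 1"
    "\<forall>(f::'e \<Rightarrow> 'f) S x. openin (top_of_set V) S \<longrightarrow> Ck_on (length vs) V f S \<longrightarrow> x \<in> S \<longrightarrow>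
      iter_deriv V vs f x = (\<Sum>bs\<in>basis_lists (length vs). c bs *\<^sub>R iter_deriv V (map (oproj V) bs) f x)"
    by (elim exE conjE)
  note c = c[rule_format]
  have "iter_deriv V vs f x - iter_deriv V vs g y = (\<Sum>bs\<in>basis_lists (length vs).
      c bs *\<^sub>R (iter_deriv V (map (oproj V) bs) f x - iter_deriv V (map (oproj V) bs) g y))"
    unfolding c(2)[OF S] c(2)[OF S'] by (simp add: scaleR_right_diff_distrib sum_subtractf)
  also have "norm \<dots> \<le> (\<Sum>bs\<in>basis_lists (length vs).
      norm (c bs *\<^sub>R (iter_deriv V (map (oproj V) bs) f x - iter_deriv V (map (oproj V) bs) g y)))"
    by (rule norm_sum)
  also have "\<dots> \<le> (\<Sum>bs\<in>basis_lists (length vs).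
      norm (iter_deriv V (map (oproj V) bs) f x - iter_deriv V (map (oproj V) bs) g y))"
    by (rule sum_mono) (simp add: c(1) mult_left_le_one_le)
  finally show ?thesis .
qed

text \<open>The supremum runs over all lists of directions in the unit ball and is meaningful only
  if it is bounded; the finite sum over basis lists provides the bound.\<close>

lemma Dk_dist_upper:
  fixes f g :: "'e::euclidean_space \<Rightarrow> 'f::euclidean_space"
  assumes V: "subspace V" and vs: "set vs \<subseteq> V \<inter> cball 0 1" "length vs = k"
    and S: "openin (top_of_set V) S" "Ck_on k V f S" "x \<in> S"
    and S': "openin (top_of_set V) S'" "Ck_on k V g S'" "x \<in> S'"
  shows "norm (iter_deriv V vs f x - iter_deriv V vs g x) \<le> Dk_dist k V f g x"
  unfolding Dk_dist_def
proof (rule cSUP_upper)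
  show "vs \<in> {vs. length vs = k \<and> set vs \<subseteq> V \<inter> cball 0 1}" using vs by simp
  show "bdd_above ((\<lambda>vs. norm (iter_deriv V vs f x - iter_deriv V vs g x)) ` {vs. length vs = k \<and> set vs \<subseteq> V \<inter> cball 0 1})"
    using iter_deriv_diff_bound[OF V _ S(1) _ S(3) S'(1) _ S'(3), where f = f and g = g] S(2) S'(2)
    by (intro bdd_aboveI2[where M = "\<Sum>bs\<in>basis_lists k.
      norm (iter_deriv V (map (oproj V) bs) f x - iter_deriv V (map (oproj V) bs) g x)"]) auto
qed

lemma Dk_dist_least:
  fixes f g :: "'e::euclidean_space \<Rightarrow> 'f::euclidean_space"
  assumes V: "subspace V"
    and "\<And>vs. set vs \<subseteq> V \<inter> cball 0 1 \<Longrightarrow> length vs = k \<Longrightarrow> norm (iter_deriv V vs f x - iter_deriv V vs g x) \<le> c"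
  shows "Dk_dist k V f g x \<le> c"
  unfolding Dk_dist_def
proof (rule cSUP_least)
  \<comment> \<open>Zero directions are available even if V = {0}, so the supremum is never over the
    empty set.\<close>
  have "replicate k 0 \<in> {vs. length vs = k \<and> set vs \<subseteq> V \<inter> cball 0 1}"
    using subspace_0[OF V] by auto
  then show "{vs. length vs = k \<and> set vs \<subseteq> V \<inter> cball 0 1} \<noteq> {}" by blast
qed (use assms in auto)

lemma section_openin:
  assumes "secs_open V T"
  shows "openin (top_of_set V) {x. (p, x) \<in> T}"
  unfolding openin_euclidean_subtopology_iff
proof (intro conjI ballI)
  show "{x. (p, x) \<in> T} \<subseteq> V" using secs_open_in[OF assms] by blast
  fix x assume "x \<in> {x. (p, x) \<in> T}"
  then have px: "(p, x) \<in> T" by simp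
  obtain e where "e > 0" "\<And>y. y \<in> V \<Longrightarrow> dist y x < e \<Longrightarrow> (p, y) \<in> T"
    using secs_openE[OF assms px] by metis
  then show "\<exists>e>0. \<forall>x'\<in>V. dist x' x < e \<longrightarrow> x' \<in> {x. (p, x) \<in> T}" by auto
qed

text \<open>Upper semicontinuity of the distance, jointly in parameter and point. The function
  \<sigma> is continuous, vanishes at (p0, x0), and dominates the change of the k-th derivatives of
  both maps uniformly in the directions, by the expansion over basis lists and the triangle
  inequality.\<close>

lemma eventually_Dk_dist_less:
  fixes f :: "'p::metric_space \<Rightarrow> 'e::euclidean_space \<Rightarrow> 'f::euclidean_space"
  assumes V: "subspace V" and T: "secs_open V T" and z0: "(p0, x0) \<in> T"
    and f: "pCk k V f T" and g: "pCk k V (\<lambda>_. g) T" and less: "Dk_dist k V (f p0) g x0 < \<epsilon>"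
  shows "eventually (\<lambda>z. Dk_dist k V (f (fst z)) g (snd z) < \<epsilon>) (at (p0, x0) within T)"
proof -
  let ?it = "\<lambda>bs. iter_deriv V (map (oproj V) bs)"
  define \<sigma> where "\<sigma> z = (\<Sum>bs\<in>basis_lists k. norm (?it bs (f (fst z)) (snd z) - ?it bs (f p0) x0)) +
      (\<Sum>bs\<in>basis_lists k. norm (?it bs g x0 - ?it bs g (snd z)))" for z
  have "continuous_on T (\<lambda>z. ?it bs (f (fst z)) (snd z))" "continuous_on T (\<lambda>z. ?it bs g (snd z))"
    if "bs \<in> basis_lists k" for bs
    using that oproj_in[OF V] by (auto intro!: pCk_iter_continuous[OF f] pCk_iter_continuous[OF g])
  then have "continuous_on T \<sigma>"
    unfolding \<sigma>_def by (intro continuous_intros) auto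
  then have "(\<sigma> \<longlongrightarrow> \<sigma> (p0, x0)) (at (p0, x0) within T)"
    using z0 unfolding continuous_on_def by blast
  moreover have "\<sigma> (p0, x0) = 0" by (simp add: \<sigma>_def)
  ultimately have ev: "eventually (\<lambda>z. \<sigma> z < \<epsilon> - Dk_dist k V (f p0) g x0) (at (p0, x0) within T)"
    by (intro order_tendstoD(2)) (use less in auto)
  have sec: "openin (top_of_set V) {x. (p, x) \<in> T}" for p
    by (rule section_openin[OF T])
  have fk: "Ck_on k V (f p) {x. (p, x) \<in> T}" for p
    by (rule pCk_imp_Ck_on[OF f]) simp
  have gk: "Ck_on k V g {x. (p, x) \<in> T}" for p
    by (rule pCk_imp_Ck_on[OF g, where p = p]) simp
  have bound: "Dk_dist k V (f (fst z)) g (snd z) \<le> Dk_dist k V (f p0) g x0 + \<sigma> z" if "z \<in> T" for z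
  proof (rule Dk_dist_least[OF V])
    fix vs assume vs: "set vs \<subseteq> V \<inter> cball 0 1" "length vs = k"
    obtain p x where z: "z = (p, x)" "(p, x) \<in> T" using \<open>z \<in> T\<close> by (cases z) auto
    have 1: "norm (iter_deriv V vs (f p) x - iter_deriv V vs (f p0) x0) \<le>
        (\<Sum>bs\<in>basis_lists k. norm (?it bs (f p) x - ?it bs (f p0) x0))"
      using iter_deriv_diff_bound[OF V vs(1) sec _ _ sec, of "f p" p x "f p0" p0 x0] vs(2) fk z z0 by simp
    have 2: "norm (iter_deriv V vs g x0 - iter_deriv V vs g x) \<le>
        (\<Sum>bs\<in>basis_lists k. norm (?it bs g x0 - ?it bs g x))"
      using iter_deriv_diff_bound[OF V vs(1) sec _ _ sec, of g p0 x0 g p x] vs(2) gk z z0 by simp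
    have 3: "norm (iter_deriv V vs (f p0) x0 - iter_deriv V vs g x0) \<le> Dk_dist k V (f p0) g x0"
      using Dk_dist_upper[OF V vs sec fk _ sec gk, of x0 p0 p0] z0 by simp
    have "iter_deriv V vs (f p) x - iter_deriv V vs g x =
        (iter_deriv V vs (f p) x - iter_deriv V vs (f p0) x0) +
        ((iter_deriv V vs (f p0) x0 - iter_deriv V vs g x0) + (iter_deriv V vs g x0 - iter_deriv V vs g x))"
      by simp
    also have "norm \<dots> \<le> norm (iter_deriv V vs (f p) x - iter_deriv V vs (f p0) x0) +
        (norm (iter_deriv V vs (f p0) x0 - iter_deriv V vs g x0) + norm (iter_deriv V vs g x0 - iter_deriv V vs g x))"
      by (meson add_left_mono norm_triangle_ineq order_trans)
    finally show "norm (iter_deriv V vs (f (fst z)) (snd z) - iter_deriv V vs g (snd z)) \<le>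
        Dk_dist k V (f p0) g x0 + \<sigma> z"
      using 1 2 3 by (simp add: z \<sigma>_def)
  qed
  have "eventually (\<lambda>z. z \<in> T) (at (p0, x0) within T)"
    by (simp add: eventually_at_filter)
  with ev show ?thesis
  proof eventually_elim
    case (elim z)
    then show ?case using bound[of z] by linarith
  qed
qed

section \<open>Affine perturbations are generically regular\<close>

text \<open>
  A linear map from \<open>'e\<close> to \<open>'d\<close> is stored by its rows, one for each basis vector of \<open>'d\<close>, so that
  the space of these maps is of class \<open>euclidean_space\<close>.
\<close>

typedef (overloaded) 'd basis_index = "Basis :: 'd::euclidean_space set"
  using nonempty_Basis by blast

instance basis_index :: (euclidean_space) finite
proof
  have "(UNIV :: 'a basis_index set) = Abs_basis_index ` Basis"
    by (metis type_definition.Abs_image type_definition_basis_index)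
  then show "finite (UNIV :: 'a basis_index set)"
    using finite_imageI[OF finite_Basis, of Abs_basis_index] by (rule ssubst)
qed

definition rows_apply :: "'e::euclidean_space ^ 'd basis_index \<Rightarrow> 'e \<Rightarrow> 'd::euclidean_space" where
  "rows_apply L x = (\<Sum>i\<in>UNIV. (L $ i \<bullet> x) *\<^sub>R Rep_basis_index i)"

lemma rows_apply_inner:
  "rows_apply L x \<bullet> w = (\<Sum>i\<in>UNIV. (Rep_basis_index i \<bullet> w) *\<^sub>R (L $ i)) \<bullet> x"
  by (simp add: rows_apply_def inner_sum_left mult.commute)

lemma differentiable_inner:
  fixes f g :: "'a::real_normed_vector \<Rightarrow> 'b::euclidean_space"
  assumes "f differentiable (at x within S)" "g differentiable (at x within S)"
  shows "(\<lambda>x. f x \<bullet> g x) differentiable (at x within S)"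
proof -
  obtain f' g' where "(f has_derivative f') (at x within S)" "(g has_derivative g') (at x within S)"
    using assms unfolding differentiable_def by (elim exE)
  from bounded_bilinear.FDERIV[OF bounded_bilinear_inner this] show ?thesis
    by (rule differentiableI)
qed

lemma differentiable_linear_compose:
  fixes f :: "'a::real_normed_vector \<Rightarrow> 'b::euclidean_space" and B :: "'b \<Rightarrow> 'c::euclidean_space"
  assumes "linear B" "f differentiable F"
  shows "(\<lambda>x. B (f x)) differentiable F"
proof -
  obtain f' where "(f has_derivative f') F" using assms(2) unfolding differentiable_def by (elim exE)
  moreover have "bounded_linear B" using assms(1) linear_conv_bounded_linear by blast
  ultimately show ?thesis using differentiableI[OF bounded_linear.has_derivative] by blast
qed

text \<open>The data that determine a bad pair are packed into an element z of the same space as (L,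
  v), so that differentiable images of null sets are null. Since row i of L is determined, its slot
  stores x together with a vector s orthogonal to V; the slot of v stores w together with a vector q
  orthogonal to E. The lost dimension is the normalisation of w to have coordinate 1 at the basis
  vector number i. Class C^2 is used because \<Phi> contains the first derivative of f and has to be
  differentiable.\<close>

lemma negligible_irregular_affine:
  fixes f :: "'e::euclidean_space \<Rightarrow> 'd::euclidean_space"
  assumes V: "subspace V" and E: "subspace E" and S: "S \<subseteq> V" and f: "Ck_on (Suc (Suc 0)) V f S"
  shows "negligible {(L, v). \<exists>x\<in>S. (\<forall>w\<in>E. (f x + (rows_apply L x + v)) \<bullet> w = 0) \<and>
    (\<exists>w\<in>E. w \<noteq> 0 \<and> (\<forall>u\<in>V. (frechet_derivative f (at x within V) u + rows_apply L u) \<bullet> w = 0))}"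
    (is "negligible ?Bad")
proof -
  define f' where "f' x = frechet_derivative f (at x within V)" for x
  have f'lin: "linear (f' x)" and fd: "f differentiable (at x within V)" if "x \<in> S" for x
    using f that unfolding f'_def by (simp_all add: linear_frechet_derivative)
  have f'd: "(\<lambda>x. f' x u) differentiable (at x within V)" if "x \<in> S" "u \<in> V" for x u
    using f that unfolding f'_def by simp
  define gr where "gr x w = (\<Sum>b\<in>Basis. (f' x (oproj V b) \<bullet> w) *\<^sub>R b)" for x w
  have gr: "gr x w \<bullet> u = f' x u \<bullet> w" if "x \<in> S" "u \<in> V" for x w u
    unfolding gr_def linear_oproj_expand[OF V f'lin[OF that(1)] that(2)]
    by (simp add: inner_sum_left inner_commute[of u] mult.commute)
  define D where "D i = {z :: ('e ^ 'd basis_index) \<times> 'd.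
      oproj V (fst z $ i) \<in> S \<and> Rep_basis_index i \<bullet> oproj E (snd z) = 1}" for i
  \<comment> \<open>On V the functional given by w and the rows vanishes, so s = gr x w + (the sum
    over j of (b_j . w) L_j) is orthogonal to V. This equation is solved for L_i, whose coefficient
    is 1; x and s are the two components of slot i.\<close>
  define row where "row i z = (fst z $ i - oproj V (fst z $ i)) - gr (oproj V (fst z $ i)) (oproj E (snd z))
      - (\<Sum>j\<in>UNIV - {i}. (Rep_basis_index j \<bullet> oproj E (snd z)) *\<^sub>R (fst z $ j))"
    for i :: "'d basis_index" and z :: "('e ^ 'd basis_index) \<times> 'd"
  define Lnew where "Lnew i z = (\<chi> j. if j = i then row i z else fst z $ j)"
    for i :: "'d basis_index" and z :: "('e ^ 'd basis_index) \<times> 'd"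
  \<comment> \<open>The second component solves f x + L x + v = q for v, where q is the part of
    \<open>snd z\<close> orthogonal to E.\<close>
  define \<Phi> where "\<Phi> i z = (Lnew i z, (snd z - oproj E (snd z)) - f (oproj V (fst z $ i)) -
      rows_apply (Lnew i z) (oproj V (fst z $ i)))"
    for i :: "'d basis_index" and z :: "('e ^ 'd basis_index) \<times> 'd"
  have "?Bad \<subseteq> (\<Union>i\<in>UNIV. \<Phi> i ` D i)"
  proof clarify
    fix L :: "'e ^ 'd basis_index" and v x w'
    assume x: "x \<in> S" and zero: "\<forall>w\<in>E. (f x + (rows_apply L x + v)) \<bullet> w = 0"
      and w': "w' \<in> E" "w' \<noteq> 0"
        "\<forall>u\<in>V. (frechet_derivative f (at x within V) u + rows_apply L u) \<bullet> w' = 0"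
    obtain b where b: "b \<in> Basis" "w' \<bullet> b \<noteq> 0" using w'(2) euclidean_all_zero_iff by blast
    define i where "i = Abs_basis_index b"
    have bi: "Rep_basis_index i = b" by (simp add: i_def Abs_basis_index_inverse b)
    define w where "w = (1 / (w' \<bullet> b)) *\<^sub>R w'"
    have w: "w \<in> E" "b \<bullet> w = 1" using w'(1) b E by (simp_all add: w_def subspace_scale inner_commute)
    have xV: "x \<in> V" using x S by blast
    define s where "s = gr x w + (\<Sum>j\<in>UNIV. (Rep_basis_index j \<bullet> w) *\<^sub>R (L $ j))"
    have s: "s \<bullet> u = 0" if "u \<in> V" for u
    proof -
      have "s \<bullet> u = (f' x u + rows_apply L u) \<bullet> w"
        by (simp add: s_def inner_add_left gr[OF x that] rows_apply_inner)
      also have "\<dots> = 0" using w'(3) that by (simp add: w_def f'_def)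
      finally show ?thesis .
    qed
    define q where "q = f x + (rows_apply L x + v)"
    have q: "q \<bullet> u = 0" if "u \<in> E" for u using zero that by (simp add: q_def)
    define z where "z = ((\<chi> j. if j = i then x + s else L $ j), w + q)"
    have zi: "fst z $ i = x + s" and zj: "j \<noteq> i \<Longrightarrow> fst z $ j = L $ j" for j by (simp_all add: z_def)
    have pV: "oproj V (fst z $ i) = x"
      by (rule oproj_unique[OF V]) (use xV s in \<open>simp_all add: zi\<close>)
    have pE: "oproj E (snd z) = w"
      by (rule oproj_unique[OF E]) (use w q in \<open>simp_all add: z_def\<close>)
    have "z \<in> D i" using x w by (simp add: D_def pV pE bi)
    have "row i z = s - gr x w - (\<Sum>j\<in>UNIV - {i}. (Rep_basis_index j \<bullet> w) *\<^sub>R (L $ j))"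
      unfolding row_def pV pE by (simp add: zi zj)
    also have "\<dots> = L $ i"
      using w(2) by (simp add: s_def sum.remove[of UNIV i] bi)
    finally have "Lnew i z = L" by (simp add: Lnew_def vec_eq_iff zj)
    moreover have "snd z - oproj E (snd z) = q" unfolding pE by (simp add: z_def)
    ultimately have "\<Phi> i z = (L, v)" unfolding \<Phi>_def pV by (simp add: q_def)
    with \<open>z \<in> D i\<close> show "(L, v) \<in> (\<Union>i\<in>UNIV. \<Phi> i ` D i)"
      by (intro UN_I[where a = i] image_eqI[where x = z]) simp_all
  qed
  moreover have "negligible (\<Union>i\<in>UNIV. \<Phi> i ` D i)"
  proof (intro negligible_Union finite_imageI finite)
    fix t assume "t \<in> range (\<lambda>i. \<Phi> i ` D i)"
    then obtain i where t: "t = \<Phi> i ` D i" by blast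
    show "negligible t" unfolding t
    proof (rule negligible_differentiable_image_negligible[OF order_refl])
      \<comment> \<open>By self-adjointness of the projection the normalisation is a linear equation
        in z. Its right-hand side 1 makes the solution set negligible even if the normal vector is
        0, as the set is then empty.\<close>
      have "D i \<subseteq> {z. (0, oproj E (Rep_basis_index i)) \<bullet> z = 1}"
        by (auto simp: D_def oproj_adjoint[OF E])
      then show "negligible (D i)"
        by (rule negligible_subset[rotated]) (rule negligible_hyperplane, simp)
    next
      have "\<Phi> i differentiable (at z within D i)" if z: "z \<in> D i" for z
      proof -
        let ?F = "at z within D i"
        have coord: "(\<lambda>z. fst z $ j) differentiable ?F" for j
          by (rule bounded_linear_imp_differentiable)
            (rule bounded_linear_compose[OF bounded_linear_vec_nth bounded_linear_fst])
        have x: "(\<lambda>z. oproj V (fst z $ i)) differentiable ?F"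
          by (rule differentiable_linear_compose[OF linear_oproj[OF V] coord])
        have y: "snd differentiable ?F"
          by (rule bounded_linear_imp_differentiable[OF bounded_linear_snd])
        have w: "(\<lambda>z. oproj E (snd z)) differentiable ?F"
          by (rule differentiable_linear_compose[OF linear_oproj[OF E] y])
        have xS: "oproj V (fst z $ i) \<in> S" using z by (simp add: D_def)
        have comp: "(\<lambda>z. h (oproj V (fst z $ i))) differentiable ?F"
          if "h differentiable (at (oproj V (fst z $ i)) within V)" for h :: "'e \<Rightarrow> 'd"
        proof -
          have "h differentiable (at (oproj V (fst z $ i)) within (\<lambda>z. oproj V (fst z $ i)) ` D i)"
            by (rule differentiable_subset[OF that]) (use S in \<open>auto simp: D_def\<close>)
          from differentiable_chain_within[OF x this] show ?thesis by (simp add: o_def)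
        qed
        have fx: "(\<lambda>z. f (oproj V (fst z $ i))) differentiable ?F"
          by (rule comp[OF fd[OF xS]])
        have f'x: "(\<lambda>z. f' (oproj V (fst z $ i)) (oproj V b)) differentiable ?F" for b
          by (rule comp[OF f'd[OF xS oproj_in[OF V]]])
        have row: "row i differentiable ?F"
          unfolding row_def gr_def
          by (intro ballI differentiable_diff differentiable_sum differentiable_scaleR differentiable_inner
              differentiable_const coord x w f'x finite finite_Basis finite_Diff)
        have Lj: "(\<lambda>z. Lnew i z $ j) differentiable ?F" for j
        proof (cases "j = i")
          case True
          then have "(\<lambda>z. Lnew i z $ j) = row i" by (simp add: Lnew_def)
          with row show ?thesis by (simp only:)
        next
          case False
          then have "(\<lambda>z. Lnew i z $ j) = (\<lambda>z. fst z $ j)" by (simp add: Lnew_def)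
          with coord show ?thesis by (simp only:)
        qed
        have L: "Lnew i differentiable ?F"
        proof (subst differentiable_componentwise_within, intro ballI)
          fix c :: "'e ^ 'd basis_index" assume "c \<in> Basis"
          then have "\<exists>j u. c = axis j u" unfolding Basis_vec_def by blast
          then obtain j u where c: "c = axis j u" by (elim exE)
          show "(\<lambda>z. Lnew i z \<bullet> c) differentiable ?F"
            unfolding c inner_axis by (rule differentiable_inner[OF Lj differentiable_const])
        qed
        have "(\<lambda>z. (snd z - oproj E (snd z)) - f (oproj V (fst z $ i)) -
            rows_apply (Lnew i z) (oproj V (fst z $ i))) differentiable ?F"
          unfolding rows_apply_def
          by (intro ballI differentiable_diff differentiable_sum differentiable_scaleR differentiable_inner
              differentiable_const Lj x y w fx finite)
        with L obtain A B where "(Lnew i has_derivative A) ?F"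
          "((\<lambda>z. (snd z - oproj E (snd z)) - f (oproj V (fst z $ i)) -
            rows_apply (Lnew i z) (oproj V (fst z $ i))) has_derivative B) ?F"
          unfolding differentiable_def by (elim exE)
        from differentiableI[OF has_derivative_Pair[OF this]]
        show ?thesis by (simp only: \<Phi>_def[abs_def])
      qed
      then show "\<Phi> i differentiable_on D i" unfolding differentiable_on_def by blast
    qed
  qed
  ultimately show ?thesis by (rule negligible_subset[rotated])
qed

section \<open>Smoothing a map of class C^1\<close>

lemma secs_open_all [simp]: "secs_open UNIV (UNIV :: ('p \<times> 'e::euclidean_space) set)"
  by (auto simp: secs_open_def intro: exI[of _ 1])

text \<open>The mean of g p over the segment from x to \<open>x + e p *\<^sub>R b\<close>. For e p =
  0 it is g p x, so the family reaches its starting point without a special case.\<close>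

definition avg :: "('p \<Rightarrow> real) \<Rightarrow> 'e \<Rightarrow> ('p \<Rightarrow> 'e::euclidean_space \<Rightarrow> 'd::euclidean_space) \<Rightarrow> 'p \<Rightarrow> 'e \<Rightarrow> 'd" where
  "avg e b g p x = integral (cbox 0 1) (\<lambda>t. g p (x + (e p * t) *\<^sub>R b))"

text \<open>Differentiation under the integral sign. The Leibniz rule wants the derivative as a
  continuous family of bounded linear functions, whence the detour through
  \<open>Blinfun\<close>.\<close>

lemma avg_has_derivative:
  fixes g :: "'p::metric_space \<Rightarrow> 'e::euclidean_space \<Rightarrow> 'd::euclidean_space"
  assumes g: "pCk (Suc 0) UNIV g UNIV"
  shows "(avg e b g p has_derivative (\<lambda>v. avg e b (\<lambda>p x. frechet_derivative (g p) (at x) v) p x)) (at x)"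
proof -
  define D where "D y = frechet_derivative (g p) (at y)" for y
  have Dd: "(g p has_derivative D y) (at y)" for y
    using pCk_has_derivative'[OF g, of p y] by (simp add: D_def)
  have DB: "blinfun_apply (Blinfun (D y)) = D y" for y
    by (rule bounded_linear_Blinfun_apply[OF has_derivative_bounded_linear[OF Dd]])
  have "continuous_on UNIV (\<lambda>z. frechet_derivative (g (fst z)) (at (snd z)) v)" for v
    using g by simp
  then have "continuous_on UNIV ((\<lambda>z. frechet_derivative (g (fst z)) (at (snd z)) v) \<circ> (\<lambda>y. (p, y)))" for v
    by (intro continuous_on_compose continuous_intros) (auto intro: continuous_on_subset)
  then have Dc: "continuous_on UNIV (\<lambda>y. D y v)" for v by (simp add: o_def D_def)
  have BDc: "continuous_on UNIV (\<lambda>y. Blinfun (D y))"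
    by (rule continuous_on_blinfun_componentwise) (simp add: DB Dc)
  have lin: "continuous_on (UNIV \<times> cbox 0 1) (\<lambda>(x, t). x + (e p * t) *\<^sub>R b)"
    by (auto simp: split_beta intro!: continuous_intros)
  have BDc2: "continuous_on (UNIV \<times> cbox 0 1) (\<lambda>(x, t). Blinfun (D (x + (e p * t) *\<^sub>R b)))"
    using continuous_on_compose[OF lin continuous_on_subset[OF BDc]] by (simp add: o_def split_beta)
  have gc: "continuous_on UNIV (g p)"
    by (rule continuous_at_imp_continuous_on) (use has_derivative_continuous[OF Dd] in blast)
  have gi: "(\<lambda>t. g p (x + (e p * t) *\<^sub>R b)) integrable_on cbox 0 1" for x
  proof (rule integrable_continuous)
    have "continuous_on (cbox 0 1) (g p \<circ> (\<lambda>t. x + (e p * t) *\<^sub>R b))"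
      by (intro continuous_on_compose continuous_intros continuous_on_subset[OF gc]) auto
    then show "continuous_on (cbox 0 1) (\<lambda>t. g p (x + (e p * t) *\<^sub>R b))" by (simp add: o_def)
  qed
  have "((\<lambda>x. integral (cbox 0 1) (\<lambda>t. g p (x + (e p * t) *\<^sub>R b))) has_derivative
      blinfun_apply (integral (cbox 0 1) (\<lambda>t. Blinfun (D (x + (e p * t) *\<^sub>R b))))) (at x within UNIV)"
  proof (rule leibniz_rule)
    fix y t
    have "((\<lambda>x. g p (x + (e p * t) *\<^sub>R b)) has_derivative (\<lambda>v. D (y + (e p * t) *\<^sub>R b) v)) (at y)"
      by (rule has_derivative_compose[where f = "\<lambda>x. x + (e p * t) *\<^sub>R b" and g = "g p"])
        (auto intro!: derivative_eq_intros Dd)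
    then show "((\<lambda>x. g p (x + (e p * t) *\<^sub>R b)) has_derivative blinfun_apply (Blinfun (D (y + (e p * t) *\<^sub>R b)))) (at y within UNIV)"
      by (simp add: DB)
  qed (use gi BDc2 in auto)
  moreover have "blinfun_apply (integral (cbox 0 1) (\<lambda>t. Blinfun (D (x + (e p * t) *\<^sub>R b)))) v =
      avg e b (\<lambda>p x. frechet_derivative (g p) (at x) v) p x" for v
  proof -
    have "(\<lambda>t. Blinfun (D (x + (e p * t) *\<^sub>R b))) integrable_on cbox 0 1"
    proof (rule integrable_continuous)
      have "continuous_on (cbox 0 1) ((\<lambda>y. Blinfun (D y)) \<circ> (\<lambda>t. x + (e p * t) *\<^sub>R b))"
        by (intro continuous_on_compose continuous_intros continuous_on_subset[OF BDc]) auto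
      then show "continuous_on (cbox 0 1) (\<lambda>t. Blinfun (D (x + (e p * t) *\<^sub>R b)))" by (simp add: o_def)
    qed
    from blinfun_apply_integral[OF this] show ?thesis
      unfolding DB avg_def D_def[symmetric] .
  qed
  then have "blinfun_apply (integral (cbox 0 1) (\<lambda>t. Blinfun (D (x + (e p * t) *\<^sub>R b)))) =
      (\<lambda>v. avg e b (\<lambda>p x. frechet_derivative (g p) (at x) v) p x)" by (rule ext)
  ultimately show ?thesis unfolding avg_def[of e b g p, abs_def] by (simp only:)
qed

lemma pCk_avg:
  fixes g :: "'p::metric_space \<Rightarrow> 'e::euclidean_space \<Rightarrow> 'd::euclidean_space"
  assumes e: "continuous_on UNIV e"
  shows "pCk k UNIV g UNIV \<Longrightarrow> pCk k UNIV (avg e b g) UNIV"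
proof (induction k arbitrary: g)
  case 0
  then have g: "continuous_on UNIV (\<lambda>z. g (fst z) (snd z))" by simp
  have "continuous_on (UNIV \<times> cbox 0 1) (\<lambda>y. (fst (fst y), snd (fst y) + (e (fst (fst y)) * snd y) *\<^sub>R b))"
    by (intro continuous_intros continuous_on_compose2[OF e]) auto
  then have "continuous_on (UNIV \<times> cbox 0 1) ((\<lambda>z. g (fst z) (snd z)) \<circ>
      (\<lambda>y::('p \<times> 'e) \<times> real. (fst (fst y), snd (fst y) + (e (fst (fst y)) * snd y) *\<^sub>R b)))"
    by (rule continuous_on_compose) (auto intro: continuous_on_subset[OF g])
  then have "continuous_on (UNIV \<times> cbox 0 1) (\<lambda>(z::'p \<times> 'e, t). g (fst z) (snd z + (e (fst z) * t) *\<^sub>R b))"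
    by (simp add: o_def split_beta)
  from integral_continuous_on_param[OF this] show ?case by (simp add: avg_def)
next
  case (Suc k)
  have g1: "pCk (Suc 0) UNIV g UNIV" by (rule pCk_mono[OF Suc.prems]) simp
  show ?case
  proof (rule pCk_SucI[OF subspace_UNIV secs_open_all])
    show "continuous_on UNIV (\<lambda>z. avg e b g (fst z) (snd z))"
      by (rule pCk_continuous[OF Suc.IH[OF pCk_SucD[OF Suc.prems]]])
    show "(avg e b g p has_derivative (\<lambda>v. avg e b (\<lambda>p x. frechet_derivative (g p) (at x) v) p x)) (at x)" for p x
      by (rule avg_has_derivative[OF g1])
    show "pCk k UNIV (\<lambda>p x. avg e b (\<lambda>p x. frechet_derivative (g p) (at x) v) p x) UNIV" for v
      by (rule Suc.IH) (use Suc.prems in simp)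
  qed
qed

text \<open>Up to the factor e p the integrand is the derivative in t of g along the segment, so the
  fundamental theorem of calculus evaluates the integral.\<close>

lemma avg_derivative_along:
  fixes g :: "'p::metric_space \<Rightarrow> 'e::euclidean_space \<Rightarrow> 'd::euclidean_space"
  assumes g: "pCk (Suc 0) UNIV g UNIV" and e: "e p \<noteq> 0"
  shows "avg e b (\<lambda>p x. frechet_derivative (g p) (at x) b) p x = (1 / e p) *\<^sub>R (g p (x + e p *\<^sub>R b) - g p x)"
proof -
  have Dd: "(g p has_derivative frechet_derivative (g p) (at y)) (at y)" for y
    using pCk_has_derivative'[OF g, of p y] by simp
  have "((\<lambda>t. (1 / e p) *\<^sub>R g p (x + (e p * t) *\<^sub>R b)) has_vector_derivative
      frechet_derivative (g p) (at (x + (e p * t) *\<^sub>R b)) b) (at t within {0..1})" for t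
  proof -
    have "((\<lambda>t. g p (x + (e p * t) *\<^sub>R b)) has_derivative
        (\<lambda>s. frechet_derivative (g p) (at (x + (e p * t) *\<^sub>R b)) ((e p * s) *\<^sub>R b))) (at t within {0..1})"
      by (rule has_derivative_compose[where f = "\<lambda>t. x + (e p * t) *\<^sub>R b" and g = "g p"])
        (auto intro!: derivative_eq_intros Dd)
    then have "((\<lambda>t. (1 / e p) *\<^sub>R g p (x + (e p * t) *\<^sub>R b)) has_derivative
        (\<lambda>s. (1 / e p) *\<^sub>R frechet_derivative (g p) (at (x + (e p * t) *\<^sub>R b)) ((e p * s) *\<^sub>R b))) (at t within {0..1})"
      by (rule has_derivative_scaleR_right)
    then show ?thesis
      unfolding has_vector_derivative_def
      using linear_scale[OF has_derivative_linear[OF Dd]] e by simp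
  qed
  from fundamental_theorem_of_calculus[OF _ this]
  have "((\<lambda>t. frechet_derivative (g p) (at (x + (e p * t) *\<^sub>R b)) b) has_integral
      ((1 / e p) *\<^sub>R g p (x + (e p * 1) *\<^sub>R b) - (1 / e p) *\<^sub>R g p (x + (e p * 0) *\<^sub>R b))) {0..1}"
    by simp
  then show ?thesis
    by (simp add: avg_def integral_unique scaleR_right_diff_distrib)
qed

text \<open>The iterated mean over the parallelepiped spanned by the vectors \<epsilon> b with b in
  the list; the side length is itself the parameter of the family.\<close>

primrec smooth :: "'e list \<Rightarrow> ('e \<Rightarrow> 'd) \<Rightarrow> real \<Rightarrow> 'e::euclidean_space \<Rightarrow> 'd::euclidean_space" where
  "smooth [] F = (\<lambda>_. F)"
| "smooth (b # bs) F = avg (\<lambda>\<epsilon>. \<epsilon>) b (smooth bs F)"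

lemma pCk_smooth:
  assumes "pCk k UNIV (\<lambda>_::real. F) UNIV"
  shows "pCk k UNIV (smooth bs F) UNIV"
  using assms by (induction bs) (simp_all del: pCk.simps add: pCk_avg)

lemma smooth_0: "smooth bs F 0 x = F x"
  by (induction bs arbitrary: x) (simp_all add: avg_def)

text \<open>
  Averaging in the direction \<open>b\<close> turns the derivative along \<open>b\<close> into a difference quotient, which
  is as regular as the map itself; it commutes with the derivatives in the other directions.
\<close>

lemma smooth_derivative:
  fixes F :: "'e::euclidean_space \<Rightarrow> 'd::euclidean_space"
  assumes F: "pCk (Suc 0) UNIV (\<lambda>_::real. F) UNIV" and \<epsilon>: "\<epsilon> \<noteq> 0" and "b \<in> set bs"
  shows "pCk (Suc 0) UNIV (\<lambda>_::real. \<lambda>x. frechet_derivative (smooth bs F \<epsilon>) (at x) b) UNIV"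
  using assms(3)
proof (induction bs)
  case (Cons c bs)
  let ?g = "smooth bs F"
  have g: "pCk (Suc 0) UNIV ?g UNIV" by (rule pCk_smooth[OF F])
  have eq: "frechet_derivative (smooth (c # bs) F \<epsilon>) (at x) b =
      avg (\<lambda>\<epsilon>. \<epsilon>) c (\<lambda>p x. frechet_derivative (?g p) (at x) b) \<epsilon> x" for x
    using frechet_derivative_eq[OF subspace_UNIV avg_has_derivative[OF g]] by simp
  show ?case
  proof (cases "b = c")
    case True
    have gk: "pCk (Suc 0) UNIV (\<lambda>_::real. ?g \<epsilon>) UNIV"
      by (rule Ck_on_imp_pCk[OF pCk_imp_Ck_on[OF g, of UNIV]]) auto
    have sh: "pCk (Suc 0) UNIV (\<lambda>_::real. \<lambda>x. ?g \<epsilon> (x + \<epsilon> *\<^sub>R c)) UNIV"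
      by (rule pCk_compose[OF subspace_UNIV secs_open_all subspace_UNIV secs_open_all _ gk])
        (auto intro!: pCk_add pCk_ident pCk_const simp del: pCk.simps)
    have "pCk (Suc 0) UNIV (\<lambda>_::real. \<lambda>x. (1 / \<epsilon>) *\<^sub>R (?g \<epsilon> (x + \<epsilon> *\<^sub>R c) - ?g \<epsilon> x)) UNIV"
      by (intro pCk_scaleR pCk_diff pCk_const subspace_UNIV secs_open_all sh gk)
    moreover have "frechet_derivative (smooth (c # bs) F \<epsilon>) (at x) b =
        (1 / \<epsilon>) *\<^sub>R (?g \<epsilon> (x + \<epsilon> *\<^sub>R c) - ?g \<epsilon> x)" for x
      unfolding eq unfolding True by (rule avg_derivative_along[where e = "\<lambda>\<epsilon>. \<epsilon>", OF g \<epsilon>])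
    ultimately show ?thesis by (simp only:)
  next
    case False
    then have "pCk (Suc 0) UNIV (\<lambda>_::real. \<lambda>x. frechet_derivative (?g \<epsilon>) (at x) b) UNIV"
      using Cons by auto
    from pCk_avg[OF continuous_on_const this, of \<epsilon> c]
    show ?thesis unfolding eq by (simp add: avg_def[abs_def] del: pCk.simps)
  qed
qed simp

lemma pCk_restrict_subspace:
  fixes f :: "'p::metric_space \<Rightarrow> 'e::euclidean_space \<Rightarrow> 'd::euclidean_space"
  assumes V: "subspace V" and T: "secs_open V T" and f: "pCk k UNIV f T'" and "T \<subseteq> T'"
  shows "pCk k V f T"
  using f
proof (induction k arbitrary: f)
  case 0
  then show ?case using \<open>T \<subseteq> T'\<close> by (auto intro: continuous_on_subset)
next
  case (Suc k)
  show ?case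
  proof (rule pCk_SucI[OF V T])
    show "continuous_on T (\<lambda>z. f (fst z) (snd z))"
      by (rule continuous_on_subset[OF pCk_continuous[OF Suc.prems] \<open>T \<subseteq> T'\<close>])
    show "(f p has_derivative frechet_derivative (f p) (at x)) (at x within V)" if "(p, x) \<in> T" for p x
      using pCk_has_derivative'[OF Suc.prems, of p x] that \<open>T \<subseteq> T'\<close> has_derivative_at_withinI by blast
    show "pCk k V (\<lambda>p x. frechet_derivative (f p) (at x) v) T" for v
      by (rule Suc.IH) (use Suc.prems in simp)
  qed
qed

text \<open>Averages need a map on the whole space, while f is given on S only. So f is multiplied
  by a bump function and pulled back along the projection onto V. The bump is 1 up to radius \<rho>
  and vanishes from R' < R on: a point whose projection leaves S projects outside
  \<open>cball c R'\<close>, and F is 0 around it. Averaging over all coordinate directions gains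
  one derivative, as each directional derivative of the average is of class C^1.\<close>

lemma C1_smoothing_family:
  fixes f :: "'e::euclidean_space \<Rightarrow> 'd::euclidean_space"
  assumes V: "subspace V" and S: "openin (top_of_set V) S" and \<rho>: "0 < \<rho>" "\<rho> < R"
    and sub: "cball c R \<inter> V \<subseteq> S" and f: "Ck_on (Suc 0) V f S"
  obtains g where "pCk (Suc 0) V g ((UNIV::real set) \<times> (ball c \<rho> \<inter> V))"
    "\<And>x. x \<in> ball c \<rho> \<inter> V \<Longrightarrow> g 0 x = f x"
    "\<And>\<epsilon>. \<epsilon> \<noteq> 0 \<Longrightarrow> Ck_on (Suc (Suc 0)) V (g \<epsilon>) (ball c \<rho> \<inter> V)"
proof -
  define R' where "R' = (\<rho> + R) / 2"
  have R': "\<rho> < R'" "R' < R" using \<rho> by (simp_all add: R'_def)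
  define F where "F y = bump c \<rho> R' (oproj V y) *\<^sub>R f (oproj V y)" for y
  have cp: "continuous_on UNIV (oproj V)"
    using linear_oproj[OF V] linear_continuous_on linear_conv_bounded_linear by blast
  have F: "pCk (Suc 0) UNIV (\<lambda>_::real. F) UNIV"
  proof (rule pCk_local)
    fix z :: "real \<times> 'e"
    show "\<exists>T'. z \<in> T' \<and> openin (top_of_set UNIV) T' \<and> pCk (Suc 0) UNIV (\<lambda>_::real. F) T'"
    proof (cases "oproj V (snd z) \<in> S")
      case True
      obtain W where W: "open W" "S = V \<inter> W" using S by (auto simp: openin_open)
      have op: "open (oproj V -` W)" using open_vimage[OF W(1) cp] .
      let ?T = "(UNIV::real set) \<times> (oproj V -` W)"
      have so: "secs_open UNIV ?T" by (rule secs_open_UNIV[OF op])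
      have pj: "pCk (Suc 0) UNIV (\<lambda>_::real. oproj V) ?T"
        by (rule pCk_linear[OF subspace_UNIV so linear_oproj[OF V] pCk_ident[OF subspace_UNIV so]])
      have soS: "secs_open V ((UNIV::real set) \<times> S)" by (rule secs_open_Times[OF S])
      have b: "pCk (Suc 0) V (\<lambda>_::real. bump c \<rho> R') (UNIV \<times> S)"
        by (rule pCk_bump[OF V soS]) (use \<rho> R' in auto)
      have fk: "pCk (Suc 0) V (\<lambda>_::real. f) (UNIV \<times> S)"
        by (rule Ck_on_imp_pCk[OF f]) (use openin_imp_subset[OF S] in auto)
      have "pCk (Suc 0) UNIV (\<lambda>_::real. F) ?T"
        unfolding F_def
        by (rule pCk_compose[OF subspace_UNIV so V soS pj pCk_scaleR[OF V soS b fk]])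
          (use W V in auto)
      moreover have "z \<in> ?T" using True W by (cases z) auto
      moreover have "openin (top_of_set UNIV) ?T" using op by (simp add: open_Times)
      ultimately show ?thesis by (intro exI[of _ ?T] conjI)
    next
      case False
      have op: "open (oproj V -` (- cball c R'))"
        by (rule open_vimage[OF open_Compl[OF closed_cball] cp])
      let ?T = "(UNIV::real set) \<times> (oproj V -` (- cball c R'))"
      have so: "secs_open UNIV ?T" by (rule secs_open_UNIV[OF op])
      have "pCk (Suc 0) UNIV (\<lambda>_::real. F) ?T"
      proof (rule pCk_cong[OF subspace_UNIV so pCk_const[OF subspace_UNIV so, of _ 0]])
        fix z assume "z \<in> ?T"
        then have "bump c \<rho> R' (oproj V (snd z)) = 0"
          by (intro bump_eq_0) (use \<rho> R' in \<open>auto simp: dist_commute\<close>)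
        then show "0 = F (snd z)" by (simp add: F_def)
      qed
      moreover have "oproj V (snd z) \<notin> cball c R'"
        using False sub R' oproj_in[OF V, of "snd z"] subset_cball[of R' R c] by auto
      then have "z \<in> ?T" by (cases z) auto
      moreover have "openin (top_of_set UNIV) ?T" using op by (simp add: open_Times)
      ultimately show ?thesis by (intro exI[of _ ?T] conjI)
    qed
  qed
  obtain bs where bs: "set bs = (Basis :: 'e set)" using finite_list finite_Basis by blast
  let ?g = "smooth bs F"
  have g: "pCk (Suc 0) UNIV ?g UNIV" by (rule pCk_smooth[OF F])
  have op: "openin (top_of_set V) (ball c \<rho> \<inter> V)" by (simp add: Int_commute openin_open_Int)
  show thesis
  proof
    show "pCk (Suc 0) V ?g (UNIV \<times> (ball c \<rho> \<inter> V))"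
      by (rule pCk_restrict_subspace[OF V secs_open_Times[OF op] g]) simp
    show "?g 0 x = f x" if "x \<in> ball c \<rho> \<inter> V" for x
    proof -
      have "bump c \<rho> R' x = 1" by (rule bump_eq_1) (use that \<rho> R' in \<open>auto simp: dist_commute\<close>)
      then show ?thesis using that V by (simp add: smooth_0 F_def)
    qed
    fix \<epsilon> :: real assume \<epsilon>: "\<epsilon> \<noteq> 0"
    have gk: "pCk (Suc 0) UNIV (\<lambda>_::real. ?g \<epsilon>) UNIV"
      by (rule Ck_on_imp_pCk[OF pCk_imp_Ck_on[OF g, of UNIV]]) auto
    have gd: "(?g \<epsilon> has_derivative frechet_derivative (?g \<epsilon>) (at x)) (at x)" for x
      using pCk_has_derivative'[OF gk, of _ x] by simp
    have "pCk (Suc (Suc 0)) UNIV (\<lambda>_::real. ?g \<epsilon>) UNIV"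
    proof (rule pCk_SucI[OF subspace_UNIV secs_open_all pCk_continuous[OF gk]])
      show "(?g \<epsilon> has_derivative frechet_derivative (?g \<epsilon>) (at x)) (at x)" for x by (rule gd)
      fix v
      have "pCk (Suc 0) UNIV (\<lambda>_::real. \<lambda>x. \<Sum>b\<in>Basis. (v \<bullet> b) *\<^sub>R frechet_derivative (?g \<epsilon>) (at x) b) UNIV"
        by (intro pCk_sum pCk_scaleR pCk_const subspace_UNIV secs_open_all smooth_derivative[OF F \<epsilon>]) (simp add: bs)
      then show "pCk (Suc 0) UNIV (\<lambda>_::real. \<lambda>x. frechet_derivative (?g \<epsilon>) (at x) v) UNIV"
        using linear_oproj_expand[OF subspace_UNIV has_derivative_linear[OF gd], of v]
        by (simp add: oproj_id[OF subspace_UNIV] del: pCk.simps)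
    qed
    then have "pCk (Suc (Suc 0)) V (\<lambda>_::real. ?g \<epsilon>) (UNIV \<times> (ball c \<rho> \<inter> V))"
      by (rule pCk_restrict_subspace[OF V secs_open_Times[OF op]]) simp
    then show "Ck_on (Suc (Suc 0)) V (?g \<epsilon>) (ball c \<rho> \<inter> V)"
      by (rule pCk_imp_Ck_on) simp
  qed
qed

text \<open>For r = 1 only the orders k \<le> 1 are asked for, which is what the averages provide;
  for r \<ge> 2 the map is already C^2 and the constant family serves.\<close>

lemma Cr_smoothing_family:
  fixes f :: "'e::euclidean_space \<Rightarrow> 'd::euclidean_space"
  assumes V: "subspace V" and S: "openin (top_of_set V) S" and \<rho>: "0 < \<rho>" "\<rho> < R"
    and sub: "cball c R \<inter> V \<subseteq> S" and r: "1 \<le> r" and f: "Cr_on r V f S"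
  obtains g where "\<And>k. enat k \<le> r \<Longrightarrow> pCk k V g ((UNIV::real set) \<times> (ball c \<rho> \<inter> V))"
    "\<And>x. x \<in> ball c \<rho> \<inter> V \<Longrightarrow> g 0 x = f x"
    "\<And>\<epsilon>. \<epsilon> \<noteq> 0 \<Longrightarrow> Ck_on (Suc (Suc 0)) V (g \<epsilon>) (ball c \<rho> \<inter> V)"
proof (cases "r = 1")
  case True
  have "Ck_on (Suc 0) V f S" using f True by (simp add: Cr_on_def one_enat_def del: Ck_on.simps)
  then obtain g where g: "pCk (Suc 0) V g ((UNIV::real set) \<times> (ball c \<rho> \<inter> V))"
    "\<And>x. x \<in> ball c \<rho> \<inter> V \<Longrightarrow> g 0 x = f x"
    "\<And>\<epsilon>. \<epsilon> \<noteq> 0 \<Longrightarrow> Ck_on (Suc (Suc 0)) V (g \<epsilon>) (ball c \<rho> \<inter> V)"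
    using C1_smoothing_family[OF V S \<rho> sub] by blast
  have "pCk k V g (UNIV \<times> (ball c \<rho> \<inter> V))" if "enat k \<le> r" for k
    by (rule pCk_mono[OF g(1)]) (use that True in \<open>simp add: one_enat_def\<close>)
  then show thesis using g(2,3) by (rule that)
next
  case False
  then have r2: "enat (Suc (Suc 0)) \<le> r"
    using r by (metis One_nat_def Suc_ile_eq one_enat_def order_le_less)
  have fk: "Ck_on k V f (ball c \<rho> \<inter> V)" if "enat k \<le> r" for k
  proof -
    have "pCk k V (\<lambda>_::real. f) (UNIV \<times> S)"
      by (rule Ck_on_imp_pCk) (use f that openin_imp_subset[OF S] in \<open>auto simp: Cr_on_def\<close>)
    then show ?thesis
      by (rule pCk_imp_Ck_on) (use sub \<rho> in auto)
  qed
  have "pCk k V (\<lambda>_::real. f) (UNIV \<times> (ball c \<rho> \<inter> V))" if "enat k \<le> r" for k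
    by (rule Ck_on_imp_pCk[OF fk[OF that]]) auto
  then show thesis
    by (rule that[of "\<lambda>_. f"]) (assumption | rule refl fk[OF r2])+
qed

section \<open>Charts\<close>

abbreviation chart_inv :: "('a, 'e) chart \<Rightarrow> 'e \<Rightarrow> 'a" where
  "chart_inv c \<equiv> inv_into (fst c) (snd c)"

context
  fixes M :: "('a, 'e::euclidean_space) mfd" and c :: "('a, 'e) chart"
  assumes c: "is_chart M c"
begin

lemma chart_openin: "openin (mf_top M) (fst c)"
  and chart_image_openin: "openin (top_of_set (mf_model M)) (snd c ` fst c)"
  and chart_homeo: "homeomorphic_map (subtopology (mf_top M) (fst c)) (top_of_set (snd c ` fst c)) (snd c)"
  using c unfolding is_chart_def by blast+

lemma chart_topspace: "topspace (subtopology (mf_top M) (fst c)) = fst c"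
  using openin_subset[OF chart_openin] by auto

lemma chart_in_topspace: "x \<in> fst c \<Longrightarrow> x \<in> topspace (mf_top M)"
  using openin_subset[OF chart_openin] by auto

lemma chart_inj: "inj_on (snd c) (fst c)"
  using homeomorphic_imp_injective_map[OF chart_homeo] unfolding chart_topspace .

lemma chart_inv_left [simp]: "x \<in> fst c \<Longrightarrow> chart_inv c (snd c x) = x"
  by (rule inv_into_f_f[OF chart_inj])

lemma chart_open_image:
  assumes "openin (mf_top M) W" "W \<subseteq> fst c"
  shows "openin (top_of_set (mf_model M)) (snd c ` W)"
proof -
  have "openin (subtopology (mf_top M) (fst c)) W"
    using assms openin_open_subtopology[OF chart_openin] by blast
  then have "openin (top_of_set (snd c ` fst c)) (snd c ` W)"
    using homeomorphic_imp_open_map[OF chart_homeo] unfolding open_map_def by blast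
  then show ?thesis using chart_image_openin openin_trans by blast
qed

lemma chart_open_preimage:
  assumes "openin (top_of_set (mf_model M)) Z"
  shows "openin (mf_top M) {x \<in> fst c. snd c x \<in> Z}"
proof -
  have "openin (top_of_set (snd c ` fst c)) (snd c ` fst c \<inter> Z)"
    by (rule openin_subset_trans[OF openin_Int[OF chart_image_openin assms] Int_lower1
        openin_imp_subset[OF chart_image_openin]])
  then have "openin (subtopology (mf_top M) (fst c)) {x \<in> fst c. snd c x \<in> snd c ` fst c \<inter> Z}"
    by (rule openin_continuous_map_preimage[OF homeomorphic_imp_continuous_map[OF chart_homeo], unfolded chart_topspace])
  then have "openin (mf_top M) {x \<in> fst c. snd c x \<in> snd c ` fst c \<inter> Z}"
    using openin_trans_full chart_openin by blast
  moreover have "{x \<in> fst c. snd c x \<in> snd c ` fst c \<inter> Z} = {x \<in> fst c. snd c x \<in> Z}" by auto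
  ultimately show ?thesis by simp
qed

lemma chart_compact_image:
  assumes "K \<subseteq> fst c"
  shows "compact (snd c ` K) \<longleftrightarrow> compactin (mf_top M) K"
proof -
  have "compactin (top_of_set (snd c ` fst c)) (snd c ` K) \<longleftrightarrow> compactin (subtopology (mf_top M) (fst c)) K"
    by (rule homeomorphic_map_compactness[OF chart_homeo, unfolded chart_topspace, OF assms])
  then show ?thesis
    using assms by (auto simp: compactin_subtopology image_mono)
qed

lemma chart_compact_preimage:
  assumes "compact Z" "Z \<subseteq> snd c ` fst c"
  shows "compactin (mf_top M) {x \<in> fst c. snd c x \<in> Z}"
proof -
  have "snd c ` {x \<in> fst c. snd c x \<in> Z} = Z" using assms(2) by auto
  then show ?thesis
    using chart_compact_image[of "{x \<in> fst c. snd c x \<in> Z}"] assms(1) by auto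
qed

lemma local_rep_chart [simp]: "x \<in> fst c \<Longrightarrow> local_rep c f c' (snd c x) = snd c' (f x)"
  by (simp add: local_rep_def)

lemma chart_in_model: "x \<in> fst c \<Longrightarrow> snd c x \<in> mf_model M"
  using openin_imp_subset[OF chart_image_openin] by blast

end

lemma Cr_manifold_chart: "Cr_manifold r M \<Longrightarrow> c \<in> mf_atlas M \<Longrightarrow> is_chart M c"
  unfolding Cr_manifold_def by blast

lemma Cr_manifold_model: "Cr_manifold r M \<Longrightarrow> subspace (mf_model M)"
  unfolding Cr_manifold_def by blast

lemma Cr_manifold_covers:
  assumes "Cr_manifold r M" "x \<in> topspace (mf_top M)"
  obtains c where "c \<in> mf_atlas M" "x \<in> fst c"
  using assms unfolding Cr_manifold_def by blast

lemma Cr_manifold_change: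
  assumes "Cr_manifold r M" "c \<in> mf_atlas M" "c' \<in> mf_atlas M" "enat k \<le> r"
  shows "Ck_on k (mf_model M) (local_rep c id c') (snd c ` (fst c \<inter> fst c'))"
  using assms unfolding Cr_manifold_def Cr_compatible_def Cr_on_def by blast

lemma Cr_manifold_change_open:
  assumes "Cr_manifold r M" "c \<in> mf_atlas M" "c' \<in> mf_atlas M"
  shows "openin (top_of_set (mf_model M)) (snd c ` (fst c \<inter> fst c'))"
  using assms by (intro chart_open_image[OF Cr_manifold_chart] openin_Int chart_openin[OF Cr_manifold_chart]) auto

lemma Cr_maps_in: "\<phi> \<in> Cr_maps r M M' \<Longrightarrow> x \<in> topspace (mf_top M) \<Longrightarrow> \<phi> x \<in> topspace (mf_top M')"
  unfolding Cr_maps_def by blast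

lemma Cr_maps_preimage_open:
  assumes "\<phi> \<in> Cr_maps r M M'" "openin (mf_top M) U" "openin (mf_top M') W"
  shows "openin (mf_top M) (U \<inter> \<phi> -` W)"
proof -
  have "openin (mf_top M) {x \<in> topspace (mf_top M). \<phi> x \<in> W}"
    using assms(1,3) unfolding Cr_maps_def by (auto intro: openin_continuous_map_preimage)
  then have "openin (mf_top M) (U \<inter> {x \<in> topspace (mf_top M). \<phi> x \<in> W})"
    using assms(2) by blast
  moreover have "U \<inter> {x \<in> topspace (mf_top M). \<phi> x \<in> W} = U \<inter> \<phi> -` W"
    using openin_subset[OF assms(2)] by auto
  ultimately show ?thesis by simp
qed

lemma Cr_maps_local_rep:
  assumes "\<phi> \<in> Cr_maps r M M'" "c \<in> mf_atlas M" "c' \<in> mf_atlas M'" "enat k \<le> r"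
  shows "Ck_on k (mf_model M) (local_rep c \<phi> c') (snd c ` (fst c \<inter> \<phi> -` fst c'))"
  using assms unfolding Cr_maps_def Cr_on_def by blast

lemma Cr_maps_mono: "\<phi> \<in> Cr_maps r M M' \<Longrightarrow> s \<le> r \<Longrightarrow> \<phi> \<in> Cr_maps s M M'"
  unfolding Cr_maps_def Cr_on_def by (blast intro: order_trans)

lemma foliation_maps_mono: "s \<le> r \<Longrightarrow> foliation_maps r M F M' F' \<subseteq> foliation_maps s M F M' F'"
proof
  fix \<phi> assume "s \<le> r" "\<phi> \<in> foliation_maps r M F M' F'"
  then show "\<phi> \<in> foliation_maps s M F M' F'"
    unfolding foliation_maps_def using Cr_maps_mono[of \<phi> r M M' s] by simp
qed

lemma foliation_maps_Cr: "\<phi> \<in> foliation_maps r M F M' F' \<Longrightarrow> \<phi> \<in> Cr_maps r M M'"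
  unfolding foliation_maps_def by blast

lemma Cr_foliation_manifold: "Cr_foliation r M F \<Longrightarrow> Cr_manifold r M"
  and Cr_foliation_atlas: "Cr_foliation r M F \<Longrightarrow> F \<subseteq> mf_atlas M"
  unfolding Cr_foliation_def by blast+

lemma Cr_foliation_covers:
  assumes "Cr_foliation r M F" "x \<in> topspace (mf_top M)"
  obtains c where "c \<in> F" "x \<in> fst c"
  using assms unfolding Cr_foliation_def by blast

text \<open>The tube lemma in terms of filters: finitely many of the sets B cover Z, and a finite
  conjunction of eventual statements is eventual. It turns estimates near single points into
  estimates uniform on a compact set.\<close>

lemma compact_tube:
  fixes Z :: "'z::topological_space set" and p0 :: "'p::topological_space"
  assumes "compact Z"
    and loc: "\<And>z. z \<in> Z \<Longrightarrow> \<exists>B. open B \<and> z \<in> B \<and> eventually (\<lambda>p. \<forall>y\<in>B \<inter> Z. R p y) (nhds p0)"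
  shows "eventually (\<lambda>p. \<forall>z\<in>Z. R p z) (nhds p0)"
proof -
  define \<C> where "\<C> = {B. open B \<and> eventually (\<lambda>p. \<forall>y\<in>B \<inter> Z. R p y) (nhds p0)}"
  have "Z \<subseteq> \<Union>\<C>" using loc unfolding \<C>_def by fast
  moreover have "\<forall>B\<in>\<C>. open B" unfolding \<C>_def by simp
  ultimately obtain \<D> where D: "\<D> \<subseteq> \<C>" "finite \<D>" "Z \<subseteq> \<Union>\<D>"
    using \<open>compact Z\<close> by (meson compactE)
  have "\<forall>B\<in>\<D>. eventually (\<lambda>p. \<forall>y\<in>B \<inter> Z. R p y) (nhds p0)"
    using D(1) unfolding \<C>_def by auto
  then have "eventually (\<lambda>p. \<forall>B\<in>\<D>. \<forall>y\<in>B \<inter> Z. R p y) (nhds p0)"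
    by (rule eventually_ball_finite[OF D(2)])
  then show ?thesis
  proof (rule eventually_mono, intro ballI)
    fix p z assume R: "\<forall>B\<in>\<D>. \<forall>y\<in>B \<inter> Z. R p y" and "z \<in> Z"
    then obtain B where "B \<in> \<D>" "z \<in> B" using D(3) by auto
    with R \<open>z \<in> Z\<close> show "R p z" by auto
  qed
qed

section \<open>Perturbing a foliation map along the plaques\<close>

lemma secs_open_openin:
  fixes T :: "('p::metric_space \<times> 'e::euclidean_space) set"
  assumes "openin (top_of_set (UNIV \<times> V)) T"
  shows "secs_open V T"
  unfolding secs_open_def
proof
  fix z assume z: "z \<in> T"
  obtain G where G: "open G" "T = (UNIV \<times> V) \<inter> G" using assms by (auto simp: openin_open)
  obtain p x where zp: "z = (p, x)" by (cases z)
  have "(p, x) \<in> G" using z G(2) zp by simp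
  then obtain A B where AB: "open A" "open B" "(p, x) \<in> A \<times> B" "A \<times> B \<subseteq> G"
    using open_prod_elim[OF G(1)] by metis
  obtain e where e: "e > 0" "ball x e \<subseteq> B" using AB openE by blast
  have "(p, y) \<in> T" if "y \<in> V" "dist y x < e" for y
  proof -
    have "y \<in> B" using e(2) that(2) by (auto simp: dist_commute)
    then show ?thesis using AB(3,4) that(1) G(2) by auto
  qed
  then show "snd z \<in> V \<and> (\<exists>e>0. \<forall>y\<in>V. dist y (snd z) < e \<longrightarrow> (fst z, y) \<in> T)"
    using e(1) z G(2) zp by auto
qed

text \<open>
  \<open>Psi p\<close> displaces \<open>\<phi>\<close> along the plaques of \<open>c'\<close>, by \<open>q p\<close> in the leaf coordinate. Parameters in
  \<open>P0\<close> are so close to \<open>p0\<close> that the displaced points remain in the chart.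
\<close>

locale perturbation =
  fixes r :: enat
    and M :: "('a, 't::euclidean_space \<times> 'b::euclidean_space) mfd"
    and F :: "('a, 't \<times> 'b) chart set"
    and M' :: "('c, 'u::euclidean_space \<times> 'd::euclidean_space) mfd"
    and F' :: "('c, 'u \<times> 'd) chart set"
    and \<phi> :: "'a \<Rightarrow> 'c" and c :: "('a, 't \<times> 'b) chart" and c' :: "('c, 'u \<times> 'd) chart"
    and Z :: "('t \<times> 'b) set" and q :: "'p::metric_space \<Rightarrow> 't \<times> 'b \<Rightarrow> 'd" and p0 :: 'p and P0 :: "'p set"
  assumes fol: "Cr_foliation r M F" and fol': "Cr_foliation r M' F'"
    and phi: "\<phi> \<in> foliation_maps r M F M' F'"
    and cF: "c \<in> F" and cF': "c' \<in> F'"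
    and Z: "compact Z" "Z \<subseteq> snd c ` (fst c \<inter> \<phi> -` fst c')"
    and q0: "\<And>z. q p0 z = 0" and qZ: "\<And>p z. z \<notin> Z \<Longrightarrow> q p z = 0"
    and qk: "\<And>k. enat k \<le> r \<Longrightarrow> pCk k (mf_model M) q (UNIV \<times> snd c ` (fst c \<inter> \<phi> -` fst c'))"
    and P0: "open P0" "p0 \<in> P0"
      "\<And>p z. p \<in> P0 \<Longrightarrow> z \<in> snd c ` (fst c \<inter> \<phi> -` fst c') \<Longrightarrow>
        local_rep c \<phi> c' z + (0, q p z) \<in> snd c' ` fst c'"
begin

abbreviation "V \<equiv> mf_model M"
abbreviation "V' \<equiv> mf_model M'"

definition "Dom = fst c \<inter> \<phi> -` fst c'"
definition "Supp = {x \<in> fst c. snd c x \<in> Z}"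

definition Psi :: "'p \<Rightarrow> 'a \<Rightarrow> 'c" where
  "Psi p x = (if x \<in> Dom then chart_inv c' (snd c' (\<phi> x) + (0, q p (snd c x))) else \<phi> x)"

lemma mfd: "Cr_manifold r M" and mfd': "Cr_manifold r M'"
  using fol fol' by (simp_all add: Cr_foliation_manifold)

lemma V: "subspace V" and V': "subspace V'"
  using mfd mfd' by (simp_all add: Cr_manifold_model)

lemma atl: "c \<in> mf_atlas M" and atl': "c' \<in> mf_atlas M'"
  using Cr_foliation_atlas[OF fol] Cr_foliation_atlas[OF fol'] cF cF' by blast+

lemma chart: "is_chart M c" and chart': "is_chart M' c'"
  using Cr_manifold_chart mfd mfd' atl atl' by blast+

lemma phiC: "\<phi> \<in> Cr_maps r M M'"
  using phi by (rule foliation_maps_Cr)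

lemma Dom_open: "openin (mf_top M) Dom"
  unfolding Dom_def by (rule Cr_maps_preimage_open[OF phiC chart_openin[OF chart] chart_openin[OF chart']])

lemma Dom_image_open: "openin (top_of_set V) (snd c ` Dom)"
  by (rule chart_open_image[OF chart Dom_open]) (simp add: Dom_def)

lemma Psi_chart:
  assumes "p \<in> P0" "x \<in> Dom"
  shows "Psi p x \<in> fst c'" "snd c' (Psi p x) = snd c' (\<phi> x) + (0, q p (snd c x))"
proof -
  have x: "x \<in> fst c" using assms(2) by (simp add: Dom_def)
  have "local_rep c \<phi> c' (snd c x) + (0, q p (snd c x)) \<in> snd c' ` fst c'"
    using assms by (intro P0(3)) (auto simp: Dom_def)
  then have "snd c' (\<phi> x) + (0, q p (snd c x)) \<in> snd c' ` fst c'"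
    by (simp add: local_rep_chart[OF chart x])
  then show "Psi p x \<in> fst c'" "snd c' (Psi p x) = snd c' (\<phi> x) + (0, q p (snd c x))"
    using assms(2) by (simp_all add: Psi_def inv_into_into f_inv_into_f)
qed

lemma Supp_Dom: "Supp \<subseteq> Dom"
proof
  fix x assume "x \<in> Supp"
  then have x: "x \<in> fst c" "snd c x \<in> snd c ` Dom" using Z by (auto simp: Supp_def Dom_def)
  then obtain y where "y \<in> Dom" "snd c x = snd c y" by blast
  then show "x \<in> Dom" using inj_onD[OF chart_inj[OF chart]] x(1) by (auto simp: Dom_def)
qed

lemma Psi_outside: "x \<notin> Supp \<Longrightarrow> Psi p x = \<phi> x"
  using qZ chart_inv_left[OF chart'] by (auto simp: Psi_def Supp_def Dom_def zero_prod_def[symmetric])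

lemma Psi_p0: "Psi p0 = \<phi>"
proof
  show "Psi p0 x = \<phi> x" for x
    using q0 chart_inv_left[OF chart'] by (auto simp: Psi_def Dom_def zero_prod_def[symmetric])
qed

lemma Supp_compact: "compactin (mf_top M) Supp"
  unfolding Supp_def using Z by (intro chart_compact_preimage[OF chart]) auto

lemma outside_open: "openin (mf_top M) (topspace (mf_top M) - Supp)"
proof -
  have "Hausdorff_space (mf_top M)" using mfd unfolding Cr_manifold_def by blast
  then have "closedin (mf_top M) Supp" using Supp_compact by (rule compactin_imp_closedin)
  then show ?thesis by blast
qed

lemma covered: "x \<in> topspace (mf_top M) \<Longrightarrow> x \<in> topspace (mf_top M) - Supp \<or> x \<in> Dom"
  using Supp_Dom by blast

text \<open>The expression of \<open>Psi p\<close> in the charts \<Theta> and \<open>c'\<close>,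
  written through the coordinate change from \<Theta> to c so that its class can be read off from
  the composition rule.\<close>

definition disp :: "('a, 't \<times> 'b) chart \<Rightarrow> 'p \<Rightarrow> 't \<times> 'b \<Rightarrow> 'u \<times> 'd" where
  "disp \<Theta> p z = local_rep c \<phi> c' (local_rep \<Theta> id c z) + (0, q p (local_rep \<Theta> id c z))"

context
  fixes \<Theta> assumes \<Theta>: "\<Theta> \<in> mf_atlas M"
begin

lemma chart_\<Theta>: "is_chart M \<Theta>"
  using Cr_manifold_chart[OF mfd \<Theta>] .

lemma disp_eq: "x \<in> fst \<Theta> \<inter> Dom \<Longrightarrow> disp \<Theta> p (snd \<Theta> x) = snd c' (\<phi> x) + (0, q p (snd c x))"
  by (simp add: disp_def Dom_def local_rep_chart[OF chart_\<Theta>] local_rep_chart[OF chart])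

lemma dom_open: "openin (top_of_set V) (snd \<Theta> ` (fst \<Theta> \<inter> Dom))"
  by (rule chart_open_image[OF chart_\<Theta> openin_Int[OF chart_openin[OF chart_\<Theta>] Dom_open]]) simp

lemma pCk_disp:
  assumes k: "enat k \<le> r"
  shows "pCk k V (disp \<Theta>) (P0 \<times> snd \<Theta> ` (fst \<Theta> \<inter> Dom))"
proof -
  have so: "secs_open V (P0 \<times> snd \<Theta> ` (fst \<Theta> \<inter> Dom))" by (rule secs_open_Times[OF dom_open])
  have so2: "secs_open V ((UNIV::'p set) \<times> snd c ` Dom)" by (rule secs_open_Times[OF Dom_image_open])
  have "Ck_on k V (local_rep \<Theta> id c) (snd \<Theta> ` (fst \<Theta> \<inter> fst c))"
    by (rule Cr_manifold_change[OF mfd \<Theta> atl k])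
  then have t: "pCk k V (\<lambda>_::'p. local_rep \<Theta> id c) (P0 \<times> snd \<Theta> ` (fst \<Theta> \<inter> Dom))"
    by (rule Ck_on_imp_pCk[OF _ openin_imp_subset[OF Cr_manifold_change_open[OF mfd \<Theta> atl]]])
      (auto simp: Dom_def)
  have "Ck_on k V (local_rep c \<phi> c') (snd c ` Dom)"
    unfolding Dom_def by (rule Cr_maps_local_rep[OF phiC atl atl' k])
  then have f: "pCk k V (\<lambda>_::'p. local_rep c \<phi> c') (UNIV \<times> snd c ` Dom)"
    by (rule Ck_on_imp_pCk[OF _ openin_imp_subset[OF Dom_image_open]]) auto
  have "pCk k V q (UNIV \<times> snd c ` Dom)" unfolding Dom_def by (rule qk[OF k])
  then have q: "pCk k V (\<lambda>p z. (0::'u, q p z)) (UNIV \<times> snd c ` Dom)"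
    by (rule pCk_linear[OF V so2, of "\<lambda>b. (0, b)", rotated]) (rule linearI; simp)
  have "pCk k V (\<lambda>p z. local_rep c \<phi> c' z + (0, q p z)) (UNIV \<times> snd c ` Dom)"
    by (rule pCk_add[OF V so2 f q])
  then have "pCk k V (\<lambda>p z. local_rep c \<phi> c' (local_rep \<Theta> id c z) + (0, q p (local_rep \<Theta> id c z)))
      (P0 \<times> snd \<Theta> ` (fst \<Theta> \<inter> Dom))"
  proof (rule pCk_compose[OF V so V so2 t])
    fix p z assume "(p, z) \<in> P0 \<times> snd \<Theta> ` (fst \<Theta> \<inter> Dom)"
    then obtain x where "x \<in> fst \<Theta> \<inter> Dom" "z = snd \<Theta> x" by blast
    then show "(p, local_rep \<Theta> id c z) \<in> UNIV \<times> snd c ` Dom"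
      by (simp add: local_rep_chart[OF chart_\<Theta>])
  qed
  then show ?thesis by (simp only: disp_def[abs_def])
qed

text \<open>
  In the chart \<open>\<Theta>\<close>, \<open>Tr W\<close> is the preimage of \<open>W\<close> under \<open>(p, x) \<mapsto> Psi p x\<close>. It is the union of
  the open parts where \<open>Psi p = \<phi>\<close> and where \<open>Psi p\<close> is given by \<open>disp\<close>.
\<close>

definition "Tr W = {y \<in> P0 \<times> snd \<Theta> ` fst \<Theta>. Psi (fst y) (chart_inv \<Theta> (snd y)) \<in> W}"
definition "Tr1 W = P0 \<times> snd \<Theta> ` (fst \<Theta> \<inter> (topspace (mf_top M) - Supp) \<inter> \<phi> -` W)"
definition "Tr2 W = (P0 \<times> snd \<Theta> ` (fst \<Theta> \<inter> Dom)) \<inter> (\<lambda>y. disp \<Theta> (fst y) (snd y)) -` (snd c' ` (fst c' \<inter> W))"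

lemma Psi_Tr2:
  assumes "p \<in> P0" "x \<in> fst \<Theta> \<inter> Dom"
  shows "disp \<Theta> p (snd \<Theta> x) = snd c' (Psi p x)"
  using disp_eq[OF assms(2)] Psi_chart(2)[of p x] assms by simp

lemma Tr2_iff:
  assumes "p \<in> P0" "x \<in> fst \<Theta> \<inter> Dom"
  shows "(p, snd \<Theta> x) \<in> Tr2 W \<longleftrightarrow> Psi p x \<in> W"
proof -
  have "snd c' (Psi p x) \<in> snd c' ` (fst c' \<inter> W) \<longleftrightarrow> Psi p x \<in> W"
    using inj_on_image_mem_iff[OF chart_inj[OF chart'], of "Psi p x" "fst c' \<inter> W"] Psi_chart(1)[of p x] assms by auto
  then show ?thesis using Psi_Tr2[OF assms] assms by (simp add: Tr2_def)
qed

lemma Tr_mem: "x \<in> fst \<Theta> \<Longrightarrow> (p, snd \<Theta> x) \<in> Tr W \<longleftrightarrow> p \<in> P0 \<and> Psi p x \<in> W"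
  using chart_inv_left[OF chart_\<Theta>] by (auto simp: Tr_def)

lemma Tr_eq: "Tr W = Tr1 W \<union> Tr2 W"
proof (intro equalityI subsetI)
  fix y assume "y \<in> Tr W"
  then obtain p x where y: "y = (p, snd \<Theta> x)" "p \<in> P0" "x \<in> fst \<Theta>" unfolding Tr_def by auto
  then have W: "Psi p x \<in> W" using \<open>y \<in> Tr W\<close> Tr_mem by simp
  from covered[OF chart_in_topspace[OF chart_\<Theta> y(3)]] show "y \<in> Tr1 W \<union> Tr2 W"
  proof
    assume x: "x \<in> topspace (mf_top M) - Supp"
    then have "\<phi> x \<in> W" using W Psi_outside by simp
    then show ?thesis using x y by (auto simp: Tr1_def)
  next
    assume "x \<in> Dom"
    then show ?thesis using Tr2_iff[of p x W] y W by simp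
  qed
next
  fix y assume "y \<in> Tr1 W \<union> Tr2 W"
  then show "y \<in> Tr W"
  proof
    assume "y \<in> Tr1 W"
    then obtain p x where y: "y = (p, snd \<Theta> x)" "p \<in> P0" "x \<in> fst \<Theta>" "x \<notin> Supp" "\<phi> x \<in> W"
      unfolding Tr1_def by auto
    then show ?thesis using Tr_mem Psi_outside by simp
  next
    assume y2: "y \<in> Tr2 W"
    then obtain p x where y: "y = (p, snd \<Theta> x)" "p \<in> P0" "x \<in> fst \<Theta> \<inter> Dom"
      unfolding Tr2_def by auto
    then show ?thesis using Tr_mem[of x p W] Tr2_iff[of p x W] y2 by simp
  qed
qed

lemma Tr1_open: "openin (mf_top M') W \<Longrightarrow> openin (top_of_set (UNIV \<times> V)) (Tr1 W)"
  unfolding Tr1_def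
  by (intro openin_Times chart_open_image[OF chart_\<Theta>] Cr_maps_preimage_open[OF phiC]
      openin_Int chart_openin[OF chart_\<Theta>] outside_open) (use P0(1) in auto)

lemma Tr2_open:
  assumes "openin (mf_top M') W"
  shows "openin (top_of_set (UNIV \<times> V)) (Tr2 W)"
proof -
  have "enat 0 \<le> r" by (simp add: zero_enat_def[symmetric])
  from pCk_continuous[OF pCk_disp[OF this]]
  have "continuous_on (P0 \<times> snd \<Theta> ` (fst \<Theta> \<inter> Dom)) (\<lambda>y. disp \<Theta> (fst y) (snd y))" .
  moreover have "openin (top_of_set V') (snd c' ` (fst c' \<inter> W))"
    by (rule chart_open_image[OF chart' openin_Int[OF chart_openin[OF chart'] assms]]) simp
  moreover have "(\<lambda>y. disp \<Theta> (fst y) (snd y)) \<in> P0 \<times> snd \<Theta> ` (fst \<Theta> \<inter> Dom) \<rightarrow> V'"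
  proof
    fix y assume "y \<in> P0 \<times> snd \<Theta> ` (fst \<Theta> \<inter> Dom)"
    then obtain p x where y: "y = (p, snd \<Theta> x)" "p \<in> P0" "x \<in> fst \<Theta> \<inter> Dom" by auto
    then show "disp \<Theta> (fst y) (snd y) \<in> V'"
      using Psi_Tr2 chart_in_model[OF chart' Psi_chart(1)[of p x]] by simp
  qed
  ultimately have "openin (top_of_set (P0 \<times> snd \<Theta> ` (fst \<Theta> \<inter> Dom))) (Tr2 W)"
    unfolding Tr2_def by (intro continuous_openin_preimage)
  moreover have "openin (top_of_set (UNIV \<times> V)) (P0 \<times> snd \<Theta> ` (fst \<Theta> \<inter> Dom))"
    by (intro openin_Times dom_open) (use P0(1) in auto)
  ultimately show ?thesis by (rule openin_trans)
qed

lemma Tr_open: "openin (mf_top M') W \<Longrightarrow> openin (top_of_set (UNIV \<times> V)) (Tr W)"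
  unfolding Tr_eq by (intro openin_Un Tr1_open Tr2_open)

text \<open>On \<open>Tr1\<close> the map is \<phi>, and on \<open>Tr2\<close> it is
  \<open>disp\<close> followed by the coordinate change from \<open>c'\<close> to \<Theta>'. Both
  pieces are open in the union, so the classes glue.\<close>

lemma pCk_Psi:
  assumes \<Theta>': "\<Theta>' \<in> mf_atlas M'" and k: "enat k \<le> r"
  shows "pCk k V (\<lambda>p. local_rep \<Theta> (Psi p) \<Theta>') (Tr (fst \<Theta>'))"
proof (rule pCk_local)
  have chart\<Theta>': "is_chart M' \<Theta>'" by (rule Cr_manifold_chart[OF mfd' \<Theta>'])
  let ?W = "fst \<Theta>'"
  have W: "openin (mf_top M') ?W" by (rule chart_openin[OF chart\<Theta>'])
  have TV: "Tr ?W \<subseteq> UNIV \<times> V" using openin_imp_subset[OF Tr_open[OF W]] .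
  have 1: "pCk k V (\<lambda>p. local_rep \<Theta> (Psi p) \<Theta>') (Tr1 ?W)"
  proof -
    have so: "secs_open V (Tr1 ?W)" by (rule secs_open_openin[OF Tr1_open[OF W]])
    have "pCk k V (\<lambda>_::'p. local_rep \<Theta> \<phi> \<Theta>') (Tr1 ?W)"
      by (rule Ck_on_imp_pCk[OF Cr_maps_local_rep[OF phiC \<Theta> \<Theta>' k]])
        (auto simp: Tr1_def chart_in_model[OF chart_\<Theta>])
    then show ?thesis
    proof (rule pCk_cong[OF V so])
      fix y assume "y \<in> Tr1 ?W"
      then obtain p x where y: "y = (p, snd \<Theta> x)" "p \<in> P0" "x \<in> fst \<Theta>" "x \<notin> Supp"
        unfolding Tr1_def by auto
      then show "local_rep \<Theta> \<phi> \<Theta>' (snd y) = local_rep \<Theta> (Psi (fst y)) \<Theta>' (snd y)"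
        by (simp add: local_rep_chart[OF chart_\<Theta>] Psi_outside)
    qed
  qed
  have 2: "pCk k V (\<lambda>p. local_rep \<Theta> (Psi p) \<Theta>') (Tr2 ?W)"
  proof -
    have so: "secs_open V (Tr2 ?W)" by (rule secs_open_openin[OF Tr2_open[OF W]])
    have so': "secs_open V' ((UNIV::'p set) \<times> snd c' ` (fst c' \<inter> ?W))"
      by (rule secs_open_Times[OF Cr_manifold_change_open[OF mfd' atl' \<Theta>']])
    have d: "pCk k V (disp \<Theta>) (Tr2 ?W)"
      by (rule pCk_subset[OF pCk_disp[OF k]]) (auto simp: Tr2_def)
    have "pCk k V' (\<lambda>_::'p. local_rep c' id \<Theta>') (UNIV \<times> snd c' ` (fst c' \<inter> ?W))"
      by (rule Ck_on_imp_pCk[OF Cr_manifold_change[OF mfd' atl' \<Theta>' k]])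
        (auto simp: chart_in_model[OF chart'])
    then have "pCk k V (\<lambda>p z. local_rep c' id \<Theta>' (disp \<Theta> p z)) (Tr2 ?W)"
      by (rule pCk_compose[OF V so V' so' d]) (auto simp: Tr2_def)
    then show ?thesis
    proof (rule pCk_cong[OF V so])
      fix y assume "y \<in> Tr2 ?W"
      then obtain p x where y: "y = (p, snd \<Theta> x)" "p \<in> P0" "x \<in> fst \<Theta> \<inter> Dom"
        unfolding Tr2_def by auto
      then show "local_rep c' id \<Theta>' (disp \<Theta> (fst y) (snd y)) = local_rep \<Theta> (Psi (fst y)) \<Theta>' (snd y)"
        using Psi_Tr2[OF y(2,3)] Psi_chart(1)[of p x]
        by (simp add: local_rep_chart[OF chart_\<Theta>] local_rep_chart[OF chart'])
    qed
  qed
  fix y assume y: "y \<in> Tr ?W"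
  then have "y \<in> Tr1 ?W \<or> y \<in> Tr2 ?W" using Tr_eq by simp
  then show "\<exists>T'. y \<in> T' \<and> openin (top_of_set (Tr ?W)) T' \<and> pCk k V (\<lambda>p. local_rep \<Theta> (Psi p) \<Theta>') T'"
  proof
    assume "y \<in> Tr1 ?W"
    moreover have "openin (top_of_set (Tr ?W)) (Tr1 ?W)"
      by (rule openin_subset_trans[OF Tr1_open[OF W] _ TV]) (simp add: Tr_eq)
    ultimately show ?thesis using 1 by (intro exI[of _ "Tr1 ?W"] conjI)
  next
    assume "y \<in> Tr2 ?W"
    moreover have "openin (top_of_set (Tr ?W)) (Tr2 ?W)"
      by (rule openin_subset_trans[OF Tr2_open[OF W] _ TV]) (simp add: Tr_eq)
    ultimately show ?thesis using 2 by (intro exI[of _ "Tr2 ?W"] conjI)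
  qed
qed

end

lemma Psi_in: "p \<in> P0 \<Longrightarrow> x \<in> topspace (mf_top M) \<Longrightarrow> Psi p x \<in> topspace (mf_top M')"
  using covered[of x] Psi_outside[of x p] Cr_maps_in[OF phiC, of x] Psi_chart(1)[of p x]
    chart_in_topspace[OF chart'] by auto

text \<open>The preimage of W, seen in a chart \<Theta>, is the slice of the open set
  \<open>Tr \<Theta> W\<close> at p.\<close>

lemma Psi_continuous:
  assumes p: "p \<in> P0"
  shows "continuous_map (mf_top M) (mf_top M') (Psi p)"
  unfolding continuous_map_def
proof (intro conjI allI impI)
  show "Psi p \<in> topspace (mf_top M) \<rightarrow> topspace (mf_top M')" using Psi_in[OF p] by auto
  fix W assume W: "openin (mf_top M') W"
  show "openin (mf_top M) {x \<in> topspace (mf_top M). Psi p x \<in> W}"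
  proof (subst openin_subopen, intro ballI)
    fix x assume x: "x \<in> {x \<in> topspace (mf_top M). Psi p x \<in> W}"
    then obtain \<Theta> where \<Theta>: "\<Theta> \<in> mf_atlas M" "x \<in> fst \<Theta>"
      using Cr_manifold_covers[OF mfd] by blast
    have "openin (top_of_set V) {z. (p, z) \<in> Tr \<Theta> W}"
      by (rule section_openin[OF secs_open_openin[OF Tr_open[OF \<Theta>(1) W]]])
    from chart_open_preimage[OF chart_\<Theta>[OF \<Theta>(1)] this]
    have "openin (mf_top M) {x \<in> fst \<Theta>. Psi p x \<in> W}"
      using Tr_mem[OF \<Theta>(1)] p by (simp cong: conj_cong)
    moreover have "{x \<in> fst \<Theta>. Psi p x \<in> W} \<subseteq> {x \<in> topspace (mf_top M). Psi p x \<in> W}"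
      using chart_in_topspace[OF chart_\<Theta>[OF \<Theta>(1)]] by auto
    moreover have "x \<in> {x \<in> fst \<Theta>. Psi p x \<in> W}" using x \<Theta>(2) by simp
    ultimately show "\<exists>T. openin (mf_top M) T \<and> x \<in> T \<and> T \<subseteq> {x \<in> topspace (mf_top M). Psi p x \<in> W}"
      by (intro exI[of _ "{x \<in> fst \<Theta>. Psi p x \<in> W}"] conjI)
  qed
qed

lemma Psi_Cr:
  assumes p: "p \<in> P0"
  shows "Psi p \<in> Cr_maps r M M'"
  unfolding Cr_maps_def
proof (intro CollectI conjI ballI)
  have "Psi p x = undefined" if "x \<notin> topspace (mf_top M)" for x
  proof -
    have "x \<notin> Supp" using that chart_in_topspace[OF chart] by (auto simp: Supp_def)
    then have "Psi p x = \<phi> x" by (rule Psi_outside)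
    also have "\<dots> = undefined" using phiC that unfolding Cr_maps_def by (auto simp: PiE_def extensional_def)
    finally show ?thesis .
  qed
  then show "Psi p \<in> topspace (mf_top M) \<rightarrow>\<^sub>E topspace (mf_top M')"
    using Psi_in[OF p] by auto
  show "continuous_map (mf_top M) (mf_top M') (Psi p)" by (rule Psi_continuous[OF p])
  fix \<Theta> \<Theta>' assume \<Theta>: "\<Theta> \<in> mf_atlas M" and \<Theta>': "\<Theta>' \<in> mf_atlas M'"
  show "Cr_on r V (local_rep \<Theta> (Psi p) \<Theta>') (snd \<Theta> ` (fst \<Theta> \<inter> Psi p -` fst \<Theta>'))"
    unfolding Cr_on_def
  proof (intro allI impI)
    fix k assume k: "enat k \<le> r"
    show "Ck_on k V (local_rep \<Theta> (Psi p) \<Theta>') (snd \<Theta> ` (fst \<Theta> \<inter> Psi p -` fst \<Theta>'))"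
      by (rule pCk_imp_Ck_on[OF pCk_Psi[OF \<Theta> \<Theta>' k], of _ p]) (use Tr_mem[OF \<Theta>] p in auto)
  qed
qed

lemma local_proj_Psi:
  assumes "p \<in> P0" "x \<in> Dom"
  shows "local_proj c' (Psi p x) = local_proj c' (\<phi> x)"
  using Psi_chart(2)[OF assms] by (simp add: local_proj_def)

text \<open>The displacement changes the leaf coordinate of \<open>c'\<close> only, so the old and
  the new image point lie in one plaque of \<open>c'\<close>. Hence a leaf is sent into the same
  leaf as before.\<close>

lemma Psi_leaf:
  assumes p: "p \<in> P0" and x: "x \<in> topspace (mf_top M)"
  shows "(same_plaque F')\<^sup>*\<^sup>* (\<phi> x) (Psi p x)"
proof (cases "x \<in> Dom")
  case True
  then have "same_plaque F' (\<phi> x) (Psi p x)"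
    unfolding same_plaque_def using Psi_chart(1)[OF p True] local_proj_Psi[OF p True] cF'
    by (intro bexI[of _ c']) (auto simp: Dom_def)
  then show ?thesis by (rule r_into_rtranclp)
next
  case False
  then have "Psi p x = \<phi> x" using Psi_outside Supp_Dom by blast
  then show ?thesis by simp
qed

lemma leaf_subset: "L \<in> leaves F \<Longrightarrow> L \<subseteq> topspace (mf_top M)"
proof
  fix y assume L: "L \<in> leaves F" and y: "y \<in> L"
  have FX: "\<Union>(fst ` F) \<subseteq> topspace (mf_top M)"
    using fol unfolding Cr_foliation_def by blast
  obtain x where x: "x \<in> \<Union>(fst ` F)" "(same_plaque F)\<^sup>*\<^sup>* x y" using L y unfolding leaves_def by blast
  from x(2) have "y \<in> \<Union>(fst ` F)"
  proof (cases rule: rtranclp.cases)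
    case rtrancl_refl
    then show ?thesis using x(1) by simp
  next
    case (rtrancl_into_rtrancl b)
    then show ?thesis unfolding same_plaque_def by blast
  qed
  then show "y \<in> topspace (mf_top M)" using FX by blast
qed

lemma Psi_foliation_maps:
  assumes p: "p \<in> P0"
  shows "Psi p \<in> foliation_maps r M F M' F'"
  unfolding foliation_maps_def
proof (intro CollectI conjI ballI)
  show "Psi p \<in> Cr_maps r M M'" by (rule Psi_Cr[OF p])
  fix L assume L: "L \<in> leaves F"
  then obtain L' where L': "L' \<in> leaves F'" "\<phi> ` L \<subseteq> L'" using phi unfolding foliation_maps_def by blast
  then obtain x' where x': "L' = {y. (same_plaque F')\<^sup>*\<^sup>* x' y}" unfolding leaves_def by blast
  have "Psi p x \<in> L'" if "x \<in> L" for x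
  proof -
    have "(same_plaque F')\<^sup>*\<^sup>* x' (\<phi> x)" using L'(2) that x' by auto
    moreover have "(same_plaque F')\<^sup>*\<^sup>* (\<phi> x) (Psi p x)" using Psi_leaf[OF p] leaf_subset[OF L] that by blast
    ultimately show ?thesis unfolding x' by simp
  qed
  then show "\<exists>L'\<in>leaves F'. Psi p ` L \<subseteq> L'" using L'(1) by (intro bexI[of _ L']) auto
qed

end

section \<open>Continuity of the perturbation in the sp-topology\<close>

lemma Dk_dist_cong:
  fixes f g :: "'e::euclidean_space \<Rightarrow> 'f::euclidean_space"
  assumes V: "subspace V" and S: "openin (top_of_set V) S" "x \<in> S" and "\<And>y. y \<in> S \<Longrightarrow> f y = g y"
  shows "Dk_dist k V f h x = Dk_dist k V g h x"
proof -
  have "iter_deriv V vs f x = iter_deriv V vs g x" for vs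
    by (rule iter_deriv_cong[OF V S assms(4)])
  then show ?thesis by (simp add: Dk_dist_def)
qed

lemma eventually_nhds_openin:
  fixes V :: "'e::euclidean_space set"
  assumes "openin (top_of_set (UNIV \<times> V)) T" "y0 \<in> T"
  shows "eventually (\<lambda>y::'p::metric_space \<times> 'e. snd y \<in> V \<longrightarrow> y \<in> T) (nhds y0)"
proof -
  obtain G where G: "open G" "T = (UNIV \<times> V) \<inter> G" using assms by (auto simp: openin_open)
  have "eventually (\<lambda>y. y \<in> G) (nhds y0)"
    using G assms(2) by (intro eventually_nhds_in_open) auto
  then show ?thesis
    by (rule eventually_mono) (auto simp: G(2) mem_Times_iff)
qed

context perturbation
begin

text \<open>The condition that one index of an sp-neighbourhood imposes at one point. Separating the
  points makes the compactness argument on \<open>K i\<close> possible, and separating the indices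
  allows those whose chart misses the support to be discarded.\<close>

definition sp_cond :: "nat \<Rightarrow> ('a \<Rightarrow> 'c) \<Rightarrow> ('a, 't \<times> 'b) chart \<Rightarrow> ('c, 'u \<times> 'd) chart \<Rightarrow> real \<Rightarrow> ('a \<Rightarrow> 'c) \<Rightarrow> 'a \<Rightarrow> bool"
where
  "sp_cond s \<phi>1 \<Theta> \<Theta>' \<epsilon> \<psi> x \<longleftrightarrow> \<psi> x \<in> fst \<Theta>' \<and> local_proj \<Theta>' (\<psi> x) = local_proj \<Theta>' (\<phi>1 x) \<and>
    (\<forall>k\<le>s. Dk_dist k V (local_rep \<Theta> \<psi> \<Theta>') (local_rep \<Theta> \<phi>1 \<Theta>') (snd \<Theta> x) < \<epsilon>)"

text \<open>The two maps agree on the whole open chart domain, hence so do all derivatives at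
  x.\<close>

lemma sp_cond_outside:
  assumes \<Theta>: "\<Theta> \<in> mf_atlas M" and x: "x \<in> fst \<Theta>" and disj: "fst \<Theta> \<inter> Supp = {}"
    and cond: "sp_cond s \<phi>1 \<Theta> \<Theta>' \<epsilon> \<phi> x"
  shows "sp_cond s \<phi>1 \<Theta> \<Theta>' \<epsilon> (Psi p) x"
proof -
  have ch: "is_chart M \<Theta>" by (rule chart_\<Theta>[OF \<Theta>])
  have eq: "Psi p y = \<phi> y" if "y \<in> fst \<Theta>" for y using Psi_outside disj that by blast
  have "Dk_dist k V (local_rep \<Theta> (Psi p) \<Theta>') h (snd \<Theta> x) = Dk_dist k V (local_rep \<Theta> \<phi> \<Theta>') h (snd \<Theta> x)" for k h
  proof (rule Dk_dist_cong[OF V chart_image_openin[OF ch]])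
    show "snd \<Theta> x \<in> snd \<Theta> ` fst \<Theta>" using x by simp
    fix y assume "y \<in> snd \<Theta> ` fst \<Theta>"
    then show "local_rep \<Theta> (Psi p) \<Theta>' y = local_rep \<Theta> \<phi> \<Theta>' y"
      using eq by (auto simp: local_rep_chart[OF ch])
  qed
  then show ?thesis using cond eq[OF x] by (simp add: sp_cond_def)
qed

text \<open>In \<open>c'\<close> the projection is unchanged by construction. To pass to \<Theta>'
  one needs the function h of the foliated change, which exists only on a small W; for p near p0 and
  x near x0 both \<phi> x and Psi p x lie in the same W. Off the support there is nothing to
  compare.\<close>

lemma eventually_local_proj:
  assumes \<Theta>: "\<Theta> \<in> mf_atlas M" and \<Theta>': "\<Theta>' \<in> F'" and x0: "x0 \<in> fst \<Theta>" "\<phi> x0 \<in> fst \<Theta>'"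
  shows "eventually (\<lambda>y. snd y \<in> V \<longrightarrow> local_proj \<Theta>' (Psi (fst y) (chart_inv \<Theta> (snd y))) =
    local_proj \<Theta>' (\<phi> (chart_inv \<Theta> (snd y)))) (nhds (p0, snd \<Theta> x0))"
proof -
  have ch: "is_chart M \<Theta>" by (rule chart_\<Theta>[OF \<Theta>])
  from covered[OF chart_in_topspace[OF ch x0(1)]] show ?thesis
  proof
    assume x: "x0 \<in> topspace (mf_top M) - Supp"
    let ?T = "(UNIV::'p set) \<times> snd \<Theta> ` (fst \<Theta> \<inter> (topspace (mf_top M) - Supp))"
    have "openin (top_of_set (UNIV \<times> V)) ?T"
      by (intro openin_Times chart_open_image[OF ch] openin_Int chart_openin[OF ch] outside_open) auto
    moreover have "(p0, snd \<Theta> x0) \<in> ?T" using x x0 by auto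
    ultimately have "eventually (\<lambda>y. snd y \<in> V \<longrightarrow> y \<in> ?T) (nhds (p0, snd \<Theta> x0))"
      by (rule eventually_nhds_openin)
    then show ?thesis
    proof (rule eventually_mono, intro impI)
      fix y assume "snd y \<in> V \<longrightarrow> y \<in> ?T" "snd y \<in> V"
      then obtain x where "snd y = snd \<Theta> x" "x \<in> fst \<Theta>" "x \<notin> Supp" by (cases y) auto
      then show "local_proj \<Theta>' (Psi (fst y) (chart_inv \<Theta> (snd y))) = local_proj \<Theta>' (\<phi> (chart_inv \<Theta> (snd y)))"
        by (simp add: chart_inv_left[OF ch] Psi_outside)
    qed
  next
    assume x: "x0 \<in> Dom"
    have "foliated_change M' c' \<Theta>'" using fol' cF' \<Theta>' unfolding Cr_foliation_def by blast
    moreover have "\<phi> x0 \<in> fst c' \<inter> fst \<Theta>'" using x x0 by (simp add: Dom_def)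
    ultimately obtain W h where W: "openin (mf_top M') W" "\<phi> x0 \<in> W" "W \<subseteq> fst c' \<inter> fst \<Theta>'"
      "\<forall>y\<in>W. local_proj \<Theta>' y = h (local_proj c' y)"
      unfolding foliated_change_def by blast
    let ?T = "Tr \<Theta> W \<inter> ((UNIV::'p set) \<times> snd \<Theta> ` (fst \<Theta> \<inter> Dom \<inter> \<phi> -` W))"
    have o: "openin (mf_top M) (fst \<Theta> \<inter> Dom \<inter> \<phi> -` W)"
      by (rule Cr_maps_preimage_open[OF phiC openin_Int[OF chart_openin[OF ch] Dom_open] W(1)])
    have "openin (top_of_set (UNIV \<times> V)) ?T"
      by (rule openin_Int[OF Tr_open[OF \<Theta> W(1)] openin_Times[OF _ chart_open_image[OF ch o]]]) auto
    moreover have "(p0, snd \<Theta> x0) \<in> ?T"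
      using x x0 W(2) P0(2) by (auto simp: Tr_mem[OF \<Theta> x0(1)] Psi_p0)
    ultimately have "eventually (\<lambda>y. snd y \<in> V \<longrightarrow> y \<in> ?T) (nhds (p0, snd \<Theta> x0))"
      by (rule eventually_nhds_openin)
    then show ?thesis
    proof (rule eventually_mono, intro impI)
      fix y assume "snd y \<in> V \<longrightarrow> y \<in> ?T" "snd y \<in> V"
      then have yT: "y \<in> ?T" by simp
      then obtain p x where y: "y = (p, snd \<Theta> x)" "x \<in> fst \<Theta>" "x \<in> Dom" "\<phi> x \<in> W" by (cases y) auto
      then have "p \<in> P0" "Psi p x \<in> W" using yT Tr_mem[OF \<Theta> y(2)] by auto
      then have "local_proj \<Theta>' (Psi p x) = local_proj \<Theta>' (\<phi> x)"
        using W(4) y(4) local_proj_Psi[OF _ y(3)] by simp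
      then show "local_proj \<Theta>' (Psi (fst y) (chart_inv \<Theta> (snd y))) = local_proj \<Theta>' (\<phi> (chart_inv \<Theta> (snd y)))"
        by (simp add: y(1) chart_inv_left[OF ch y(2)])
    qed
  qed
qed

text \<open>The centre \<phi>1 of the neighbourhood may differ from \<phi> and is only of class s.
  The inequalities are strict and persist near each point, then on K by the tube lemma. The equality
  of projections is passed on from \<phi>1 to \<phi> by hypothesis and from \<phi> to Psi p by the
  foliated change.\<close>

lemma eventually_sp_cond:
  assumes sr: "enat s \<le> r" and \<phi>1: "\<phi>1 \<in> foliation_maps (enat s) M F M' F'"
    and \<Theta>F: "\<Theta> \<in> F" and \<Theta>F': "\<Theta>' \<in> F'"
    and K: "compactin (mf_top M) K" "K \<subseteq> fst \<Theta>" "\<phi>1 ` K \<subseteq> fst \<Theta>'"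
    and cond: "\<And>x. x \<in> K \<Longrightarrow> sp_cond s \<phi>1 \<Theta> \<Theta>' \<epsilon> \<phi> x"
  shows "eventually (\<lambda>p. \<forall>x\<in>K. sp_cond s \<phi>1 \<Theta> \<Theta>' \<epsilon> (Psi p) x) (nhds p0)"
proof -
  have \<Theta>: "\<Theta> \<in> mf_atlas M" and \<Theta>': "\<Theta>' \<in> mf_atlas M'"
    using \<Theta>F \<Theta>F' Cr_foliation_atlas fol fol' by blast+
  have ch: "is_chart M \<Theta>" by (rule chart_\<Theta>[OF \<Theta>])
  have ch': "is_chart M' \<Theta>'" by (rule Cr_manifold_chart[OF mfd' \<Theta>'])
  have \<phi>1C: "\<phi>1 \<in> Cr_maps (enat s) M M'" by (rule foliation_maps_Cr[OF \<phi>1])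
  let ?Z = "snd \<Theta> ` K"
  have "compact ?Z" using chart_compact_image[OF ch K(2)] K(1) by simp
  then have "eventually (\<lambda>p. \<forall>z\<in>?Z. sp_cond s \<phi>1 \<Theta> \<Theta>' \<epsilon> (Psi p) (chart_inv \<Theta> z)) (nhds p0)"
  proof (rule compact_tube)
    fix z0 assume "z0 \<in> ?Z"
    then obtain x0 where x0: "x0 \<in> K" "z0 = snd \<Theta> x0" by blast
    then have x0': "x0 \<in> fst \<Theta>" "\<phi> x0 \<in> fst \<Theta>'" using K cond[OF x0(1)] by (auto simp: sp_cond_def)
    let ?D1 = "snd \<Theta> ` (fst \<Theta> \<inter> \<phi>1 -` fst \<Theta>')"
    have D1: "openin (top_of_set V) ?D1"
      by (rule chart_open_image[OF ch Cr_maps_preimage_open[OF \<phi>1C chart_openin[OF ch] chart_openin[OF ch']]]) simp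
    let ?T = "Tr \<Theta> (fst \<Theta>') \<inter> ((UNIV::'p set) \<times> ?D1)"
    have T: "openin (top_of_set (UNIV \<times> V)) ?T"
      by (intro openin_Int Tr_open[OF \<Theta> chart_openin[OF ch']] openin_Times D1) auto
    have z0T: "(p0, z0) \<in> ?T"
      using x0 x0' K(3) P0(2) by (auto simp: Tr_mem[OF \<Theta> x0'(1)] Psi_p0)
    have evT: "eventually (\<lambda>y. snd y \<in> V \<longrightarrow> y \<in> ?T) (nhds (p0, z0))"
      by (rule eventually_nhds_openin[OF T z0T])
    have less: "Dk_dist k V (local_rep \<Theta> (Psi p0) \<Theta>') (local_rep \<Theta> \<phi>1 \<Theta>') z0 < \<epsilon>" if "k \<le> s" for k
      using cond[OF x0(1)] that by (simp add: sp_cond_def Psi_p0 x0(2))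
    have "eventually (\<lambda>y. y \<in> ?T \<longrightarrow> Dk_dist k V (local_rep \<Theta> (Psi (fst y)) \<Theta>') (local_rep \<Theta> \<phi>1 \<Theta>') (snd y) < \<epsilon>)
        (nhds (p0, z0))" if "k \<in> {..s}" for k
    proof -
      have kr: "enat k \<le> r" and ks: "enat k \<le> enat s" using that sr order_trans[of "enat k" "enat s" r] by auto
      have f: "pCk k V (\<lambda>p. local_rep \<Theta> (Psi p) \<Theta>') ?T"
        by (rule pCk_subset[OF pCk_Psi[OF \<Theta> \<Theta>' kr]]) simp
      have g: "pCk k V (\<lambda>_::'p. local_rep \<Theta> \<phi>1 \<Theta>') ?T"
        by (rule Ck_on_imp_pCk[OF Cr_maps_local_rep[OF \<phi>1C \<Theta> \<Theta>' ks] openin_imp_subset[OF D1]]) auto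
      have "eventually (\<lambda>y. Dk_dist k V (local_rep \<Theta> (Psi (fst y)) \<Theta>') (local_rep \<Theta> \<phi>1 \<Theta>') (snd y) < \<epsilon>)
          (at (p0, z0) within ?T)"
        by (rule eventually_Dk_dist_less[OF V secs_open_openin[OF T] z0T f g less]) (use that in simp)
      \<comment> \<open>The filter omits the point (p0, z0) itself; the inequality there is
        \<open>less\<close>.\<close>
      then show ?thesis
        unfolding eventually_at_filter
        by (rule eventually_mono) (use less[of k] that in auto)
    qed
    then have "\<forall>k\<in>{..s}. eventually (\<lambda>y. y \<in> ?T \<longrightarrow> Dk_dist k V (local_rep \<Theta> (Psi (fst y)) \<Theta>') (local_rep \<Theta> \<phi>1 \<Theta>') (snd y) < \<epsilon>)
        (nhds (p0, z0))" by blast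
    then have evD: "eventually (\<lambda>y. \<forall>k\<in>{..s}. y \<in> ?T \<longrightarrow> Dk_dist k V (local_rep \<Theta> (Psi (fst y)) \<Theta>') (local_rep \<Theta> \<phi>1 \<Theta>') (snd y) < \<epsilon>)
        (nhds (p0, z0))" by (rule eventually_ball_finite[OF finite_atMost])
    have evP: "eventually (\<lambda>y. snd y \<in> V \<longrightarrow> local_proj \<Theta>' (Psi (fst y) (chart_inv \<Theta> (snd y))) =
        local_proj \<Theta>' (\<phi> (chart_inv \<Theta> (snd y)))) (nhds (p0, z0))"
      unfolding x0(2) by (rule eventually_local_proj[OF \<Theta> \<Theta>F' x0'])
    have "eventually (\<lambda>y. snd y \<in> ?Z \<longrightarrow> sp_cond s \<phi>1 \<Theta> \<Theta>' \<epsilon> (Psi (fst y)) (chart_inv \<Theta> (snd y))) (nhds (p0, z0))"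
      using evT evD evP
    proof eventually_elim
      case (elim y)
      show ?case
      proof
        assume "snd y \<in> ?Z"
        then obtain p x where y: "y = (p, snd \<Theta> x)" "x \<in> K" by (cases y) auto
        then have x: "x \<in> fst \<Theta>" using K by blast
        have yV: "snd y \<in> V" using chart_in_model[OF ch x] y by simp
        then have yT: "y \<in> ?T" using elim(1) by blast
        then have "Psi p x \<in> fst \<Theta>'" using Tr_mem[OF \<Theta> x] y(1) by simp
        moreover have "local_proj \<Theta>' (Psi p x) = local_proj \<Theta>' (\<phi>1 x)"
          using elim(3) yV cond[OF y(2)] by (simp add: y(1) chart_inv_left[OF ch x] sp_cond_def)
        moreover have "\<forall>k\<le>s. Dk_dist k V (local_rep \<Theta> (Psi p) \<Theta>') (local_rep \<Theta> \<phi>1 \<Theta>') (snd \<Theta> x) < \<epsilon>"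
          using elim(2) yT by (simp add: y(1))
        ultimately show "sp_cond s \<phi>1 \<Theta> \<Theta>' \<epsilon> (Psi (fst y)) (chart_inv \<Theta> (snd y))"
          by (simp add: y(1) chart_inv_left[OF ch x] sp_cond_def)
      qed
    qed
    then obtain Pf Pg where P: "eventually Pf (nhds p0)" "eventually Pg (nhds z0)"
      "\<And>p z. Pf p \<Longrightarrow> Pg z \<Longrightarrow> z \<in> ?Z \<longrightarrow> sp_cond s \<phi>1 \<Theta> \<Theta>' \<epsilon> (Psi p) (chart_inv \<Theta> z)"
      unfolding nhds_prod eventually_prod_filter by auto
    from P(2) obtain B where B: "open B" "z0 \<in> B" "\<forall>z\<in>B. Pg z" unfolding eventually_nhds by blast
    have "eventually (\<lambda>p. \<forall>z\<in>B \<inter> ?Z. sp_cond s \<phi>1 \<Theta> \<Theta>' \<epsilon> (Psi p) (chart_inv \<Theta> z)) (nhds p0)"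
      using P(1) by (rule eventually_mono) (use P(3) B(3) in blast)
    with B show "\<exists>B. open B \<and> z0 \<in> B \<and>
        eventually (\<lambda>p. \<forall>z\<in>B \<inter> ?Z. sp_cond s \<phi>1 \<Theta> \<Theta>' \<epsilon> (Psi p) (chart_inv \<Theta> z)) (nhds p0)"
      by (intro exI[of _ B] conjI)
  qed
  then show ?thesis
  proof (rule eventually_mono, intro ballI)
    fix p x assume "\<forall>z\<in>?Z. sp_cond s \<phi>1 \<Theta> \<Theta>' \<epsilon> (Psi p) (chart_inv \<Theta> z)" and x: "x \<in> K"
    then have "sp_cond s \<phi>1 \<Theta> \<Theta>' \<epsilon> (Psi p) (chart_inv \<Theta> (snd \<Theta> x))" by blast
    then show "sp_cond s \<phi>1 \<Theta> \<Theta>' \<epsilon> (Psi p) x" using chart_inv_left[OF ch] x K(2) by auto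
  qed
qed

lemma sp_nbhd_iff:
  "\<psi> \<in> sp_nbhd s M F M' F' \<phi>1 I \<Theta> \<Theta>' K \<epsilon> \<longleftrightarrow> \<psi> \<in> foliation_maps (enat s) M F M' F' \<and>
    (\<forall>i\<in>I. \<forall>x\<in>K i. sp_cond s \<phi>1 (\<Theta> i) (\<Theta>' i) (\<epsilon> i) \<psi> x)"
  unfolding sp_nbhd_def sp_cond_def by blast

lemma eventually_sp_base:
  assumes sr: "enat s \<le> r" and N: "N \<in> sp_base s M F M' F'" and \<phi>N: "\<phi> \<in> N"
  shows "eventually (\<lambda>p. Psi p \<in> N) (nhds p0)"
proof -
  obtain \<phi>1 I \<Theta> \<Theta>' K \<epsilon> where Neq: "N = sp_nbhd s M F M' F' \<phi>1 I \<Theta> \<Theta>' K \<epsilon>"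
    and \<phi>1: "\<phi>1 \<in> foliation_maps (enat s) M F M' F'"
    and I: "\<And>i. i \<in> I \<Longrightarrow> \<Theta> i \<in> F \<and> \<Theta>' i \<in> F' \<and> compactin (mf_top M) (K i) \<and> K i \<subseteq> fst (\<Theta> i) \<and>
                \<phi>1 ` K i \<subseteq> fst (\<Theta>' i) \<and> \<epsilon> i > 0"
    and fin: "\<And>x. x \<in> topspace (mf_top M) \<Longrightarrow> \<exists>W. openin (mf_top M) W \<and> x \<in> W \<and>
                finite {i \<in> I. fst (\<Theta> i) \<inter> W \<noteq> {}}"
    using N unfolding sp_base_def by auto
  have cond: "\<And>i x. i \<in> I \<Longrightarrow> x \<in> K i \<Longrightarrow> sp_cond s \<phi>1 (\<Theta> i) (\<Theta>' i) (\<epsilon> i) \<phi> x"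
    using \<phi>N unfolding Neq sp_nbhd_iff by blast
  \<comment> \<open>Charts outside J miss the support and are settled for every p at once.
    Finiteness of J comes from covering the compact support by finitely many open sets that each
    meet finitely many charts.\<close>
  define J where "J = {i \<in> I. fst (\<Theta> i) \<inter> Supp \<noteq> {}}"
  have "finite J"
  proof -
    define \<U> where "\<U> = {W. openin (mf_top M) W \<and> finite {i \<in> I. fst (\<Theta> i) \<inter> W \<noteq> {}}}"
    have "Supp \<subseteq> \<Union>\<U>"
    proof
      fix x assume "x \<in> Supp"
      then have "x \<in> topspace (mf_top M)" using compactin_subset_topspace[OF Supp_compact] by blast
      from fin[OF this] show "x \<in> \<Union>\<U>" unfolding \<U>_def by blast
    qed
    moreover have "\<And>U. U \<in> \<U> \<Longrightarrow> openin (mf_top M) U" unfolding \<U>_def by blast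
    ultimately obtain \<F> where F: "finite \<F>" "\<F> \<subseteq> \<U>" "Supp \<subseteq> \<Union>\<F>"
      using compactinD[OF Supp_compact, of \<U>] by blast
    have "J \<subseteq> (\<Union>W\<in>\<F>. {i \<in> I. fst (\<Theta> i) \<inter> W \<noteq> {}})"
    proof
      fix i assume "i \<in> J"
      then obtain x where x: "i \<in> I" "x \<in> fst (\<Theta> i)" "x \<in> Supp" unfolding J_def by blast
      then obtain W where "W \<in> \<F>" "x \<in> W" using F(3) by blast
      then show "i \<in> (\<Union>W\<in>\<F>. {i \<in> I. fst (\<Theta> i) \<inter> W \<noteq> {}})" using x by blast
    qed
    moreover have "finite (\<Union>W\<in>\<F>. {i \<in> I. fst (\<Theta> i) \<inter> W \<noteq> {}})"
      using F(1,2) unfolding \<U>_def by (intro finite_UN_I) auto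
    ultimately show ?thesis by (rule finite_subset)
  qed
  moreover have "\<forall>i\<in>J. eventually (\<lambda>p. \<forall>x\<in>K i. sp_cond s \<phi>1 (\<Theta> i) (\<Theta>' i) (\<epsilon> i) (Psi p) x) (nhds p0)"
  proof
    fix i assume "i \<in> J"
    then have i: "i \<in> I" by (simp add: J_def)
    show "eventually (\<lambda>p. \<forall>x\<in>K i. sp_cond s \<phi>1 (\<Theta> i) (\<Theta>' i) (\<epsilon> i) (Psi p) x) (nhds p0)"
      by (rule eventually_sp_cond[OF sr \<phi>1]) (use I[OF i] cond[OF i] in auto)
  qed
  ultimately have ev: "eventually (\<lambda>p. \<forall>i\<in>J. \<forall>x\<in>K i. sp_cond s \<phi>1 (\<Theta> i) (\<Theta>' i) (\<epsilon> i) (Psi p) x) (nhds p0)"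
    by (rule eventually_ball_finite)
  have evP0: "eventually (\<lambda>p. p \<in> P0) (nhds p0)" by (rule eventually_nhds_in_open[OF P0(1,2)])
  from ev evP0 show ?thesis
  proof eventually_elim
    case (elim p)
    have "Psi p \<in> foliation_maps (enat s) M F M' F'"
      using Psi_foliation_maps[OF elim(2)] foliation_maps_mono[OF sr] by blast
    moreover have "sp_cond s \<phi>1 (\<Theta> i) (\<Theta>' i) (\<epsilon> i) (Psi p) x" if i: "i \<in> I" and x: "x \<in> K i" for i x
    proof (cases "i \<in> J")
      case True
      then show ?thesis using elim(1) x by blast
    next
      case False
      then have "fst (\<Theta> i) \<inter> Supp = {}" using i by (simp add: J_def)
      moreover have "\<Theta> i \<in> mf_atlas M" "x \<in> fst (\<Theta> i)"
        using I[OF i] x Cr_foliation_atlas[OF fol] by blast+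
      ultimately show ?thesis using sp_cond_outside cond[OF i x] by simp
    qed
    ultimately show ?case unfolding Neq sp_nbhd_iff by blast
  qed
qed

text \<open>Continuity at p0 of the map p \<mapsto> Psi p into the function space. It is checked on
  the generating sets and carried through finite intersections and unions.\<close>

lemma eventually_sp_open:
  assumes "openin (sp_topology r M F M' F') G" "\<phi> \<in> G"
  shows "eventually (\<lambda>p. Psi p \<in> G) (nhds p0)"
proof -
  define \<S> where "\<S> = (case r of enat s \<Rightarrow> sp_base s M F M' F'
        | \<infinity> \<Rightarrow> {foliation_maps \<infinity> M F M' F' \<inter> N | s N. N \<in> sp_base s M F M' F'})"
  have "generate_topology_on \<S> G"
    using assms(1) unfolding sp_topology_def \<S>_def by (rule openin_topology_generated_by)
  then show ?thesis using assms(2)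
  proof induction
    case Empty
    then show ?case by simp
  next
    case (Int a b)
    then show ?case by (auto intro: eventually_conj)
  next
    case (UN K)
    then obtain k where k: "k \<in> K" "\<phi> \<in> k" by blast
    from UN.IH[OF k] show ?case by (rule eventually_mono) (use k in blast)
  next
    case (Basis S)
    show ?case
    proof (cases r)
      case (enat s)
      then have "S \<in> sp_base s M F M' F'" using Basis.hyps by (simp add: \<S>_def)
      then show ?thesis using eventually_sp_base[of s S] Basis.prems enat by simp
    next
      case infinity
      then obtain s N where N: "S = foliation_maps \<infinity> M F M' F' \<inter> N" "N \<in> sp_base s M F M' F'"
        using Basis.hyps unfolding \<S>_def by auto
      have "eventually (\<lambda>p. Psi p \<in> N) (nhds p0)"
        using eventually_sp_base[OF _ N(2)] Basis.prems N(1) infinity by simp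
      moreover have "eventually (\<lambda>p. p \<in> P0) (nhds p0)" by (rule eventually_nhds_in_open[OF P0(1,2)])
      ultimately show ?thesis
        by eventually_elim (use Psi_foliation_maps N(1) infinity in auto)
    qed
  qed
qed

end

section \<open>Tangent spaces\<close>

text \<open>The values of a local representation outside its natural domain are arbitrary, so the
  chain rule is applied within a ball of the model that corresponds to points of W, where f maps
  into the domain of \<open>c2\<close>.\<close>

lemma local_rep_chain:
  assumes c1: "is_chart M1 c1" and c2: "is_chart M2 c2"
    and W: "openin (mf_top M1) W" "x \<in> W" "W \<subseteq> fst c1" "f ` W \<subseteq> fst c2"
    and D1: "(local_rep c1 f c2 has_derivative D1) (at (snd c1 x) within mf_model M1)"
    and D2: "(local_rep c2 g c3 has_derivative D2) (at (snd c2 (f x)) within mf_model M2)"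
  shows "(local_rep c1 (g \<circ> f) c3 has_derivative (\<lambda>v. D2 (D1 v))) (at (snd c1 x) within mf_model M1)"
proof -
  have x: "x \<in> fst c1" using W by blast
  let ?S = "snd c1 ` W"
  have S: "openin (top_of_set (mf_model M1)) ?S" by (rule chart_open_image[OF c1 W(1,3)])
  have zS: "(0, snd c1 x) \<in> (UNIV::real set) \<times> ?S" using W by simp
  have so: "secs_open (mf_model M1) ((UNIV::real set) \<times> ?S)" by (rule secs_open_Times[OF S])
  obtain e where e: "e > 0" "\<And>y. y \<in> mf_model M1 \<Longrightarrow> dist y (snd c1 x) < e \<Longrightarrow> (0, y) \<in> (UNIV::real set) \<times> ?S"
    and xV: "snd c1 x \<in> mf_model M1"
    using secs_openE[OF so zS] by metis
  let ?B = "mf_model M1 \<inter> ball (snd c1 x) e"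
  have BS: "?B \<subseteq> ?S" using e(2) by (auto simp: dist_commute)
  have at: "at (snd c1 x) within ?B = at (snd c1 x) within mf_model M1"
    by (rule at_within_nhd[where S = "ball (snd c1 x) e"]) (use e in auto)
  have "((\<lambda>z. local_rep c2 g c3 (local_rep c1 f c2 z)) has_derivative (\<lambda>v. D2 (D1 v))) (at (snd c1 x) within ?B)"
  proof (rule has_derivative_in_compose[where f = "local_rep c1 f c2" and g = "local_rep c2 g c3"])
    show "(local_rep c1 f c2 has_derivative D1) (at (snd c1 x) within ?B)"
      unfolding at by (rule D1)
    have "local_rep c1 f c2 ` ?B \<subseteq> mf_model M2"
    proof
      fix y assume "y \<in> local_rep c1 f c2 ` ?B"
      then obtain w where w: "w \<in> W" "y = local_rep c1 f c2 (snd c1 w)" using BS by blast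
      then have "w \<in> fst c1" "f w \<in> fst c2" using W by auto
      then show "y \<in> mf_model M2" using chart_in_model[OF c2, of "f w"] by (simp add: w local_rep_chart[OF c1])
    qed
    then show "(local_rep c2 g c3 has_derivative D2) (at (local_rep c1 f c2 (snd c1 x)) within local_rep c1 f c2 ` ?B)"
      using has_derivative_subset[OF D2] by (simp add: local_rep_chart[OF c1 x])
  qed
  then have "((\<lambda>z. local_rep c2 g c3 (local_rep c1 f c2 z)) has_derivative (\<lambda>v. D2 (D1 v))) (at (snd c1 x) within mf_model M1)"
    unfolding at .
  then show ?thesis
  proof (rule has_derivative_transform_within[OF _ e(1) xV])
    fix y assume "y \<in> mf_model M1" "dist y (snd c1 x) < e"
    then obtain w where w: "w \<in> W" "y = snd c1 w" using e(2) by blast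
    then have "w \<in> fst c1" "f w \<in> fst c2" using W by auto
    then show "local_rep c2 g c3 (local_rep c1 f c2 y) = local_rep c1 (g \<circ> f) c3 y"
      by (simp add: w local_rep_chart[OF c1] local_rep_chart[OF c2])
  qed
qed

locale C1_manifold =
  fixes r :: enat and M :: "('a, 'e::euclidean_space) mfd"
  assumes r: "1 \<le> r" and M: "Cr_manifold r M"
begin

lemma charts_atD: "c \<in> charts_at M x \<Longrightarrow> is_chart M c" "c \<in> charts_at M x \<Longrightarrow> x \<in> fst c"
  "c \<in> charts_at M x \<Longrightarrow> c \<in> mf_atlas M"
  using Cr_manifold_chart[OF M] unfolding charts_at_def by auto

lemma model: "subspace (mf_model M)"
  by (rule Cr_manifold_model[OF M])

definition dch :: "'a \<Rightarrow> ('a, 'e) chart \<Rightarrow> ('a, 'e) chart \<Rightarrow> 'e \<Rightarrow> 'e" where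
  "dch x c c' = frechet_derivative (local_rep c id c') (at (snd c x) within mf_model M)"

lemma dch_derivative:
  assumes c: "c \<in> charts_at M x" and c': "c' \<in> charts_at M x"
  shows "(local_rep c id c' has_derivative dch x c c') (at (snd c x) within mf_model M)"
proof -
  have "enat (Suc 0) \<le> r" using r by (simp add: one_enat_def)
  from Cr_manifold_change[OF M charts_atD(3)[OF c] charts_atD(3)[OF c'] this]
  have "local_rep c id c' differentiable (at (snd c x) within mf_model M)"
    using charts_atD(2)[OF c] charts_atD(2)[OF c'] by simp
  then show ?thesis unfolding dch_def frechet_derivative_works .
qed

lemma dch_compose:
  assumes c: "c \<in> charts_at M x" and c': "c' \<in> charts_at M x" and c'': "c'' \<in> charts_at M x" and v: "v \<in> mf_model M"
  shows "dch x c' c'' (dch x c c' v) = dch x c c'' v"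
proof -
  have W: "openin (mf_top M) (fst c \<inter> fst c')"
    using chart_openin charts_atD c c' by (intro openin_Int) blast+
  have "(local_rep c (id \<circ> id) c'' has_derivative (\<lambda>v. dch x c' c'' (dch x c c' v))) (at (snd c x) within mf_model M)"
    by (rule local_rep_chain[where g = id, OF charts_atD(1)[OF c] charts_atD(1)[OF c'] W _ _ _ dch_derivative[OF c c']])
      (use dch_derivative[OF c' c''] charts_atD(2)[OF c] charts_atD(2)[OF c'] in \<open>auto\<close>)
  then have "(local_rep c id c'' has_derivative (\<lambda>v. dch x c' c'' (dch x c c' v))) (at (snd c x) within mf_model M)"
    by simp
  from frechet_unique_subspace[OF model this dch_derivative[OF c c''] chart_in_model[OF charts_atD(1,2)[OF c]] v]
  show ?thesis .
qed

lemma dch_self: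
  assumes c: "c \<in> charts_at M x" and v: "v \<in> mf_model M"
  shows "dch x c c v = v"
proof -
  have ch: "is_chart M c" by (rule charts_atD(1)[OF c])
  let ?T = "(UNIV::real set) \<times> snd c ` fst c"
  have "(local_rep c id c has_derivative (\<lambda>v. v)) (at (snd c x) within mf_model M)
      = ((\<lambda>v. v) has_derivative (\<lambda>v. v)) (at (snd c x) within mf_model M)"
    by (rule has_derivative_cong_section[OF model secs_open_Times[OF chart_image_openin[OF ch], of "UNIV::real set"], of 0])
      (use charts_atD(2)[OF c] in \<open>auto simp: local_rep_chart[OF ch]\<close>)
  then have "(local_rep c id c has_derivative (\<lambda>v. v)) (at (snd c x) within mf_model M)" by simp
  from frechet_unique_subspace[OF model dch_derivative[OF c c] this chart_in_model[OF ch charts_atD(2)[OF c]] v]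
  show ?thesis .
qed

text \<open>Near \<open>snd c x\<close> the coordinate change maps L into L', so its derivative
  within L takes values in L'. The case L = L' = \<open>mf_model M\<close> says that coordinate
  changes preserve the model.\<close>

lemma dch_in_slice:
  assumes c: "c \<in> charts_at M x" and c': "c' \<in> charts_at M x" and L: "subspace L" "L \<subseteq> mf_model M" "snd c x \<in> L"
    and L': "subspace L'" and sub: "\<And>y. y \<in> fst c \<inter> fst c' \<Longrightarrow> snd c y \<in> L \<Longrightarrow> snd c' y \<in> L'" and v: "v \<in> L"
  shows "dch x c c' v \<in> L'"
proof -
  have ch: "is_chart M c" by (rule charts_atD(1)[OF c])
  let ?S = "snd c ` (fst c \<inter> fst c')"
  have S: "openin (top_of_set (mf_model M)) ?S"
    by (rule Cr_manifold_change_open[OF M charts_atD(3)[OF c] charts_atD(3)[OF c']])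
  have zS: "(0, snd c x) \<in> (UNIV::real set) \<times> ?S" using charts_atD(2)[OF c] charts_atD(2)[OF c'] by simp
  obtain e where e: "e > 0" "\<And>y. y \<in> mf_model M \<Longrightarrow> dist y (snd c x) < e \<Longrightarrow> (0, y) \<in> (UNIV::real set) \<times> ?S"
    using secs_openE[OF secs_open_Times[OF S] zS] by metis
  have "(local_rep c id c' has_derivative dch x c c') (at (snd c x) within L)"
    by (rule has_derivative_subset[OF dch_derivative[OF c c'] L(2)])
  then show ?thesis
  proof (rule has_derivative_in_subspace[OF L(1) L' _ L(3) v e(1)])
    fix y assume y: "y \<in> L" "dist y (snd c x) < e"
    then obtain w where "w \<in> fst c \<inter> fst c'" "y = snd c w" using e(2)[of y] L(2) by blast
    then show "local_rep c id c' y \<in> L'" using sub y(1) by (simp add: local_rep_chart[OF ch])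
  qed
qed

lemma dch_in_model:
  assumes c: "c \<in> charts_at M x" and c': "c' \<in> charts_at M x" and v: "v \<in> mf_model M"
  shows "dch x c c' v \<in> mf_model M"
  by (rule dch_in_slice[OF c c' model order_refl chart_in_model[OF charts_atD(1,2)[OF c]] model _ v])
    (simp add: chart_in_model[OF charts_atD(1)[OF c']])

lemma tangent_space_iff:
  "v \<in> tangent_space M x \<longleftrightarrow> (\<forall>c. c \<notin> charts_at M x \<longrightarrow> v c = 0) \<and> (\<forall>c\<in>charts_at M x. v c \<in> mf_model M) \<and>
    (\<forall>c\<in>charts_at M x. \<forall>c'\<in>charts_at M x. v c' = dch x c c' (v c))"
  by (simp add: tangent_space_def dch_def)

text \<open>A vector prescribed in one chart is transported to all others by the derivatives of the
  coordinate changes; the cocycle identity \<open>dch_compose\<close> makes the resulting family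
  consistent.\<close>

lemma tangent_exists:
  assumes c: "c \<in> charts_at M x" and w: "w \<in> mf_model M"
  obtains v where "v \<in> tangent_space M x" "v c = w"
proof
  let ?v = "\<lambda>c'. if c' \<in> charts_at M x then dch x c c' w else 0"
  show "?v \<in> tangent_space M x"
    unfolding tangent_space_iff using dch_in_model[OF c _ w] dch_compose[OF c _ _ w] by simp
  show "?v c = w" using c dch_self[OF c w] by simp
qed

lemma dch_linear:
  assumes "c \<in> charts_at M x" "c' \<in> charts_at M x"
  shows "linear (dch x c c')"
  by (rule has_derivative_linear[OF dch_derivative[OF assms]])

lemma tangent_add:
  assumes "v \<in> tangent_space M x" "w \<in> tangent_space M x"
  shows "(\<lambda>c. v c + w c) \<in> tangent_space M x"
  unfolding tangent_space_iff
proof (intro conjI allI impI ballI)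
  note v = assms(1)[unfolded tangent_space_iff] and w = assms(2)[unfolded tangent_space_iff]
  show "v c + w c = 0" if "c \<notin> charts_at M x" for c
    using v[THEN conjunct1, rule_format, OF that] w[THEN conjunct1, rule_format, OF that] by simp
  show "v c + w c \<in> mf_model M" if "c \<in> charts_at M x" for c
    by (rule subspace_add[OF model]) (use v w that in blast)+
  show "v c' + w c' = dch x c c' (v c + w c)" if cc': "c \<in> charts_at M x" "c' \<in> charts_at M x" for c c'
  proof -
    have "v c' = dch x c c' (v c)" "w c' = dch x c c' (w c)" using v w cc' by blast+
    then show ?thesis by (simp only: linear_add[OF dch_linear[OF cc']])
  qed
qed

lemma tangent_diff:
  assumes "v \<in> tangent_space M x" "w \<in> tangent_space M x"
  shows "(\<lambda>c. v c - w c) \<in> tangent_space M x"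
  unfolding tangent_space_iff
proof (intro conjI allI impI ballI)
  note v = assms(1)[unfolded tangent_space_iff] and w = assms(2)[unfolded tangent_space_iff]
  show "v c - w c = 0" if "c \<notin> charts_at M x" for c
    using v[THEN conjunct1, rule_format, OF that] w[THEN conjunct1, rule_format, OF that] by simp
  show "v c - w c \<in> mf_model M" if "c \<in> charts_at M x" for c
    by (rule subspace_diff[OF model]) (use v w that in blast)+
  show "v c' - w c' = dch x c c' (v c - w c)" if cc': "c \<in> charts_at M x" "c' \<in> charts_at M x" for c c'
  proof -
    have "v c' = dch x c c' (v c)" "w c' = dch x c c' (w c)" using v w cc' by blast+
    then show ?thesis by (simp only: linear_diff[OF dch_linear[OF cc']])
  qed
qed

text \<open>The definition quantifies over all slice charts at x, but one decides: between two slice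
  charts the coordinate change maps slice to slice, and so does its derivative.\<close>

lemma submanifold_tangent_iff:
  assumes x: "x \<in> A" and c: "x \<in> fst c" "slice_chart M A c L" and v: "v \<in> tangent_space M x"
  shows "v \<in> submanifold_tangent_space M A x \<longleftrightarrow> v c \<in> L"
proof
  assume "v \<in> submanifold_tangent_space M A x"
  then show "v c \<in> L" using c unfolding submanifold_tangent_space_def by blast
next
  assume vL: "v c \<in> L"
  have cc: "c \<in> charts_at M x" using c by (simp add: slice_chart_def charts_at_def)
  have "v c' \<in> L'" if c': "x \<in> fst c'" "slice_chart M A c' L'" for c' L'
  proof -
    have cc': "c' \<in> charts_at M x" using c' by (simp add: slice_chart_def charts_at_def)
    have S: "snd c ` (fst c \<inter> A) = snd c ` fst c \<inter> L" "snd c' ` (fst c' \<inter> A) = snd c' ` fst c' \<inter> L'"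
      using c c' by (simp_all add: slice_chart_def)
    have "dch x c c' (v c) \<in> L'"
    proof (rule dch_in_slice[OF cc cc'])
      show "subspace L" "L \<subseteq> mf_model M" "subspace L'" using c c' by (simp_all add: slice_chart_def)
      show "snd c x \<in> L" using S(1) x c(1) by blast
      show "v c \<in> L" by (rule vL)
      fix y assume y: "y \<in> fst c \<inter> fst c'" "snd c y \<in> L"
      then have "snd c y \<in> snd c ` (fst c \<inter> A)" using S(1) by auto
      then obtain y' where "y' \<in> fst c \<inter> A" "snd c y = snd c y'" by blast
      then have "y \<in> A" using inj_onD[OF chart_inj[OF charts_atD(1)[OF cc]]] y by (metis IntD1 IntD2)
      then show "snd c' y \<in> L'" using S(2) y by blast
    qed
    moreover have "v c' = dch x c c' (v c)" using v cc cc' unfolding tangent_space_iff by blast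
    ultimately show ?thesis by (simp only:)
  qed
  then show "v \<in> submanifold_tangent_space M A x"
    using v unfolding submanifold_tangent_space_def by blast
qed

end

section \<open>The differential in charts\<close>

lemma local_rep_derivative:
  assumes r: "1 \<le> r" and \<phi>: "\<phi> \<in> Cr_maps r M M'" and c: "c \<in> charts_at M x" and c': "c' \<in> charts_at M' (\<phi> x)"
  shows "(local_rep c \<phi> c' has_derivative frechet_derivative (local_rep c \<phi> c') (at (snd c x) within mf_model M))
    (at (snd c x) within mf_model M)"
proof -
  have "enat (Suc 0) \<le> r" using r by (simp add: one_enat_def)
  from Cr_maps_local_rep[OF \<phi> _ _ this, of c c'] c c'
  have "local_rep c \<phi> c' differentiable (at (snd c x) within mf_model M)"
    by (simp add: charts_at_def)
  then show ?thesis unfolding frechet_derivative_works .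
qed

text \<open>The definition of \<open>differential\<close> picks some chart \<open>c0\<close> at x;
  the chain rule for the change from \<open>c0\<close> to c removes the choice.\<close>

lemma differential_chart:
  assumes r: "1 \<le> r" and M: "Cr_manifold r M" and M': "Cr_manifold r M'" and \<phi>: "\<phi> \<in> Cr_maps r M M'"
    and c: "c \<in> charts_at M x" and c': "c' \<in> charts_at M' (\<phi> x)" and v: "v \<in> tangent_space M x"
  shows "differential M M' \<phi> x v c' = frechet_derivative (local_rep c \<phi> c') (at (snd c x) within mf_model M) (v c)"
proof -
  interpret C1_manifold r M using r M by unfold_locales
  define c0 where "c0 = (SOME c. c \<in> charts_at M x)"
  have c0: "c0 \<in> charts_at M x" unfolding c0_def using c by (rule someI)
  let ?D = "\<lambda>c. frechet_derivative (local_rep c \<phi> c') (at (snd c x) within mf_model M)"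
  have W: "openin (mf_top M) (fst c0 \<inter> fst c)"
    using chart_openin charts_atD c c0 by (intro openin_Int) blast+
  have d: "(local_rep c0 (\<phi> \<circ> id) c' has_derivative (\<lambda>v. ?D c (dch x c0 c v))) (at (snd c0 x) within mf_model M)"
    by (rule local_rep_chain[OF charts_atD(1)[OF c0] charts_atD(1)[OF c] W _ _ _ dch_derivative[OF c0 c]])
      (use local_rep_derivative[OF r \<phi> c c'] charts_atD(2)[OF c] charts_atD(2)[OF c0] in auto)
  have v0: "v c0 \<in> mf_model M" "v c = dch x c0 c (v c0)"
    using v c c0 unfolding tangent_space_iff by blast+
  have "differential M M' \<phi> x v c' = ?D c0 (v c0)"
    using c' by (simp add: differential_def c0_def[symmetric] Let_def)
  also have "\<dots> = ?D c (dch x c0 c (v c0))"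
    using frechet_derivative_eq[OF model d chart_in_model[OF charts_atD(1,2)[OF c0]] v0(1)] by simp
  finally show ?thesis by (simp only: v0(2)[symmetric])
qed

lemma differential_tangent:
  assumes r: "1 \<le> r" and M: "Cr_manifold r M" and M': "Cr_manifold r M'" and \<phi>: "\<phi> \<in> Cr_maps r M M'"
    and c: "c \<in> charts_at M x" and v: "v \<in> tangent_space M x"
  shows "differential M M' \<phi> x v \<in> tangent_space M' (\<phi> x)"
proof -
  interpret C1_manifold r M using r M by unfold_locales
  interpret N: C1_manifold r M' using r M' by unfold_locales
  let ?D = "\<lambda>c'. frechet_derivative (local_rep c \<phi> c') (at (snd c x) within mf_model M)"
  note dc = differential_chart[OF r M M' \<phi> c _ v]
  have vc: "v c \<in> mf_model M" using v c unfolding tangent_space_iff by blast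
  have xV: "snd c x \<in> mf_model M" by (rule chart_in_model[OF charts_atD(1,2)[OF c]])
  have W: "openin (mf_top M) (fst c \<inter> \<phi> -` fst c')" if "c' \<in> charts_at M' (\<phi> x)" for c'
    by (rule Cr_maps_preimage_open[OF \<phi> chart_openin[OF charts_atD(1)[OF c]] chart_openin[OF N.charts_atD(1)[OF that]]])
  have change: "?D c'' (v c) = N.dch (\<phi> x) c' c'' (?D c' (v c))"
    if c': "c' \<in> charts_at M' (\<phi> x)" and c'': "c'' \<in> charts_at M' (\<phi> x)" for c' c''
  proof -
    have "(local_rep c (id \<circ> \<phi>) c'' has_derivative (\<lambda>v. N.dch (\<phi> x) c' c'' (?D c' v))) (at (snd c x) within mf_model M)"
      by (rule local_rep_chain[where g = id, OF charts_atD(1)[OF c] N.charts_atD(1)[OF c'] W[OF c'] _ _ _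
            local_rep_derivative[OF r \<phi> c c']])
        (use N.dch_derivative[OF c' c''] charts_atD(2)[OF c] N.charts_atD(2)[OF c'] in auto)
    then show ?thesis using frechet_derivative_eq[OF model _ xV vc] by simp
  qed
  have inV: "?D c' (v c) \<in> mf_model M'" if c': "c' \<in> charts_at M' (\<phi> x)" for c'
  proof -
    let ?S = "snd c ` (fst c \<inter> \<phi> -` fst c')"
    have S: "openin (top_of_set (mf_model M)) ?S"
      by (rule chart_open_image[OF charts_atD(1)[OF c] W[OF c']]) simp
    have zS: "(0, snd c x) \<in> (UNIV::real set) \<times> ?S" using charts_atD(2)[OF c] N.charts_atD(2)[OF c'] by simp
    obtain e where e: "e > 0" "\<And>y. y \<in> mf_model M \<Longrightarrow> dist y (snd c x) < e \<Longrightarrow> (0, y) \<in> (UNIV::real set) \<times> ?S"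
      using secs_openE[OF secs_open_Times[OF S] zS] by metis
    show ?thesis
    proof (rule has_derivative_in_subspace[OF model N.model local_rep_derivative[OF r \<phi> c c'] xV vc e(1)])
      fix y assume y: "y \<in> mf_model M" "dist y (snd c x) < e"
      then obtain w where "w \<in> fst c \<inter> \<phi> -` fst c'" "y = snd c w" using e(2)[of y] by blast
      then show "local_rep c \<phi> c' y \<in> mf_model M'"
        using chart_in_model[OF N.charts_atD(1)[OF c'], of "\<phi> w"] by (simp add: local_rep_chart[OF charts_atD(1)[OF c]])
    qed
  qed
  show ?thesis unfolding N.tangent_space_iff
  proof (intro conjI allI impI ballI)
    show "differential M M' \<phi> x v c' = 0" if "c' \<notin> charts_at M' (\<phi> x)" for c'
      using that by (simp add: differential_def)
    show "differential M M' \<phi> x v c' \<in> mf_model M'" if "c' \<in> charts_at M' (\<phi> x)" for c'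
      unfolding dc[OF that] by (rule inV[OF that])
    show "differential M M' \<phi> x v c'' = N.dch (\<phi> x) c' c'' (differential M M' \<phi> x v c')"
      if "c' \<in> charts_at M' (\<phi> x)" "c'' \<in> charts_at M' (\<phi> x)" for c' c''
      unfolding dc[OF that(1)] dc[OF that(2)] by (rule change[OF that])
  qed
qed

section \<open>Transversality in an adapted chart\<close>

definition adapted :: "'c set \<Rightarrow> ('c, 'u \<times> 'd::euclidean_space) chart \<Rightarrow> 'd set \<Rightarrow> bool" where
  "adapted A c' E \<longleftrightarrow> (\<forall>y\<in>fst c'. y \<in> A \<longleftrightarrow> (\<forall>w\<in>E. snd (snd c' y) \<bullet> w = 0))"

text \<open>Surjectivity onto E of the E-component of the derivative, stated dually: no nonzero w in
  E annihilates the image. In this form the condition is a linear relation among the rows of the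
  derivative, and it can be tested on the unit sphere of E.\<close>

definition regular_at :: "'d::euclidean_space set \<Rightarrow> 'e::euclidean_space set \<Rightarrow> ('e \<Rightarrow> 'd) \<Rightarrow> 'e \<Rightarrow> bool" where
  "regular_at E V f z \<longleftrightarrow> ((\<forall>w\<in>E. f z \<bullet> w = 0) \<longrightarrow>
     (\<forall>w\<in>E. w \<noteq> 0 \<longrightarrow> (\<exists>u\<in>V. frechet_derivative f (at z within V) u \<bullet> w \<noteq> 0)))"

definition transverse_at :: "('a, 'e::euclidean_space) mfd \<Rightarrow> ('b, 'f::euclidean_space) mfd \<Rightarrow> ('a \<Rightarrow> 'b) \<Rightarrow> 'b set \<Rightarrow> 'a \<Rightarrow> bool" where
  "transverse_at M M' \<phi> A x \<longleftrightarrow> (\<phi> x \<in> A \<longrightarrow> tangent_space M' (\<phi> x) =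
     tangent_sum (submanifold_tangent_space M' A (\<phi> x)) (differential M M' \<phi> x ` tangent_space M x))"

lemma map_transverse_to_iff:
  "map_transverse_to M M' \<phi> A \<longleftrightarrow> (\<forall>x\<in>topspace (mf_top M). transverse_at M M' \<phi> A x)"
  by (simp add: map_transverse_to_def transverse_at_def)

text \<open>In an adapted chart A is the slice by L, the vectors of the model whose leaf part is
  orthogonal to E. So the tangent space of A together with the image of the differential D is
  everything precisely if the E-component of D is onto E.\<close>

lemma transverse_at_iff_regular:
  fixes M :: "('a, 'e::euclidean_space) mfd" and M' :: "('c, 'u::euclidean_space \<times> 'd::euclidean_space) mfd"
  assumes r: "1 \<le> r" and M: "Cr_manifold r M" and M': "Cr_manifold r M'" and \<phi>: "\<phi> \<in> Cr_maps r M M'"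
    and model': "mf_model M' = Q' \<times> P'" "0 \<in> Q'" and E: "subspace E" "E \<subseteq> P'"
    and c: "c \<in> charts_at M x" and c': "c' \<in> charts_at M' (\<phi> x)" and ad: "adapted A c' E"
  shows "transverse_at M M' \<phi> A x \<longleftrightarrow> regular_at E (mf_model M) (\<lambda>z. snd (local_rep c \<phi> c' z)) (snd c x)"
proof -
  interpret C1_manifold r M using r M by unfold_locales
  interpret N: C1_manifold r M' using r M' by unfold_locales
  let ?V = "mf_model M" and ?V' = "mf_model M'"
  define L where "L = {y \<in> ?V'. \<forall>w\<in>E. snd y \<bullet> w = 0}"
  have sl: "slice_chart M' A c' L"
    unfolding slice_chart_def
  proof (intro conjI)
    show "c' \<in> mf_atlas M'" by (rule N.charts_atD(3)[OF c'])
    show "L \<subseteq> ?V'" by (auto simp: L_def)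
    show "subspace L" unfolding L_def subspace_def
      using subspace_0[OF N.model] subspace_add[OF N.model] subspace_scale[OF N.model]
      by (auto simp: inner_add_left)
    show "snd c' ` (fst c' \<inter> A) = snd c' ` fst c' \<inter> L"
      using ad chart_in_model[OF N.charts_atD(1)[OF c']] by (auto simp: adapted_def L_def)
  qed
  define D where "D = frechet_derivative (local_rep c \<phi> c') (at (snd c x) within ?V)"
  have Dd: "(local_rep c \<phi> c' has_derivative D) (at (snd c x) within ?V)"
    unfolding D_def by (rule local_rep_derivative[OF r \<phi> c c'])
  have xV: "snd c x \<in> ?V" by (rule chart_in_model[OF charts_atD(1,2)[OF c]])
  have sD: "frechet_derivative (\<lambda>z. snd (local_rep c \<phi> c' z)) (at (snd c x) within ?V) u = snd (D u)" if "u \<in> ?V" for u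
    by (rule frechet_derivative_eq[OF model bounded_linear.has_derivative[OF bounded_linear_snd Dd] xV that])
  have A_iff: "\<phi> x \<in> A \<longleftrightarrow> (\<forall>w\<in>E. snd (local_rep c \<phi> c' (snd c x)) \<bullet> w = 0)"
    using ad N.charts_atD(2)[OF c'] by (simp add: adapted_def local_rep_chart[OF charts_atD(1,2)[OF c]])
  have dD: "differential M M' \<phi> x v c' = D (v c)" if "v \<in> tangent_space M x" for v
    unfolding D_def by (rule differential_chart[OF r M M' \<phi> c c' that])
  have "tangent_space M' (\<phi> x) =
      tangent_sum (submanifold_tangent_space M' A (\<phi> x)) (differential M M' \<phi> x ` tangent_space M x) \<longleftrightarrow>
      (\<forall>w\<in>E. w \<noteq> 0 \<longrightarrow> (\<exists>u\<in>?V. snd (D u) \<bullet> w \<noteq> 0))" (is "?L \<longleftrightarrow> ?R") if xA: "\<phi> x \<in> A"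
  proof
    assume eq: ?L
    show ?R
    proof (intro ballI impI)
      fix w assume w: "w \<in> E" "w \<noteq> 0"
      then have "(0, w) \<in> ?V'" using model' E by auto
      then obtain v' where v': "v' \<in> tangent_space M' (\<phi> x)" "v' c' = (0, w)"
        using N.tangent_exists[OF c'] by blast
      then obtain a v where a: "a \<in> submanifold_tangent_space M' A (\<phi> x)" and v: "v \<in> tangent_space M x"
        and sum: "v' = (\<lambda>c. a c + differential M M' \<phi> x v c)"
        using eq unfolding tangent_sum_def by blast
      have "a c' \<in> L" using a sl N.charts_atD(2)[OF c'] unfolding submanifold_tangent_space_def by blast
      then have aw: "snd (a c') \<bullet> w = 0" using w by (simp add: L_def)
      have "(0, w) = a c' + D (v c)" using sum v'(2) dD[OF v] by metis
      then have "w = snd (a c') + snd (D (v c))" by (metis snd_add snd_conv)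
      then have "w \<bullet> w = snd (D (v c)) \<bullet> w" using aw by (metis add_0 inner_add_left)
      then have "snd (D (v c)) \<bullet> w \<noteq> 0" using w(2) by (metis inner_eq_zero_iff)
      moreover have "v c \<in> ?V" using v c unfolding tangent_space_iff by blast
      ultimately show "\<exists>u\<in>?V. snd (D u) \<bullet> w \<noteq> 0" by blast
    qed
  next
    assume R: ?R
    define X where "X = (\<lambda>u. oproj E (snd (D u))) ` ?V"
    have linD: "linear (\<lambda>u. oproj E (snd (D u)))"
      using linear_compose[OF linear_compose[OF has_derivative_linear[OF Dd] linear_snd] linear_oproj[OF E(1)]]
      by (simp add: o_def)
    have X: "subspace X" unfolding X_def by (rule linear_subspace_image[OF linD model])
    have XE: "X \<subseteq> E" unfolding X_def using oproj_in[OF E(1)] by blast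
    have EX: "e \<in> X" if e: "e \<in> E" for e
    proof (rule ccontr)
      assume "e \<notin> X"
      \<comment> \<open>If the image X were a proper subspace of E, the residual of e would be a
        nonzero vector of E orthogonal to X, against the dual form of surjectivity.\<close>
      define w where "w = e - oproj X e"
      have "w \<noteq> 0" using \<open>e \<notin> X\<close> oproj_in[OF X, of e] by (auto simp: w_def)
      moreover have wE: "w \<in> E" unfolding w_def using e XE oproj_in[OF X, of e] by (intro subspace_diff[OF E(1)]) auto
      ultimately obtain u where u: "u \<in> ?V" "snd (D u) \<bullet> w \<noteq> 0" using R by blast
      have "w \<bullet> oproj E (snd (D u)) = 0"
        unfolding w_def by (rule oproj_orth[OF X]) (use u in \<open>simp add: X_def\<close>)
      then have "snd (D u) \<bullet> w = 0" using oproj_inner[OF E(1) wE, of "snd (D u)"] by (simp add: inner_commute)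
      then show False using u(2) by simp
    qed
    show ?L
    proof (intro equalityI subsetI)
      fix v' assume v': "v' \<in> tangent_space M' (\<phi> x)"
      \<comment> \<open>This yields a vector u whose image under D has the same E-component as v';
        the difference of v' and that image is then tangent to A.\<close>
      have "oproj E (snd (v' c')) \<in> X" using EX oproj_in[OF E(1)] by blast
      then obtain u where u: "u \<in> ?V" "oproj E (snd (v' c')) = oproj E (snd (D u))" unfolding X_def by blast
      obtain v where v: "v \<in> tangent_space M x" "v c = u" using tangent_exists[OF c u(1)] by blast
      have dv: "differential M M' \<phi> x v \<in> tangent_space M' (\<phi> x)"
        by (rule differential_tangent[OF r M M' \<phi> c v(1)])
      let ?a = "\<lambda>c. v' c - differential M M' \<phi> x v c"
      have a: "?a \<in> tangent_space M' (\<phi> x)" by (rule N.tangent_diff[OF v' dv])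
      have "?a c' \<in> L"
      proof -
        have "?a c' \<in> ?V'" using a c' unfolding N.tangent_space_iff by blast
        moreover have "snd (?a c') \<bullet> w = 0" if w: "w \<in> E" for w
          using oproj_inner[OF E(1) w, of "snd (v' c')"] oproj_inner[OF E(1) w, of "snd (D u)"] u(2) dD[OF v(1)] v(2)
          by (simp add: inner_diff_left)
        ultimately show ?thesis by (simp add: L_def)
      qed
      then have "?a \<in> submanifold_tangent_space M' A (\<phi> x)"
        using N.submanifold_tangent_iff[OF xA N.charts_atD(2)[OF c'] sl a] by blast
      moreover have "v' = (\<lambda>c. ?a c + differential M M' \<phi> x v c)" by simp
      ultimately show "v' \<in> tangent_sum (submanifold_tangent_space M' A (\<phi> x)) (differential M M' \<phi> x ` tangent_space M x)"
        using v(1) unfolding tangent_sum_def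
        by (intro CollectI exI[of _ ?a] exI[of _ "differential M M' \<phi> x v"] conjI imageI)
    next
      fix v' assume "v' \<in> tangent_sum (submanifold_tangent_space M' A (\<phi> x)) (differential M M' \<phi> x ` tangent_space M x)"
      then obtain a v where a: "a \<in> submanifold_tangent_space M' A (\<phi> x)" and v: "v \<in> tangent_space M x"
        and sum: "v' = (\<lambda>c. a c + differential M M' \<phi> x v c)"
        unfolding tangent_sum_def by blast
      have "a \<in> tangent_space M' (\<phi> x)" using a unfolding submanifold_tangent_space_def by blast
      then show "v' \<in> tangent_space M' (\<phi> x)"
        unfolding sum by (rule N.tangent_add[OF _ differential_tangent[OF r M M' \<phi> c v]])
    qed
  qed
  moreover have "regular_at E ?V (\<lambda>z. snd (local_rep c \<phi> c' z)) (snd c x) \<longleftrightarrow>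
      (\<phi> x \<in> A \<longrightarrow> (\<forall>w\<in>E. w \<noteq> 0 \<longrightarrow> (\<exists>u\<in>?V. snd (D u) \<bullet> w \<noteq> 0)))"
    unfolding regular_at_def A_iff by (simp add: sD cong: bex_cong)
  ultimately show ?thesis unfolding transverse_at_def by blast
qed

section \<open>Straightening a submanifold transverse to the foliation\<close>

lemma Cr_foliation_model:
  assumes "Cr_foliation r M F"
  shows "\<exists>Q P. subspace Q \<and> subspace P \<and> mf_model M = Q \<times> P \<and>
        F \<subseteq> mf_atlas M \<and> (\<forall>c\<in>F. product_chart Q P c) \<and>
        topspace (mf_top M) = \<Union>(fst ` F) \<and>
        (\<forall>c\<in>F. \<forall>c'\<in>F. foliated_change M c c') \<and>
        (\<forall>c\<in>mf_atlas M. product_chart Q P c \<and>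
            (\<forall>c'\<in>F. foliated_change M c c' \<and> foliated_change M c' c) \<longrightarrow> c \<in> F)"
  using assms unfolding Cr_foliation_def by (rule conjunct2)

text \<open>Since G keeps the first coordinate, following c1 by G leaves the local projection
  unchanged, and with it all foliated changes. After shrinking to a product image with convex leaf
  factor, the new chart belongs to the atlas and to F by their maximality.\<close>

lemma foliated_chart_change:
  fixes M :: "('c, 'u::euclidean_space \<times> 'd::euclidean_space) mfd"
  assumes fol: "Cr_foliation r M F" and c1: "c1 \<in> F" and y0: "y0 \<in> fst c1"
    and S: "open S" "open S'" "snd c1 y0 \<in> S" and hom: "homeomorphism S S' G H"
    and Gr: "Cr_on r UNIV G S" and Hr: "Cr_on r UNIV H S'"
    and GV: "\<And>z. z \<in> S \<Longrightarrow> G z \<in> mf_model M \<longleftrightarrow> z \<in> mf_model M" and fstG: "\<And>z. fst (G z) = fst z"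
    and SV: "S \<inter> mf_model M \<subseteq> snd c1 ` fst c1"
  shows "\<exists>c'\<in>F. y0 \<in> fst c' \<and> fst c' \<subseteq> fst c1 \<and> (\<forall>y\<in>fst c'. snd c1 y \<in> S \<and> snd c' y = G (snd c1 y))"
proof -
  let ?V = "mf_model M"
  from Cr_foliation_model[OF fol]
  obtain Q P where Q: "subspace Q" and P: "subspace P" and QP: "?V = Q \<times> P" and Fat: "F \<subseteq> mf_atlas M"
    and prod: "\<forall>c\<in>F. product_chart Q P c" and "topspace (mf_top M) = \<Union>(fst ` F)"
    and fch: "\<forall>c\<in>F. \<forall>c'\<in>F. foliated_change M c c'"
    and maxi: "\<forall>c\<in>mf_atlas M. product_chart Q P c \<and>
            (\<forall>c'\<in>F. foliated_change M c c' \<and> foliated_change M c' c) \<longrightarrow> c \<in> F"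
    by (elim exE conjE)
  have mfd: "Cr_manifold r M" by (rule Cr_foliation_manifold[OF fol])
  have c1a: "c1 \<in> mf_atlas M" using Fat c1 by blast
  have ch1: "is_chart M c1" by (rule Cr_manifold_chart[OF mfd c1a])
  have V: "subspace ?V" by (rule Cr_manifold_model[OF mfd])
  have GH: "\<And>z. z \<in> S \<Longrightarrow> G z \<in> S'" "\<And>w. w \<in> S' \<Longrightarrow> H w \<in> S" "\<And>z. z \<in> S \<Longrightarrow> H (G z) = z" "\<And>w. w \<in> S' \<Longrightarrow> G (H w) = w"
    and Gc: "continuous_on S G" and Hc: "continuous_on S' H"
    using hom unfolding homeomorphism_def by auto
  have HV: "H w \<in> ?V \<longleftrightarrow> w \<in> ?V" if "w \<in> S'" for w using GV[OF GH(2)[OF that]] GH(4)[OF that] by simp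
  define z0 where "z0 = snd c1 y0"
  have z0V: "z0 \<in> ?V" unfolding z0_def by (rule chart_in_model[OF ch1 y0])
  have "G z0 \<in> S'" using GH(1) S(3) by (simp add: z0_def)
  then obtain A1 B1 where AB: "open A1" "open B1" "G z0 \<in> A1 \<times> B1" "A1 \<times> B1 \<subseteq> S'"
    using open_prod_elim[OF S(2)] by metis
  have "snd (G z0) \<in> B1" using AB(3) by (simp add: mem_Times_iff)
  then obtain e where e: "e > 0" "ball (snd (G z0)) e \<subseteq> B1" by (rule openE[OF AB(2)])
  \<comment> \<open>A product neighbourhood inside S' whose leaf factor is a ball. Its trace
    \<open>TB\<close> on the model \<open>Q \<times> P\<close> is then a product with convex second
    factor, as a foliation chart requires.\<close>
  define O1 where "O1 = A1 \<times> ball (snd (G z0)) e"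
  have O1: "open O1" "G z0 \<in> O1" "O1 \<subseteq> S'"
    using AB e by (auto simp: O1_def open_Times mem_Times_iff)
  define TB where "TB = (Q \<inter> A1) \<times> (P \<inter> ball (snd (G z0)) e)"
  have TB: "TB = ?V \<inter> O1" by (auto simp: TB_def O1_def QP)
  define Z1 where "Z1 = ?V \<inter> (S \<inter> G -` O1)"
  have "open (S \<inter> G -` O1)" by (rule continuous_open_preimage[OF Gc S(1) O1(1)])
  then have Z1: "openin (top_of_set ?V) Z1" unfolding Z1_def by (rule openin_open_Int)
  have Z1c: "Z1 \<subseteq> snd c1 ` fst c1" using SV by (auto simp: Z1_def)
  have GZ: "G ` Z1 = TB"
  proof (intro equalityI subsetI)
    fix w assume "w \<in> G ` Z1" then show "w \<in> TB" using GV by (auto simp: TB Z1_def)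
  next
    fix w assume "w \<in> TB"
    then have w: "w \<in> ?V" "w \<in> O1" "w \<in> S'" using O1(3) by (auto simp: TB)
    then have "H w \<in> Z1" using HV GH by (simp add: Z1_def)
    then show "w \<in> G ` Z1" using GH(4)[OF w(3)] by (intro image_eqI[of _ _ "H w"]) simp_all
  qed
  define c' where "c' = ({y \<in> fst c1. snd c1 y \<in> Z1}, \<lambda>y. G (snd c1 y))"
  have fc': "fst c' = {y \<in> fst c1. snd c1 y \<in> Z1}" and sc': "snd c' y = G (snd c1 y)" for y
    by (simp_all add: c'_def)
  have img1: "snd c1 ` fst c' = Z1" using Z1c by (auto simp: fc')
  have img: "snd c' ` fst c' = TB" 
  proof -
    have "snd c' ` fst c' = G ` (snd c1 ` fst c')" by (simp add: image_image sc')
    then show ?thesis by (simp only: img1 GZ)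
  qed
  have y0': "y0 \<in> fst c'"
    using y0 z0V S(3) O1(2) by (simp add: fc' Z1_def z0_def)
  have opc': "openin (mf_top M) (fst c')" unfolding fc' by (rule chart_open_preimage[OF ch1 Z1])
  have TBo: "openin (top_of_set ?V) TB" unfolding TB using O1(1) by (rule openin_open_Int)
  have h1: "homeomorphic_map (subtopology (mf_top M) (fst c')) (top_of_set Z1) (snd c1)"
  proof -
    have "topspace (subtopology (mf_top M) (fst c1)) \<inter> fst c' = fst c'"
      unfolding chart_topspace[OF ch1] by (auto simp: fc')
    moreover have "topspace (top_of_set (snd c1 ` fst c1)) \<inter> Z1 = Z1" using Z1c by auto
    ultimately have "snd c1 ` (topspace (subtopology (mf_top M) (fst c1)) \<inter> fst c') =
        topspace (top_of_set (snd c1 ` fst c1)) \<inter> Z1"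
      by (simp only: img1)
    then have "homeomorphic_map (subtopology (subtopology (mf_top M) (fst c1)) (fst c'))
        (subtopology (top_of_set (snd c1 ` fst c1)) Z1) (snd c1)"
      by (rule homeomorphic_map_subtopologies[OF chart_homeo[OF ch1]])
    moreover have "fst c1 \<inter> fst c' = fst c'" "snd c1 ` fst c1 \<inter> Z1 = Z1" using Z1c by (auto simp: fc')
    ultimately show ?thesis by (simp add: subtopology_subtopology)
  qed
  have h2: "homeomorphic_map (top_of_set Z1) (top_of_set TB) G"
  proof -
    have "homeomorphic_maps (top_of_set Z1) (top_of_set TB) G H"
      unfolding homeomorphic_maps_def
    proof (intro conjI ballI)
      have ZS: "Z1 \<subseteq> S" by (auto simp: Z1_def)
      have TS: "TB \<subseteq> S'" using O1(3) by (auto simp: TB)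
      show "continuous_map (top_of_set Z1) (top_of_set TB) G"
        using continuous_on_subset[OF Gc ZS] GZ by (auto simp: continuous_map_in_subtopology)
      have "H ` TB \<subseteq> Z1" unfolding GZ[symmetric] using ZS GH(3) by auto
      then show "continuous_map (top_of_set TB) (top_of_set Z1) H"
        using continuous_on_subset[OF Hc TS] by (auto simp: continuous_map_in_subtopology)
      show "H (G x) = x" if "x \<in> topspace (top_of_set Z1)" for x using GH(3)[of x] ZS that by auto
      show "G (H y) = y" if "y \<in> topspace (top_of_set TB)" for y using GH(4)[of y] TS that by auto
    qed
    then show ?thesis unfolding homeomorphic_map_maps by blast
  qed
  have ch': "is_chart M c'"
    unfolding is_chart_def img
  proof (intro conjI opc' TBo)
    have "snd c' = G \<circ> snd c1" by (simp add: fun_eq_iff sc')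
    then show "homeomorphic_map (subtopology (mf_top M) (fst c')) (top_of_set TB) (snd c')"
      using homeomorphic_map_compose[OF h1 h2] by simp
  qed
  have inj1: "chart_inv c' (snd c' y) = y" if "y \<in> fst c'" for y by (rule chart_inv_left[OF ch' that])
  have compat: "Cr_compatible r M c' c''" if c'': "c'' \<in> mf_atlas M" for c''
    unfolding Cr_compatible_def Cr_on_def
  proof (intro conjI allI impI)
    have chc: "is_chart M c''" by (rule Cr_manifold_chart[OF mfd c''])
    fix k assume k: "enat k \<le> r"
    have op: "openin (mf_top M) (fst c' \<inter> fst c'')" by (intro openin_Int opc' chart_openin[OF chc])
    let ?D = "snd c' ` (fst c' \<inter> fst c'')"
    have D: "openin (top_of_set ?V) ?D" by (rule chart_open_image[OF ch' op]) simp
    have so: "secs_open ?V ((UNIV::real set) \<times> ?D)" by (rule secs_open_Times[OF D])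
    have DS: "?D \<subseteq> S'" using img O1(3) by (auto simp: TB)
    let ?D1 = "snd c1 ` (fst c1 \<inter> fst c'')"
    have so1: "secs_open ?V ((UNIV::real set) \<times> ?D1)"
      by (rule secs_open_Times[OF Cr_manifold_change_open[OF mfd c1a c'']])
    have "pCk k UNIV (\<lambda>_::real. H) (UNIV \<times> S')"
      using Hr k by (intro Ck_on_imp_pCk) (auto simp: Cr_on_def)
    then have Hk: "pCk k ?V (\<lambda>_::real. H) (UNIV \<times> ?D)"
      by (rule pCk_restrict_subspace[OF V so]) (use DS in auto)
    have "pCk k ?V (\<lambda>_::real. local_rep c1 id c'') (UNIV \<times> ?D1)"
      by (rule Ck_on_imp_pCk[OF Cr_manifold_change[OF mfd c1a c'' k]])
        (auto simp: chart_in_model[OF ch1])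
    then have "pCk k ?V (\<lambda>_::real. \<lambda>z. local_rep c1 id c'' (H z)) (UNIV \<times> ?D)"
    proof (rule pCk_compose[OF V so V so1 Hk])
      fix p :: real and z assume "(p, z) \<in> UNIV \<times> ?D"
      then obtain y where y: "y \<in> fst c'" "y \<in> fst c''" "z = G (snd c1 y)" by (auto simp: sc')
      then have "H z = snd c1 y" using GH(3) by (simp add: fc' Z1_def)
      then show "(p, H z) \<in> UNIV \<times> ?D1" using y by (auto simp: fc')
    qed
    then have "pCk k ?V (\<lambda>_::real. local_rep c' id c'') (UNIV \<times> ?D)"
    proof (rule pCk_cong[OF V so])
      fix u assume "u \<in> (UNIV::real set) \<times> ?D"
      then obtain y where y: "y \<in> fst c'" "y \<in> fst c''" "snd u = snd c' y" by auto
      then have "H (snd u) = snd c1 y" "y \<in> fst c1" using GH(3) by (simp_all add: fc' Z1_def sc')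
      then show "local_rep c1 id c'' (H (snd u)) = local_rep c' id c'' (snd u)"
        using y by (simp add: local_rep_chart[OF ch1] local_rep_chart[OF ch'])
    qed
    then show "Ck_on k ?V (local_rep c' id c'') ?D" by (rule pCk_imp_Ck_on) simp
    let ?E = "snd c'' ` (fst c' \<inter> fst c'')"
    have E: "openin (top_of_set ?V) ?E" by (rule chart_open_image[OF chc op]) simp
    have soE: "secs_open ?V ((UNIV::real set) \<times> ?E)" by (rule secs_open_Times[OF E])
    have ZS: "secs_open ?V ((UNIV::real set) \<times> Z1)" by (rule secs_open_Times[OF Z1])
    have "pCk k UNIV (\<lambda>_::real. G) (UNIV \<times> S)"
      using Gr k by (intro Ck_on_imp_pCk) (auto simp: Cr_on_def)
    then have Gk: "pCk k ?V (\<lambda>_::real. G) (UNIV \<times> Z1)"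
      by (rule pCk_restrict_subspace[OF V ZS]) (auto simp: Z1_def)
    have "pCk k ?V (\<lambda>_::real. local_rep c'' id c1) (UNIV \<times> snd c'' ` (fst c'' \<inter> fst c1))"
      by (rule Ck_on_imp_pCk[OF Cr_manifold_change[OF mfd c'' c1a k]])
        (auto simp: chart_in_model[OF chc])
    then have t: "pCk k ?V (\<lambda>_::real. local_rep c'' id c1) (UNIV \<times> ?E)"
      by (rule pCk_subset) (auto simp: fc')
    have "pCk k ?V (\<lambda>_::real. \<lambda>z. G (local_rep c'' id c1 z)) (UNIV \<times> ?E)"
      by (rule pCk_compose[OF V soE V ZS t Gk]) (auto simp: fc' local_rep_chart[OF chc])
    then have "pCk k ?V (\<lambda>_::real. local_rep c'' id c') (UNIV \<times> ?E)"
      by (rule pCk_cong[OF V soE]) (auto simp: sc' local_rep_chart[OF chc])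
    then show "Ck_on k ?V (local_rep c'' id c') ?E" by (rule pCk_imp_Ck_on) simp
  qed
  have c'a: "c' \<in> mf_atlas M"
    using mfd ch' compat unfolding Cr_manifold_def by blast
  have lp: "local_proj c' y = local_proj c1 y" for y by (simp add: local_proj_def sc' fstG)
  have sub: "fst c' \<subseteq> fst c1" by (auto simp: fc')
  have "c' \<in> F"
  proof (rule maxi[rule_format, OF c'a], intro conjI ballI)
    have "convex (P \<inter> ball (snd (G z0)) e)"
      by (rule convex_Int[OF subspace_imp_convex[OF P] convex_ball])
    then show "product_chart Q P c'"
      unfolding product_chart_def img TB_def
      by (intro exI[of _ "Q \<inter> A1"] exI[of _ "P \<inter> ball (snd (G z0)) e"] conjI refl
          openin_open_Int AB(1) open_ball)
    fix c'' assume c'': "c'' \<in> F"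
    show "foliated_change M c' c''"
      unfolding foliated_change_def
    proof
      fix x assume x: "x \<in> fst c' \<inter> fst c''"
      then have "x \<in> fst c1 \<inter> fst c''" using sub by blast
      from bspec[OF fch[rule_format, OF c1 c'', unfolded foliated_change_def] this]
      obtain W h where W: "openin (mf_top M) W" "x \<in> W" "W \<subseteq> fst c1 \<inter> fst c''"
        "\<forall>y\<in>W. local_proj c'' y = h (local_proj c1 y)"
        by (elim exE conjE)
      show "\<exists>W h. openin (mf_top M) W \<and> x \<in> W \<and> W \<subseteq> fst c' \<inter> fst c'' \<and>
          (\<forall>y\<in>W. local_proj c'' y = h (local_proj c' y))"
        by (intro exI[of _ "W \<inter> fst c'"] exI[of _ h] conjI openin_Int W(1) opc') (use W x lp in auto)
    qed
    show "foliated_change M c'' c'"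
      unfolding foliated_change_def
    proof
      fix x assume x: "x \<in> fst c'' \<inter> fst c'"
      then have "x \<in> fst c'' \<inter> fst c1" using sub by blast
      from bspec[OF fch[rule_format, OF c'' c1, unfolded foliated_change_def] this]
      obtain W h where W: "openin (mf_top M) W" "x \<in> W" "W \<subseteq> fst c'' \<inter> fst c1"
        "\<forall>y\<in>W. local_proj c1 y = h (local_proj c'' y)"
        by (elim exE conjE)
      show "\<exists>W h. openin (mf_top M) W \<and> x \<in> W \<and> W \<subseteq> fst c'' \<inter> fst c' \<and>
          (\<forall>y\<in>W. local_proj c' y = h (local_proj c'' y))"
        by (intro exI[of _ "W \<inter> fst c'"] exI[of _ h] conjI openin_Int W(1) opc') (use W x lp in auto)
    qed
  qed
  then show ?thesis
    using y0' sub by (intro bexI[of _ c']) (auto simp: fc' Z1_def sc')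
qed

text \<open>In a slice chart \<open>c2\<close> the set A is given by the component R normal to L. By
  transversality this normal component can be produced by leaf directions alone, namely by a space E
  of leaf directions on which h is injective. Pulling the equation of A back to E by J gives an
  E-valued function, which is made the new E-component of the leaf coordinate.\<close>

lemma adapted_chart_exists:
  fixes M :: "('c, 'u::euclidean_space \<times> 'd::euclidean_space) mfd"
  assumes r: "1 \<le> r" and fol: "Cr_foliation r M F" and A: "embedded_submanifold M A"
    and tr: "submanifold_transverse_to_foliation M F A" and y0: "y0 \<in> A"
  obtains c' E where "c' \<in> F" "y0 \<in> fst c'" "subspace E" "E \<subseteq> snd ` mf_model M" "adapted A c' E"
proof -
  let ?V = "mf_model M"
  have mfd: "Cr_manifold r M" by (rule Cr_foliation_manifold[OF fol])
  interpret C1_manifold r M using r mfd by unfold_locales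
  obtain Q P where Q: "subspace Q" and P: "subspace P" and QP: "?V = Q \<times> P"
    using Cr_foliation_model[OF fol] by blast
  have Pi: "P = snd ` ?V" using subspace_0[OF Q] by (force simp: QP)
  have V: "subspace ?V" by (rule model)
  have "y0 \<in> topspace (mf_top M)" using A y0 unfolding embedded_submanifold_def by blast
  then obtain c1 where c1: "c1 \<in> F" "y0 \<in> fst c1" using Cr_foliation_covers[OF fol] by blast
  obtain c2 L where c2: "y0 \<in> fst c2" and sl: "slice_chart M A c2 L"
    using A y0 unfolding embedded_submanifold_def by blast
  have L: "subspace L" "L \<subseteq> ?V" "c2 \<in> mf_atlas M" "snd c2 ` (fst c2 \<inter> A) = snd c2 ` fst c2 \<inter> L"
    using sl by (simp_all add: slice_chart_def)
  have c1a: "c1 \<in> mf_atlas M" using Cr_foliation_atlas[OF fol] c1 by blast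
  have cc1: "c1 \<in> charts_at M y0" and cc2: "c2 \<in> charts_at M y0"
    using c1 c1a c2 L(3) by (simp_all add: charts_at_def)
  have ch1: "is_chart M c1" and ch2: "is_chart M c2" using charts_atD cc1 cc2 by blast+
  define z0 where "z0 = snd c1 y0"
  have z0V: "z0 \<in> ?V" unfolding z0_def by (rule chart_in_model[OF ch1 c1(2)])
  define \<tau> where "\<tau> = local_rep c1 id c2"
  define D where "D = dch y0 c1 c2"
  have Dd: "(\<tau> has_derivative D) (at z0 within ?V)"
    unfolding \<tau>_def D_def z0_def by (rule dch_derivative[OF cc1 cc2])
  have Dlin: "linear D" by (rule has_derivative_linear[OF Dd])
  have DV: "D v \<in> ?V" if "v \<in> ?V" for v unfolding D_def by (rule dch_in_model[OF cc1 cc2 that])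
  \<comment> \<open>The component orthogonal to L, whose vanishing on \<open>snd c2 y\<close>
    characterises the points y of A in the domain of \<open>c2\<close>.\<close>
  define R where "R w = w - oproj L w" for w
  have Rlin: "linear R"
    unfolding R_def by (intro linear_compose_sub linear_id[unfolded id_def] linear_oproj[OF L(1)])
  have R0: "R w = 0 \<longleftrightarrow> w \<in> L" for w
  proof
    assume "R w = 0"
    then have "w = oproj L w" by (simp add: R_def)
    then show "w \<in> L" using oproj_in[OF L(1), of w] by simp
  qed (simp add: R_def oproj_id[OF L(1)])
  define h where "h b = R (D (0, b))" for b :: 'd
  have hlin: "linear h"
  proof -
    have "linear (\<lambda>b::'d. (0::'u, b))" by (rule linearI) simp_all
    from linear_compose[OF linear_compose[OF this Dlin] Rlin] show ?thesis by (simp add: h_def[abs_def] o_def)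
  qed
  \<comment> \<open>The leaf directions at y0 that are tangent to A. On their orthogonal complement
    in P, which becomes E, the map h is injective.\<close>
  define Ker where "Ker = {b \<in> P. h b = 0}"
  have Ker: "subspace Ker" unfolding Ker_def subspace_def
    using subspace_0[OF P] subspace_add[OF P] subspace_scale[OF P]
    by (auto simp: linear_0[OF hlin] linear_add[OF hlin] linear_scale[OF hlin])
  define E where "E = {b \<in> P. \<forall>k\<in>Ker. b \<bullet> k = 0}"
  have E: "subspace E" unfolding E_def subspace_def
    using subspace_0[OF P] subspace_add[OF P] subspace_scale[OF P] by (auto simp: inner_add_left)
  have EP: "E \<subseteq> P" by (auto simp: E_def)
  have EV: "b \<in> E \<Longrightarrow> (0, b) \<in> ?V" for b using EP subspace_0[OF Q] by (auto simp: QP)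
  have hinj: "b = 0" if "b \<in> E" "h b = 0" for b
  proof -
    have "b \<in> Ker" using that EP by (auto simp: Ker_def)
    then have "b \<bullet> b = 0" using that(1) by (simp add: E_def)
    then show ?thesis by simp
  qed
  have "inj_on h E"
  proof (rule inj_onI)
    fix a b assume ab: "a \<in> E" "b \<in> E" "h a = h b"
    then have "a - b = 0" by (intro hinj subspace_diff[OF E]) (simp_all add: linear_diff[OF hlin])
    then show "a = b" by simp
  qed
  then obtain J where J: "range J \<subseteq> E" "linear J" "\<forall>v\<in>E. J (h v) = v"
    using linear_exists_left_inverse_on[OF hlin E] by blast
  \<comment> \<open>Transversality enters here: w is the sum of a vector tangent to A, which R
    kills, and a leaf vector, which is (0, b) in \<open>c1\<close>. Reducing b modulo
    \<open>Ker\<close> puts it into E without changing h b.\<close>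
  have onto: "\<exists>e\<in>E. R w = h e" if w: "w \<in> ?V" for w
  proof -
    obtain v where v: "v \<in> tangent_space M y0" "v c2 = w" using tangent_exists[OF cc2 w] by blast
    have "v \<in> tangent_sum (submanifold_tangent_space M A y0) (leaf_tangent_space M F y0)"
      using tr y0 v(1) unfolding submanifold_transverse_to_foliation_def by blast
    then obtain a l where al: "a \<in> submanifold_tangent_space M A y0" "l \<in> leaf_tangent_space M F y0"
      "v = (\<lambda>c. a c + l c)" unfolding tangent_sum_def by blast
    have aL: "a c2 \<in> L" using al(1) c2 sl unfolding submanifold_tangent_space_def by blast
    have l: "l \<in> tangent_space M y0" "fst (l c1) = 0"
      using al(2) c1 unfolding leaf_tangent_space_def by blast+
    have lV: "l c1 \<in> ?V" "l c2 = D (l c1)"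
      using l(1) cc1 cc2 unfolding tangent_space_iff D_def by blast+
    define b where "b = snd (l c1)"
    have lb: "l c1 = (0, b)" using l(2) by (simp add: b_def prod_eq_iff)
    have bP: "b \<in> P" using lV(1) by (simp add: lb QP)
    have "w = a c2 + l c2" using v(2) unfolding al(3) by simp
    then have "R w = R (a c2) + h b"
      unfolding lV(2) lb h_def by (simp only: linear_add[OF Rlin])
    then have Rw: "R w = h b" using R0[of "a c2"] aL by simp
    define e where "e = b - oproj Ker b"
    have kK: "oproj Ker b \<in> Ker" by (rule oproj_in[OF Ker])
    have "e \<in> P" unfolding e_def using bP kK by (intro subspace_diff[OF P]) (simp_all add: Ker_def)
    moreover have "e \<bullet> k = 0" if "k \<in> Ker" for k unfolding e_def by (rule oproj_orth[OF Ker that])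
    ultimately have "e \<in> E" by (simp add: E_def)
    moreover have "h e = h b" using kK by (simp add: e_def linear_diff[OF hlin] Ker_def)
    ultimately show ?thesis using Rw by (intro bexI[of _ e]) simp_all
  qed
  have JR: "J (R w) = 0 \<longleftrightarrow> w \<in> L" if w: "w \<in> ?V" for w
  proof -
    obtain e where e: "e \<in> E" "R w = h e" using onto[OF w] by blast
    then have "J (R w) = e" using J(3) by simp
    moreover have "e = 0 \<longleftrightarrow> R w = 0" using e hinj[of e] linear_0[OF hlin] by auto
    ultimately show ?thesis using R0 by simp
  qed
  \<comment> \<open>The E-component of the leaf coordinate is replaced by the equation of A; all
    else is kept. The increment lies in {0} \<times> E, so first coordinates and membership in the
    model are preserved. As \<tau> is a map on V, the projection onto V extends G to an open subset
    of the full space, where the inverse function theorem is available.\<close>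
  define G where "G z = z + (0, J (R (\<tau> (oproj ?V z))) - oproj E (snd z))" for z
  let ?S0 = "snd c1 ` (fst c1 \<inter> fst c2)"
  have S0: "openin (top_of_set ?V) ?S0" by (rule Cr_manifold_change_open[OF mfd c1a L(3)])
  then obtain W where W: "open W" "?S0 = ?V \<inter> W" by (auto simp: openin_open)
  have "continuous_on UNIV (oproj ?V)"
    using linear_oproj[OF V] linear_continuous_on linear_conv_bounded_linear by blast
  then have opU: "open (oproj ?V -` W)" by (rule open_vimage[OF W(1)])
  let ?U = "oproj ?V -` W"
  have so: "secs_open UNIV ((UNIV::real set) \<times> ?U)" by (rule secs_open_UNIV[OF opU])
  have Gr: "Cr_on r UNIV G ?U"
    unfolding Cr_on_def
  proof (intro allI impI)
    fix k assume k: "enat k \<le> r"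
    have pj: "pCk k UNIV (\<lambda>_::real. oproj ?V) (UNIV \<times> ?U)"
      by (rule pCk_linear[OF subspace_UNIV so linear_oproj[OF V] pCk_ident[OF subspace_UNIV so]])
    have "pCk k ?V (\<lambda>_::real. \<tau>) (UNIV \<times> ?S0)"
      unfolding \<tau>_def by (rule Ck_on_imp_pCk[OF Cr_manifold_change[OF mfd c1a L(3) k] openin_imp_subset[OF S0]]) auto
    then have t: "pCk k UNIV (\<lambda>_::real. \<lambda>z. \<tau> (oproj ?V z)) (UNIV \<times> ?U)"
      by (rule pCk_compose[OF subspace_UNIV so V secs_open_Times[OF S0] pj])
        (use W(2) oproj_in[OF V] in auto)
    have Jt: "pCk k UNIV (\<lambda>_::real. \<lambda>z. J (R (\<tau> (oproj ?V z)))) (UNIV \<times> ?U)"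
      by (rule pCk_linear[OF subspace_UNIV so J(2) pCk_linear[OF subspace_UNIV so Rlin t]])
    have Es: "pCk k UNIV (\<lambda>_::real. \<lambda>z. oproj E (snd z)) (UNIV \<times> ?U)"
      by (rule pCk_linear[OF subspace_UNIV so linear_oproj[OF E]
            pCk_linear[OF subspace_UNIV so linear_snd pCk_ident[OF subspace_UNIV so]]])
    have lp: "linear (\<lambda>b::'d. (0::'u, b))" by (rule linearI) simp_all
    have "pCk k UNIV (\<lambda>_::real. G) (UNIV \<times> ?U)"
      unfolding G_def
      by (rule pCk_add[OF subspace_UNIV so pCk_ident[OF subspace_UNIV so]
            pCk_linear[OF subspace_UNIV so lp pCk_diff[OF subspace_UNIV so Jt Es]]])
    then show "Ck_on k UNIV G ?U" by (rule pCk_imp_Ck_on) simp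
  qed
  have z0U: "z0 \<in> ?U" using W(2) c1 c2 z0V V by (auto simp: z0_def)
  have Gd: "(G has_derivative (\<lambda>v. v + (0, J (R (D (oproj ?V v))) - oproj E (snd v)))) (at z0)"
  proof -
    have bl: "bounded_linear (oproj ?V)" "bounded_linear (oproj E)" "bounded_linear (\<lambda>w. J (R w))"
      using linear_oproj[OF V] linear_oproj[OF E] linear_compose[OF Rlin J(2)]
      by (simp_all add: linear_conv_bounded_linear o_def)
    have "((\<lambda>z. \<tau> (oproj ?V z)) has_derivative (\<lambda>v. D (oproj ?V v))) (at z0)"
    proof (rule has_derivative_in_compose[where f = "oproj ?V" and g = \<tau> and s = UNIV
          and f' = "oproj ?V" and g' = D])
      show "(oproj ?V has_derivative oproj ?V) (at z0 within UNIV)"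
        by (rule bounded_linear_imp_has_derivative[OF bl(1)])
      show "(\<tau> has_derivative D) (at (oproj ?V z0) within range (oproj ?V))"
        unfolding oproj_id[OF V z0V]
        by (rule has_derivative_subset[OF Dd]) (use oproj_in[OF V] in blast)
    qed
    then have "((\<lambda>z. J (R (\<tau> (oproj ?V z)))) has_derivative (\<lambda>v. J (R (D (oproj ?V v))))) (at z0)"
      by (rule bounded_linear.has_derivative[OF bl(3)])
    moreover have "((\<lambda>z. oproj E (snd z)) has_derivative (\<lambda>v. oproj E (snd v))) (at z0)"
      by (rule bounded_linear.has_derivative[OF bl(2) bounded_linear_imp_has_derivative[OF bounded_linear_snd]])
    ultimately show ?thesis
      unfolding G_def by (intro has_derivative_add has_derivative_ident has_derivative_Pair has_derivative_const has_derivative_diff)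
  qed
  \<comment> \<open>A kernel vector has the form (0, b) with b in E. On such vectors the new
    component has derivative J (h b) = b, which replaces the old component b; so the derivative of G
    fixes (0, b), and b = 0.\<close>
  have inj: "v = 0" if v: "frechet_derivative G (at z0) v = 0" for v
  proof -
    have "v + (0, J (R (D (oproj ?V v))) - oproj E (snd v)) = 0"
      using v unfolding frechet_derivative_at[OF Gd, symmetric] .
    then have v1: "fst v = 0" and v2: "snd v + (J (R (D (oproj ?V v))) - oproj E (snd v)) = 0"
      by (simp_all add: prod_eq_iff)
    define b where "b = snd v"
    have vb: "v = (0, b)" using v1 by (simp add: b_def prod_eq_iff)
    have "b = oproj E b - J (R (D (oproj ?V v)))" using v2 by (simp add: b_def algebra_simps)
    moreover have "oproj E b - J (R (D (oproj ?V v))) \<in> E"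
      using oproj_in[OF E, of b] J(1) by (intro subspace_diff[OF E]) auto
    ultimately have bE: "b \<in> E" by simp
    then have "oproj ?V v = v" using EV V vb by simp
    then have "J (R (D (oproj ?V v))) = b" using J(3) bE by (simp add: vb h_def[symmetric])
    then have "b = 0" using v2 oproj_id[OF E bE] by (simp add: b_def)
    then show ?thesis using vb by (simp add: zero_prod_def)
  qed
  obtain S S' H where S: "open S" "z0 \<in> S" "S \<subseteq> ?U" "open S'" "G z0 \<in> S'"
    and hom: "homeomorphism S S' G H" and Hr: "Cr_on r UNIV H S'"
    by (rule Cr_inverse_function[OF r opU Gr z0U inj])
  have incr: "(0, J (R (\<tau> (oproj ?V z))) - oproj E (snd z)) \<in> ?V" for z
    using J(1) oproj_in[OF E] by (intro EV subspace_diff[OF E]) auto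
  have GV: "G z \<in> ?V \<longleftrightarrow> z \<in> ?V" for z
  proof
    assume "G z \<in> ?V"
    then have "G z - (0, J (R (\<tau> (oproj ?V z))) - oproj E (snd z)) \<in> ?V" by (rule subspace_diff[OF V _ incr])
    then show "z \<in> ?V" by (simp add: G_def)
  qed (simp add: G_def subspace_add[OF V _ incr])
  have SV: "S \<inter> ?V \<subseteq> ?S0" using S(3) V W(2) by auto
  have GrS: "Cr_on r UNIV G S"
    unfolding Cr_on_def
  proof (intro allI impI)
    fix k assume "enat k \<le> r"
    then have "pCk k UNIV (\<lambda>_::real. G) (UNIV \<times> ?U)" using Gr by (intro Ck_on_imp_pCk) (auto simp: Cr_on_def)
    then show "Ck_on k UNIV G S" by (rule pCk_imp_Ck_on) (use S(3) in auto)
  qed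
  have "\<exists>c'\<in>F. y0 \<in> fst c' \<and> fst c' \<subseteq> fst c1 \<and> (\<forall>y\<in>fst c'. snd c1 y \<in> S \<and> snd c' y = G (snd c1 y))"
    by (rule foliated_chart_change[OF fol c1 S(1,4) _ hom GrS Hr])
      (use S(2) GV SV in \<open>auto simp: z0_def G_def\<close>)
  then obtain c' where c': "c' \<in> F" "y0 \<in> fst c'" "fst c' \<subseteq> fst c1" "\<forall>y\<in>fst c'. snd c1 y \<in> S \<and> snd c' y = G (snd c1 y)"
    by blast
  have ad: "adapted A c' E"
    unfolding adapted_def
  proof
    fix y assume y: "y \<in> fst c'"
    then have y1: "y \<in> fst c1" using c' by blast
    define z where "z = snd c1 y"
    have zV: "z \<in> ?V" unfolding z_def by (rule chart_in_model[OF ch1 y1])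
    have "z \<in> ?S0" using SV zV c'(4) y by (auto simp: z_def)
    then obtain y' where y': "y' \<in> fst c1" "y' \<in> fst c2" "snd c1 y = snd c1 y'" by (auto simp: z_def)
    then have y2: "y \<in> fst c2" using inj_onD[OF chart_inj[OF ch1]] y1 by metis
    have tz: "\<tau> z = snd c2 y" by (simp add: \<tau>_def z_def local_rep_chart[OF ch1 y1])
    have tV: "\<tau> z \<in> ?V" unfolding tz by (rule chart_in_model[OF ch2 y2])
    have sG: "snd (snd c' y) = (snd z - oproj E (snd z)) + J (R (\<tau> z))"
      using c'(4) y zV V by (simp add: G_def z_def[symmetric])
    have "snd (snd c' y) \<bullet> w = J (R (\<tau> z)) \<bullet> w" if "w \<in> E" for w
      unfolding sG using oproj_orth[OF E that, of "snd z"] by (simp add: inner_add_left)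
    then have "(\<forall>w\<in>E. snd (snd c' y) \<bullet> w = 0) \<longleftrightarrow> (\<forall>w\<in>E. J (R (\<tau> z)) \<bullet> w = 0)" by simp
    also have "\<dots> \<longleftrightarrow> J (R (\<tau> z)) = 0" 
    proof
      assume "\<forall>w\<in>E. J (R (\<tau> z)) \<bullet> w = 0"
      moreover have "J (R (\<tau> z)) \<in> E" using J(1) by blast
      ultimately have "J (R (\<tau> z)) \<bullet> J (R (\<tau> z)) = 0" by blast
      then show "J (R (\<tau> z)) = 0" by simp
    qed simp
    also have "\<dots> \<longleftrightarrow> snd c2 y \<in> L" using JR[OF tV] by (simp add: tz)
    also have "\<dots> \<longleftrightarrow> y \<in> A"
    proof
      assume "snd c2 y \<in> L"
      then have "snd c2 y \<in> snd c2 ` (fst c2 \<inter> A)" using L(4) y2 by auto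
      then obtain y' where "y' \<in> fst c2" "y' \<in> A" "snd c2 y = snd c2 y'" by auto
      then show "y \<in> A" using inj_onD[OF chart_inj[OF ch2]] y2 by metis
    next
      assume "y \<in> A"
      then show "snd c2 y \<in> L" using L(4) y2 by blast
    qed
    finally show "y \<in> A \<longleftrightarrow> (\<forall>w\<in>E. snd (snd c' y) \<bullet> w = 0)" by simp
  qed
  show thesis
    by (rule that[OF c'(1,2) E _ ad]) (use EP Pi in simp)
qed

section \<open>Openness\<close>

text \<open>For a unit vector w in E, \<sigma> is positive if the E-component of the value is
  nonzero or if some derivative is not orthogonal to w. Regularity on Z makes it positive for all
  such w, hence bounded below by some \<delta> > 0 on the compact product of Z with the unit sphere
  of E. A C^1-small change of f changes \<sigma> by less than \<delta>.\<close>

lemma regular_at_stable: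
  fixes f :: "'e::euclidean_space \<Rightarrow> 'd::euclidean_space"
  assumes V: "subspace V" and E: "subspace E" and D: "openin (top_of_set V) D" and Z: "compact Z" "Z \<subseteq> D"
    and f: "Ck_on (Suc 0) V f D" and reg: "\<forall>z\<in>Z. regular_at E V f z"
  shows "\<exists>\<epsilon>>0. \<forall>h z. z \<in> Z \<longrightarrow> h differentiable (at z within V) \<longrightarrow> norm (h z - f z) < \<epsilon> \<longrightarrow>
      (\<forall>u. u \<in> V \<longrightarrow> norm u \<le> 1 \<longrightarrow>
        norm (frechet_derivative h (at z within V) u - frechet_derivative f (at z within V) u) < \<epsilon>) \<longrightarrow>
      regular_at E V h z"
proof -
  let ?d = "\<lambda>f z. frechet_derivative f (at z within V)"
  define \<sigma> where "\<sigma> h z w = norm (oproj E (h z)) + (\<Sum>b\<in>Basis. \<bar>?d h z (oproj V b) \<bullet> w\<bar>)"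
    for h :: "'e \<Rightarrow> 'd" and z and w :: 'd
  have fd: "f differentiable (at z within V)" if "z \<in> D" for z using f that by simp
  have pos: "\<sigma> f z w > 0" if z: "z \<in> Z" and w: "w \<in> E" "norm w = 1" for z w
  proof (cases "oproj E (f z) = 0")
    case True
    then have "f z \<bullet> w' = 0" if "w' \<in> E" for w' using oproj_inner[OF E that, of "f z"] by simp
    moreover have "w \<noteq> 0" using w by auto
    ultimately obtain u where u: "u \<in> V" "?d f z u \<bullet> w \<noteq> 0" using reg[rule_format, OF z] w(1) unfolding regular_at_def by blast
    have "\<exists>b\<in>Basis. ?d f z (oproj V b) \<bullet> w \<noteq> 0"
    proof (rule ccontr)
      assume "\<not> ?thesis"
      moreover have "?d f z u = (\<Sum>b\<in>Basis. (u \<bullet> b) *\<^sub>R ?d f z (oproj V b))"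
        by (rule linear_oproj_expand[OF V linear_frechet_derivative[OF fd] u(1)]) (use z Z in blast)
      ultimately have "?d f z u \<bullet> w = 0" by (simp add: inner_sum_left)
      then show False using u(2) by simp
    qed
    then obtain b :: 'e where "b \<in> Basis" "?d f z (oproj V b) \<bullet> w \<noteq> 0" by blast
    then have "(\<Sum>b\<in>Basis. \<bar>?d f z (oproj V b) \<bullet> w\<bar>) > 0"
      by (intro sum_pos2[where i = b]) auto
    then show ?thesis unfolding \<sigma>_def by (rule add_nonneg_pos[OF norm_ge_zero])
  next
    case False
    then show ?thesis unfolding \<sigma>_def by (intro add_pos_nonneg sum_nonneg) auto
  qed
  obtain \<delta> where \<delta>: "\<delta> > 0" "\<And>z w. z \<in> Z \<Longrightarrow> w \<in> E \<Longrightarrow> norm w = 1 \<Longrightarrow> \<delta> \<le> \<sigma> f z w"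
  \<comment> \<open>The product is empty if Z is, or if E = {0}; any \<delta> will do then.\<close>
  proof (cases "Z \<times> (sphere 0 1 \<inter> E) = {}")
    case True
    show thesis
      by (rule that[of 1]) (use True in \<open>auto simp: dist_norm\<close>)
  next
    case False
    have "compact (Z \<times> (sphere 0 1 \<inter> E))"
      by (intro compact_Times Z compact_Int_closed compact_sphere closed_subspace[OF E])
    moreover have "continuous_on (Z \<times> (sphere 0 1 \<inter> E)) (\<lambda>y. \<sigma> f (fst y) (snd y))"
    proof -
      have cz: "continuous_on (Z \<times> (sphere 0 1 \<inter> E)) (\<lambda>y. h (fst y))" if "continuous_on D h" for h :: "'e \<Rightarrow> 'd"
        by (rule continuous_on_compose2[OF that continuous_on_fst[OF continuous_on_id]]) (use Z in auto)
      have 1: "continuous_on D f"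
        using pCk_continuous[OF Ck_on_imp_pCk[OF f openin_imp_subset[OF D], of "{0::real} \<times> D"]]
        by (auto intro: continuous_on_compose2[of "{0::real} \<times> D" "\<lambda>y. f (snd y)" D "Pair 0", simplified]
            simp: continuous_on_Pair)
      have 2: "continuous_on D (\<lambda>z. ?d f z (oproj V b))" for b using f oproj_in[OF V] by simp
      have bE: "bounded_linear (oproj E)" using linear_oproj[OF E] linear_conv_bounded_linear by blast
      show ?thesis
        unfolding \<sigma>_def
        by (intro continuous_on_add continuous_on_norm bounded_linear.continuous_on[OF bE] cz[OF 1]
            continuous_on_sum continuous_on_rabs continuous_on_inner cz[OF 2] continuous_on_snd continuous_on_id)
    qed
    ultimately obtain y where y: "y \<in> Z \<times> (sphere 0 1 \<inter> E)"
      "\<forall>x\<in>Z \<times> (sphere 0 1 \<inter> E). \<sigma> f (fst y) (snd y) \<le> \<sigma> f (fst x) (snd x)"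
      using continuous_attains_inf[OF _ False] by blast
    show thesis
    proof (rule that[of "\<sigma> f (fst y) (snd y)"])
      show "\<sigma> f (fst y) (snd y) > 0" using y(1) by (intro pos) auto
      show "\<sigma> f (fst y) (snd y) \<le> \<sigma> f z w" if "z \<in> Z" "w \<in> E" "norm w = 1" for z w
        using y(2) that by force
    qed
  qed
  define N where "N = real (card (Basis :: 'e set))"
  have N: "N \<ge> 0" by (simp add: N_def)
  \<comment> \<open>The value term and the N derivative terms each change by at most \<epsilon>, and
    the total has to stay below \<delta>.\<close>
  define \<epsilon> where "\<epsilon> = \<delta> / (2 * (1 + N))"
  have "m * (\<delta> / (2 * m)) = \<delta> / 2" if "m > 0" for m :: real using that by (simp add: field_simps)
  from this[of "1 + N"] have "(1 + N) * \<epsilon> = \<delta> / 2" using N by (simp only: \<epsilon>_def)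
  moreover have "\<epsilon> > 0" unfolding \<epsilon>_def using \<delta>(1) N by (intro divide_pos_pos) simp_all
  ultimately have \<epsilon>: "\<epsilon> > 0" "(1 + N) * \<epsilon> < \<delta>" using \<delta>(1) by simp_all
  show ?thesis
  proof (intro exI[of _ \<epsilon>] conjI \<epsilon>(1) allI impI)
    fix h z assume z: "z \<in> Z" and hd: "h differentiable (at z within V)" and h0: "norm (h z - f z) < \<epsilon>"
      and h1: "\<forall>u. u \<in> V \<longrightarrow> norm u \<le> 1 \<longrightarrow> norm (?d h z u - ?d f z u) < \<epsilon>"
    have pos': "\<sigma> h z w > 0" if w: "w \<in> E" "norm w = 1" for w
    proof -
      have "oproj E (f z) = oproj E (h z) - oproj E (h z - f z)" by (simp add: linear_diff[OF linear_oproj[OF E]])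
      then have "norm (oproj E (f z)) \<le> norm (oproj E (h z)) + norm (oproj E (h z - f z))"
        by (metis norm_triangle_ineq4)
      then have 1: "norm (oproj E (f z)) \<le> norm (oproj E (h z)) + \<epsilon>"
        using norm_oproj[OF E, of "h z - f z"] h0 by linarith
      have 2: "\<bar>?d f z (oproj V b) \<bullet> w\<bar> \<le> \<bar>?d h z (oproj V b) \<bullet> w\<bar> + \<epsilon>" if b: "b \<in> Basis" for b
      proof -
        have "norm (oproj V b) \<le> 1" using norm_oproj[OF V, of b] b by simp
        then have "norm (?d h z (oproj V b) - ?d f z (oproj V b)) < \<epsilon>" by (rule h1[rule_format, OF oproj_in[OF V]])
        moreover have "\<bar>(?d h z (oproj V b) - ?d f z (oproj V b)) \<bullet> w\<bar> \<le> norm (?d h z (oproj V b) - ?d f z (oproj V b)) * norm w"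
          by (rule Cauchy_Schwarz_ineq2)
        ultimately have "\<bar>?d h z (oproj V b) \<bullet> w - ?d f z (oproj V b) \<bullet> w\<bar> \<le> \<epsilon>"
          using w by (simp add: inner_diff_left)
        then show ?thesis by linarith
      qed
      have "(\<Sum>b\<in>Basis. \<bar>?d f z (oproj V b) \<bullet> w\<bar>) \<le> (\<Sum>b\<in>(Basis::'e set). \<bar>?d h z (oproj V b) \<bullet> w\<bar> + \<epsilon>)"
        by (rule sum_mono[OF 2])
      also have "\<dots> = (\<Sum>b\<in>Basis. \<bar>?d h z (oproj V b) \<bullet> w\<bar>) + N * \<epsilon>" by (simp add: sum.distrib N_def)
      finally have "\<sigma> f z w \<le> \<sigma> h z w + (1 + N) * \<epsilon>" using 1 by (simp add: \<sigma>_def algebra_simps)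
      then show ?thesis using \<delta>(2)[OF z w] \<epsilon>(2) by linarith
    qed
    show "regular_at E V h z"
      unfolding regular_at_def
    proof (intro impI ballI)
      fix w assume 0: "\<forall>w\<in>E. h z \<bullet> w = 0" and w: "w \<in> E" "w \<noteq> 0"
      define w1 where "w1 = (1 / norm w) *\<^sub>R w"
      have w1: "w1 \<in> E" "norm w1 = 1" using w subspace_scale[OF E] by (simp_all add: w1_def)
      have "oproj E (h z) = 0" by (rule oproj_unique[OF E]) (use 0 subspace_0[OF E] in auto)
      then have "(\<Sum>b\<in>Basis. \<bar>?d h z (oproj V b) \<bullet> w1\<bar>) > 0" using pos'[OF w1] by (simp add: \<sigma>_def)
      then obtain b :: 'e where "\<bar>?d h z (oproj V b) \<bullet> w1\<bar> \<noteq> 0"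
        by (metis (no_types, lifting) less_irrefl sum.neutral)
      then have "?d h z (oproj V b) \<bullet> w \<noteq> 0" by (auto simp: w1_def)
      then show "\<exists>u\<in>V. ?d h z u \<bullet> w \<noteq> 0" using oproj_in[OF V] by blast
    qed
  qed
qed

lemma Dk_dist_0: "Dk_dist 0 V f g x = norm (f x - g x)"
proof -
  have "{vs::'a list. length vs = 0 \<and> set vs \<subseteq> V \<inter> cball 0 1} = {[]}" by auto
  then show ?thesis by (simp add: Dk_dist_def)
qed

section \<open>Maps transverse on a compact ball\<close>

locale transverse_setting =
  fixes r :: enat
    and M :: "('a, 't::euclidean_space \<times> 'b::euclidean_space) mfd"
    and F :: "('a, 't \<times> 'b) chart set"
    and M' :: "('c, 'u::euclidean_space \<times> 'd::euclidean_space) mfd"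
    and F' :: "('c, 'u \<times> 'd) chart set"
    and A :: "'c set"
  assumes r: "1 \<le> r" and fol: "Cr_foliation r M F" and fol': "Cr_foliation r M' F'"
begin

abbreviation "V \<equiv> mf_model M"
abbreviation "V' \<equiv> mf_model M'"
abbreviation "Sp \<equiv> sp_topology r M F M' F'"
abbreviation "Maps \<equiv> foliation_maps r M F M' F'"

lemma mfd: "Cr_manifold r M" and mfd': "Cr_manifold r M'"
  using fol fol' by (simp_all add: Cr_foliation_manifold)

lemma V: "subspace V" and V': "subspace V'"
  using mfd mfd' by (simp_all add: Cr_manifold_model)

lemma F_atlas: "c \<in> F \<Longrightarrow> c \<in> mf_atlas M" and F'_atlas: "c' \<in> F' \<Longrightarrow> c' \<in> mf_atlas M'"
  using Cr_foliation_atlas fol fol' by blast+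

lemma F_chart: "c \<in> F \<Longrightarrow> is_chart M c" and F'_chart: "c' \<in> F' \<Longrightarrow> is_chart M' c'"
  using Cr_manifold_chart[OF mfd] Cr_manifold_chart[OF mfd'] F_atlas F'_atlas by blast+

lemma r1: "enat (Suc 0) \<le> r"
  using r by (simp add: one_enat_def)

text \<open>The inclusion makes \<open>snd c\<close> map K onto all of
  \<open>cball z \<rho> \<inter> V\<close>. This gives compactness of K and, later, room around it
  for a bump function.\<close>

definition compact_ball :: "('a, 't \<times> 'b) chart \<Rightarrow> 't \<times> 'b \<Rightarrow> real \<Rightarrow> 'a set \<Rightarrow> bool" where
  "compact_ball c z \<rho> K \<longleftrightarrow> c \<in> F \<and> z \<in> V \<and> 0 < \<rho> \<and> cball z \<rho> \<inter> V \<subseteq> snd c ` fst c \<and>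
     K = {x \<in> fst c. snd c x \<in> cball z \<rho>}"

definition adapted_compact :: "('c, 'u \<times> 'd) chart \<Rightarrow> 'd set \<Rightarrow> 'c set \<Rightarrow> bool" where
  "adapted_compact c' E W \<longleftrightarrow> c' \<in> F' \<and> subspace E \<and> E \<subseteq> snd ` V' \<and> adapted A c' E \<and>
     compactin (mf_top M') W \<and> W \<subseteq> fst c'"

definition transverse_set :: "'a set \<Rightarrow> 'c set \<Rightarrow> ('a \<Rightarrow> 'c) set" where
  "transverse_set K W = {\<psi> \<in> Maps. \<psi> ` K \<subseteq> W \<longrightarrow> (\<forall>x\<in>K. transverse_at M M' \<psi> A x)}"

lemma compact_ball_image:
  assumes "compact_ball c z \<rho> K"
  shows "snd c ` K = cball z \<rho> \<inter> V" "K \<subseteq> fst c" "compactin (mf_top M) K" "compact (cball z \<rho> \<inter> V)"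
proof -
  have c: "is_chart M c" using assms F_chart by (simp add: compact_ball_def)
  show K: "K \<subseteq> fst c" using assms by (auto simp: compact_ball_def)
  show im: "snd c ` K = cball z \<rho> \<inter> V"
    using assms chart_in_model[OF c] by (auto simp: compact_ball_def)
  show "compact (cball z \<rho> \<inter> V)" by (intro compact_Int_closed compact_cball closed_subspace[OF V])
  then show "compactin (mf_top M) K" using chart_compact_image[OF c K] im by simp
qed

lemma transverse_iff:
  assumes \<psi>: "\<psi> \<in> Maps" and c: "c \<in> F" "x \<in> fst c" and W: "adapted_compact c' E W" and \<psi>x: "\<psi> x \<in> fst c'"
  shows "transverse_at M M' \<psi> A x \<longleftrightarrow> regular_at E V (\<lambda>z. snd (local_rep c \<psi> c' z)) (snd c x)"
proof -
  obtain Q P where Q: "subspace Q" and P: "subspace P" and QP: "V' = Q \<times> P"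
    using Cr_foliation_model[OF fol'] by blast
  show ?thesis
  proof (rule transverse_at_iff_regular[OF r mfd mfd' foliation_maps_Cr[OF \<psi>] QP subspace_0[OF Q]])
    show "subspace E" "adapted A c' E" using W by (auto simp: adapted_compact_def)
    have "E \<subseteq> snd ` (Q \<times> P)" using W QP by (simp add: adapted_compact_def)
    then show "E \<subseteq> P" by (rule order_trans) (auto split: if_splits)
    show "c \<in> charts_at M x" "c' \<in> charts_at M' (\<psi> x)"
      using c \<psi>x W F_atlas F'_atlas by (simp_all add: charts_at_def adapted_compact_def)
  qed
qed

lemma sp_subbasis:
  assumes "r = enat s \<or> r = \<infinity>" "N \<in> sp_base s M F M' F'"
  shows "openin Sp (Maps \<inter> N)"
  using assms(1)
proof
  assume rs: "r = enat s"
  have "N \<subseteq> Maps" using assms(2) unfolding sp_base_def sp_nbhd_def rs by auto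
  then have "Maps \<inter> N = N" by blast
  moreover have "openin Sp N"
    unfolding sp_topology_def rs using assms(2) by (simp add: topology_generated_by_Basis)
  ultimately show ?thesis by simp
next
  assume rs: "r = \<infinity>"
  show ?thesis
    unfolding sp_topology_def rs enat.simps
    by (rule topology_generated_by_Basis) (use assms(2) in blast)
qed

lemma class_cases:
  obtains s where "r = enat s \<or> r = \<infinity>" "1 \<le> s" "enat s \<le> r"
proof (cases r)
  case (enat s)
  then show thesis using that[of s] r by (simp add: one_enat_def)
next
  case infinity
  then show thesis using that[of 1] by simp
qed

lemma single_nbhd_open:
  assumes \<psi>: "\<psi> \<in> Maps" and c: "c \<in> F" and c': "c' \<in> F'" and K: "compactin (mf_top M) K" "K \<subseteq> fst c" "\<psi> ` K \<subseteq> fst c'"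
    and \<epsilon>: "\<epsilon> > 0" and s: "r = enat s \<or> r = \<infinity>" "enat s \<le> r"
  defines "N \<equiv> sp_nbhd s M F M' F' \<psi> {0} (\<lambda>_. c) (\<lambda>_. c') (\<lambda>_. K) (\<lambda>_. \<epsilon>)"
  shows "openin Sp (Maps \<inter> N)" "\<psi> \<in> Maps \<inter> N"
proof -
  have \<psi>s: "\<psi> \<in> foliation_maps (enat s) M F M' F'" using \<psi> foliation_maps_mono[OF s(2)] by blast
  have "N \<in> sp_base s M F M' F'"
    unfolding sp_base_def N_def
    by (rule CollectI, rule exI[of _ \<psi>], rule exI[of _ "{0}"], rule exI[of _ "\<lambda>_. c"], rule exI[of _ "\<lambda>_. c'"],
        rule exI[of _ "\<lambda>_. K"], rule exI[of _ "\<lambda>_. \<epsilon>"])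
      (use \<psi>s c c' K \<epsilon> openin_topspace in auto)
  then show "openin Sp (Maps \<inter> N)" by (rule sp_subbasis[OF s(1)])
  have "Dk_dist k V f f x = 0" for k and f :: "'t \<times> 'b \<Rightarrow> 'u \<times> 'd" and x
  proof -
    have "replicate k 0 \<in> {vs. length vs = k \<and> set vs \<subseteq> V \<inter> cball 0 1}" using subspace_0[OF V] by auto
    then have "{vs. length vs = k \<and> set vs \<subseteq> V \<inter> cball 0 1} \<noteq> {}" by blast
    then show ?thesis by (simp add: Dk_dist_def)
  qed
  then show "\<psi> \<in> Maps \<inter> N" using \<psi> \<psi>s K \<epsilon> by (simp add: N_def sp_nbhd_def)
qed

text \<open>If \<psi> does not send K into W, neither do nearby maps, because W is closed. If it
  does, nearby maps still send K into the domain of \<open>c'\<close>, where transversality can be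
  tested as regularity, and regularity is C^1-stable on the compact ball.\<close>

lemma transverse_set_open:
  assumes K: "compact_ball c z \<rho> K" and W: "adapted_compact c' E W"
  shows "openin Sp (transverse_set K W)"
proof (subst openin_subopen, intro ballI)
  fix \<psi> assume "\<psi> \<in> transverse_set K W"
  then have \<psi>: "\<psi> \<in> Maps" and tr: "\<psi> ` K \<subseteq> W \<Longrightarrow> x \<in> K \<Longrightarrow> transverse_at M M' \<psi> A x" for x
    unfolding transverse_set_def by blast+
  have \<psi>C: "\<psi> \<in> Cr_maps r M M'" by (rule foliation_maps_Cr[OF \<psi>])
  obtain s where s: "r = enat s \<or> r = \<infinity>" "1 \<le> s" "enat s \<le> r" by (rule class_cases)
  have cF: "c \<in> F" using K by (simp add: compact_ball_def)
  have c: "is_chart M c" by (rule F_chart[OF cF])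
  have c'F: "c' \<in> F'" using W by (simp add: adapted_compact_def)
  have c': "is_chart M' c'" by (rule F'_chart[OF c'F])
  note Kc = compact_ball_image[OF K]
  show "\<exists>T. openin Sp T \<and> \<psi> \<in> T \<and> T \<subseteq> transverse_set K W"
  proof (cases "\<psi> ` K \<subseteq> W")
    case False
    then obtain x where x: "x \<in> K" "\<psi> x \<notin> W" by blast
    have xc: "x \<in> fst c" using x Kc by blast
    have "\<psi> x \<in> topspace (mf_top M')" by (rule Cr_maps_in[OF \<psi>C chart_in_topspace[OF c xc]])
    then obtain c2 where c2: "c2 \<in> F'" "\<psi> x \<in> fst c2" using Cr_foliation_covers[OF fol'] by blast
    have ch2: "is_chart M' c2" by (rule F'_chart[OF c2(1)])
    have "Hausdorff_space (mf_top M')" using mfd' unfolding Cr_manifold_def by blast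
    then have "closedin (mf_top M') W" using W by (intro compactin_imp_closedin) (simp_all add: adapted_compact_def)
    then have "openin (mf_top M') (fst c2 - W)" by (intro openin_diff chart_openin[OF ch2])
    then have "openin (top_of_set V') (snd c2 ` (fst c2 - W))" by (rule chart_open_image[OF ch2]) blast
    moreover have "snd c2 (\<psi> x) \<in> snd c2 ` (fst c2 - W)" using c2 x by blast
    ultimately obtain \<epsilon> where \<epsilon>: "\<epsilon> > 0"
      "\<And>y. y \<in> V' \<Longrightarrow> dist y (snd c2 (\<psi> x)) < \<epsilon> \<Longrightarrow> y \<in> snd c2 ` (fst c2 - W)"
      unfolding openin_euclidean_subtopology_iff by metis
    \<comment> \<open>To leave W it suffices that the single point x is sent outside, so the
      neighbourhood constrains nothing else. The chart \<open>c2\<close> is chosen at \<psi> x,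
      which may lie outside the domain of \<open>c'\<close>.\<close>
    have xK: "compactin (mf_top M) {x}" using chart_in_topspace[OF c xc] by simp
    let ?N = "sp_nbhd s M F M' F' \<psi> {0} (\<lambda>_. c) (\<lambda>_. c2) (\<lambda>_. {x}) (\<lambda>_. \<epsilon>)"
    have N: "openin Sp (Maps \<inter> ?N)" "\<psi> \<in> Maps \<inter> ?N"
      by (rule single_nbhd_open[OF \<psi> cF c2(1) xK _ _ \<epsilon>(1) s(1,3)]; use xc c2 in simp)+
    have "Maps \<inter> ?N \<subseteq> transverse_set K W"
    proof
      fix \<eta> assume "\<eta> \<in> Maps \<inter> ?N"
      then have \<eta>: "\<eta> \<in> Maps" "\<eta> x \<in> fst c2"
        "Dk_dist 0 V (local_rep c \<eta> c2) (local_rep c \<psi> c2) (snd c x) < \<epsilon>"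
        unfolding sp_nbhd_def by auto
      then have "dist (snd c2 (\<eta> x)) (snd c2 (\<psi> x)) < \<epsilon>"
        by (simp add: Dk_dist_0 dist_norm local_rep_chart[OF c xc])
      then have "snd c2 (\<eta> x) \<in> snd c2 ` (fst c2 - W)" by (rule \<epsilon>(2)[OF chart_in_model[OF ch2 \<eta>(2)]])
      then obtain y where "y \<in> fst c2" "y \<notin> W" "snd c2 (\<eta> x) = snd c2 y" by blast
      then have "\<eta> x \<notin> W" using inj_onD[OF chart_inj[OF ch2] _ \<eta>(2), of y] by auto
      then show "\<eta> \<in> transverse_set K W" using \<eta>(1) x(1) unfolding transverse_set_def by blast
    qed
    with N show ?thesis by (intro exI[of _ "Maps \<inter> ?N"] conjI)
  next
    case True
    let ?f = "\<lambda>\<psi> z. snd (local_rep c \<psi> c' z)"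
    have KW: "\<psi> ` K \<subseteq> fst c'" using True W by (auto simp: adapted_compact_def)
    have E: "subspace E" using W by (simp add: adapted_compact_def)
    have Dop: "openin (top_of_set V) (snd c ` (fst c \<inter> \<eta> -` fst c'))" if "\<eta> \<in> Cr_maps r M M'" for \<eta>
      by (rule chart_open_image[OF c Cr_maps_preimage_open[OF that chart_openin[OF c] chart_openin[OF c']]]) simp
    have Dk: "Ck_on (Suc 0) V (local_rep c \<eta> c') (snd c ` (fst c \<inter> \<eta> -` fst c'))" if "\<eta> \<in> Cr_maps r M M'" for \<eta>
      by (rule Cr_maps_local_rep[OF that F_atlas[OF cF] F'_atlas[OF c'F] r1])
    let ?D = "snd c ` (fst c \<inter> \<psi> -` fst c')"
    have ZD: "cball z \<rho> \<inter> V \<subseteq> ?D" unfolding Kc(1)[symmetric] using Kc(2) KW by blast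
    have so: "secs_open V ((UNIV::real set) \<times> ?D)" by (rule secs_open_Times[OF Dop[OF \<psi>C]])
    have f1: "Ck_on (Suc 0) V (?f \<psi>) ?D"
    proof (rule pCk_imp_Ck_on)
      show "pCk (Suc 0) V (\<lambda>_::real. ?f \<psi>) (UNIV \<times> ?D)"
        by (rule pCk_linear[OF V so linear_snd Ck_on_imp_pCk[OF Dk[OF \<psi>C] openin_imp_subset[OF Dop[OF \<psi>C]]]]) auto
    qed simp
    have reg: "\<forall>y\<in>cball z \<rho> \<inter> V. regular_at E V (?f \<psi>) y"
    proof
      fix y assume "y \<in> cball z \<rho> \<inter> V"
      then have "y \<in> snd c ` K" using Kc(1) by simp
      then obtain x where x: "x \<in> K" "y = snd c x" by blast
      then show "regular_at E V (?f \<psi>) y"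
        using transverse_iff[OF \<psi> cF _ W, of x] tr[OF True x(1)] Kc(2) KW by auto
    qed
    obtain \<epsilon> where \<epsilon>: "\<epsilon> > 0" "\<forall>h y. y \<in> cball z \<rho> \<inter> V \<longrightarrow> h differentiable (at y within V) \<longrightarrow>
      norm (h y - ?f \<psi> y) < \<epsilon> \<longrightarrow> (\<forall>u. u \<in> V \<longrightarrow> norm u \<le> 1 \<longrightarrow>
        norm (frechet_derivative h (at y within V) u - frechet_derivative (?f \<psi>) (at y within V) u) < \<epsilon>) \<longrightarrow>
      regular_at E V h y"
      using regular_at_stable[OF V E Dop[OF \<psi>C] Kc(4) ZD f1 reg] by (elim exE conjE)
    let ?N = "sp_nbhd s M F M' F' \<psi> {0} (\<lambda>_. c) (\<lambda>_. c') (\<lambda>_. K) (\<lambda>_. \<epsilon>)"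
    have N: "openin Sp (Maps \<inter> ?N)" "\<psi> \<in> Maps \<inter> ?N"
      by (rule single_nbhd_open[OF \<psi> cF c'F Kc(3,2) KW \<epsilon>(1) s(1,3)])+
    have "Maps \<inter> ?N \<subseteq> transverse_set K W"
    proof
      fix \<eta> assume "\<eta> \<in> Maps \<inter> ?N"
      then have \<eta>: "\<eta> \<in> Maps" "\<eta> ` K \<subseteq> fst c'"
        "\<And>x k. x \<in> K \<Longrightarrow> k \<le> s \<Longrightarrow> Dk_dist k V (local_rep c \<eta> c') (local_rep c \<psi> c') (snd c x) < \<epsilon>"
        unfolding sp_nbhd_def by auto
      have \<eta>C: "\<eta> \<in> Cr_maps r M M'" by (rule foliation_maps_Cr[OF \<eta>(1)])
      have "transverse_at M M' \<eta> A x" if x: "x \<in> K" for x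
      proof -
        have xc: "x \<in> fst c" and \<eta>x: "\<eta> x \<in> fst c'" using x Kc \<eta>(2) by blast+
        have zx: "snd c x \<in> cball z \<rho> \<inter> V" using x Kc(1) by blast
        have zD: "snd c x \<in> snd c ` (fst c \<inter> \<eta> -` fst c')" using xc \<eta>x by blast
        have zV: "snd c x \<in> V" using zx by blast
        have d\<eta>: "(local_rep c \<eta> c' has_derivative frechet_derivative (local_rep c \<eta> c') (at (snd c x) within V)) (at (snd c x) within V)"
          using Dk[OF \<eta>C] zD unfolding Ck_on.simps frechet_derivative_works by blast
        have d\<psi>: "(local_rep c \<psi> c' has_derivative frechet_derivative (local_rep c \<psi> c') (at (snd c x) within V)) (at (snd c x) within V)"
          using Dk[OF \<psi>C] zx ZD unfolding Ck_on.simps frechet_derivative_works by blast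
        have snd_le: "norm (snd y - snd y') \<le> norm (y - y')" for y y' :: "'u \<times> 'd"
          by (metis norm_snd_le prod.collapse snd_diff)
        have "regular_at E V (?f \<eta>) (snd c x)"
        proof (rule \<epsilon>(2)[rule_format, OF zx])
          show "?f \<eta> differentiable (at (snd c x) within V)"
            by (rule differentiableI[OF bounded_linear.has_derivative[OF bounded_linear_snd d\<eta>]])
          have "norm (local_rep c \<eta> c' (snd c x) - local_rep c \<psi> c' (snd c x)) < \<epsilon>"
            using \<eta>(3)[OF x, of 0] by (simp add: Dk_dist_0)
          then show "norm (?f \<eta> (snd c x) - ?f \<psi> (snd c x)) < \<epsilon>" using snd_le order_le_less_trans by blast
          fix u assume u: "u \<in> V" "norm u \<le> 1"
          have "norm (iter_deriv V [u] (local_rep c \<eta> c') (snd c x) - iter_deriv V [u] (local_rep c \<psi> c') (snd c x)) \<le>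
              Dk_dist (Suc 0) V (local_rep c \<eta> c') (local_rep c \<psi> c') (snd c x)"
            by (rule Dk_dist_upper[OF V _ _ Dop[OF \<eta>C] Dk[OF \<eta>C] zD Dop[OF \<psi>C] Dk[OF \<psi>C]])
              (use u zx ZD in auto)
          also have "\<dots> < \<epsilon>" using \<eta>(3)[OF x, of "Suc 0"] s(2) by simp
          finally have "norm (frechet_derivative (local_rep c \<eta> c') (at (snd c x) within V) u -
              frechet_derivative (local_rep c \<psi> c') (at (snd c x) within V) u) < \<epsilon>" by simp
          moreover have "frechet_derivative (?f \<eta>) (at (snd c x) within V) u =
              snd (frechet_derivative (local_rep c \<eta> c') (at (snd c x) within V) u)"
            by (rule frechet_derivative_eq[OF V bounded_linear.has_derivative[OF bounded_linear_snd d\<eta>] zV u(1)])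
          moreover have "frechet_derivative (?f \<psi>) (at (snd c x) within V) u =
              snd (frechet_derivative (local_rep c \<psi> c') (at (snd c x) within V) u)"
            by (rule frechet_derivative_eq[OF V bounded_linear.has_derivative[OF bounded_linear_snd d\<psi>] zV u(1)])
          ultimately show "norm (frechet_derivative (?f \<eta>) (at (snd c x) within V) u -
              frechet_derivative (?f \<psi>) (at (snd c x) within V) u) < \<epsilon>"
            using snd_le by (simp only:) (rule order_le_less_trans)
        qed
        then show ?thesis using transverse_iff[OF \<eta>(1) cF xc W \<eta>x] by simp
      qed
      then show "\<eta> \<in> transverse_set K W" using \<eta>(1) unfolding transverse_set_def by blast
    qed
    with N show ?thesis by (intro exI[of _ "Maps \<inter> ?N"] conjI)
  qed
qed

end

section \<open>Density\<close>

text \<open>As the parameter is never differentiated, continuity of h is enough.\<close>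

lemma pCk_reparam:
  fixes f :: "'q::metric_space \<Rightarrow> 'e::euclidean_space \<Rightarrow> 'd::euclidean_space" and h :: "'p::metric_space \<Rightarrow> 'q"
  assumes h: "continuous_on UNIV h" and "pCk k V f T" and T': "\<And>p x. (p, x) \<in> T' \<Longrightarrow> (h p, x) \<in> T"
  shows "pCk k V (\<lambda>p. f (h p)) T'"
  using assms(2)
proof (induction k arbitrary: f)
  case 0
  have "continuous_on T' (\<lambda>y. (h (fst y), snd y))"
    by (intro continuous_on_Pair continuous_on_compose2[OF h continuous_on_fst[OF continuous_on_id]]
        continuous_on_snd continuous_on_id) auto
  then have "continuous_on T' ((\<lambda>z. f (fst z) (snd z)) \<circ> (\<lambda>y. (h (fst y), snd y)))"
    by (rule continuous_on_compose) (rule continuous_on_subset[OF pCk_continuous[OF 0]], use T' in auto)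
  then show ?case by (simp add: o_def)
next
  case (Suc k)
  have "pCk k V (\<lambda>p. f (h p)) T'" by (rule Suc.IH[OF pCk_SucD[OF Suc.prems]])
  then have "continuous_on T' (\<lambda>z. f (h (fst z)) (snd z))" by (rule pCk_continuous)
  moreover have "f (h (fst z)) differentiable (at (snd z) within V)" if "z \<in> T'" for z
    using Suc.prems T'[of "fst z" "snd z"] that by auto
  moreover have "pCk k V (\<lambda>p x. frechet_derivative (f (h p)) (at x within V) v) T'" if "v \<in> V" for v
    using Suc.IH[of "\<lambda>p x. frechet_derivative (f p) (at x within V) v"] Suc.prems that by simp
  ultimately show ?case unfolding pCk.simps(2) by blast
qed

lemma eventually_compact_section:
  fixes V :: "'e::euclidean_space set" and T :: "('p::metric_space \<times> 'e) set"
  assumes Z: "compact Z" "Z \<subseteq> V" and T: "openin (top_of_set (UNIV \<times> V)) T" and sub: "\<And>z. z \<in> Z \<Longrightarrow> (p0, z) \<in> T"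
  shows "eventually (\<lambda>p. \<forall>z\<in>Z. (p, z) \<in> T) (nhds p0)"
proof (rule compact_tube[OF Z(1)])
  fix z0 assume "z0 \<in> Z"
  then have "eventually (\<lambda>y. snd y \<in> V \<longrightarrow> y \<in> T) (nhds (p0, z0))"
    by (intro eventually_nhds_openin[OF T] sub)
  then obtain Pf Pg where P: "eventually Pf (nhds p0)" "eventually Pg (nhds z0)"
    "\<And>p z. Pf p \<Longrightarrow> Pg z \<Longrightarrow> z \<in> V \<longrightarrow> (p, z) \<in> T"
    unfolding nhds_prod eventually_prod_filter by auto
  from P(2) obtain B where B: "open B" "z0 \<in> B" "\<forall>z\<in>B. Pg z" unfolding eventually_nhds by blast
  have "eventually (\<lambda>p. \<forall>z\<in>B \<inter> Z. (p, z) \<in> T) (nhds p0)"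
    using P(1) by (rule eventually_mono) (use P(3) B(3) Z(2) in blast)
  with B show "\<exists>B. open B \<and> z0 \<in> B \<and> eventually (\<lambda>p. \<forall>z\<in>B \<inter> Z. (p, z) \<in> T) (nhds p0)"
    by (intro exI[of _ B] conjI)
qed

text \<open>A compact set keeps a uniform distance e from the complement of an open set containing
  it. A point of V slightly outside the ball is compared with its radial projection x to the sphere
  of radius \<rho>, which lies in V because the centre does.\<close>

lemma cball_enlarge:
  fixes z :: "'e::euclidean_space"
  assumes V: "subspace V" and z: "z \<in> V" and \<rho>: "0 < \<rho>" and D: "openin (top_of_set V) D" and sub: "cball z \<rho> \<inter> V \<subseteq> D"
  obtains R where "\<rho> < R" "cball z R \<inter> V \<subseteq> D"
proof -
  obtain G where G: "open G" "D = V \<inter> G" using D by (auto simp: openin_open)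
  have "compact (cball z \<rho> \<inter> V)" by (intro compact_Int_closed compact_cball closed_subspace[OF V])
  then obtain e where e: "e > 0" "(\<Union>x\<in>cball z \<rho> \<inter> V. ball x e) \<subseteq> G"
    using compact_subset_open_imp_ball_epsilon_subset[of "cball z \<rho> \<inter> V" G] G sub by blast
  show thesis
  proof (rule that[of "\<rho> + e / 2"])
    show "cball z (\<rho> + e / 2) \<inter> V \<subseteq> D"
    proof
      fix y assume y: "y \<in> cball z (\<rho> + e / 2) \<inter> V"
      show "y \<in> D"
      proof (cases "dist z y \<le> \<rho>")
        case True
        then show ?thesis using y sub by auto
      next
        case False
        define n where "n = norm (y - z)"
        have n: "\<rho> < n" "n \<le> \<rho> + e / 2" using False y by (simp_all add: n_def dist_norm norm_minus_commute)
        define x where "x = z + (\<rho> / n) *\<^sub>R (y - z)"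
        have "x \<in> V" unfolding x_def using z y V by (intro subspace_add subspace_scale subspace_diff) auto
        moreover have "norm (x - z) = \<rho>" using n \<rho> by (simp add: x_def n_def[symmetric])
        moreover have "y - x = (1 - \<rho> / n) *\<^sub>R (y - z)" by (simp add: x_def algebra_simps)
        then have "norm (y - x) = (1 - \<rho> / n) * n" using n \<rho> by (simp add: n_def[symmetric] abs_if)
        then have "norm (y - x) = n - \<rho>" using n \<rho> by (simp add: algebra_simps)
        ultimately have "x \<in> cball z \<rho> \<inter> V" "y \<in> ball x e"
          using n e(1) by (auto simp: dist_norm norm_minus_commute)
        then have "y \<in> G" using e(2) by blast
        then show ?thesis using y G(2) by simp
      qed
    qed
  qed (use e(1) in simp)
qed

lemma linear_rows_apply: "linear (rows_apply L)"
  by (rule linearI) (simp_all add: rows_apply_def inner_add_right scaleR_add_left sum.distrib scaleR_sum_right)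

lemma rows_apply_0 [simp]: "rows_apply 0 x = 0"
  by (simp add: rows_apply_def)

context transverse_setting
begin

text \<open>
  Inside the compact ball the perturbed map is \<open>g \<epsilon> + L + v\<close> modulo the orthogonal complement of
  \<open>E\<close>, with \<open>g \<epsilon>\<close> of class C^2; for almost all \<open>(L, v)\<close> it is regular.
\<close>

lemma perturb_to_transverse:
  assumes \<phi>: "\<phi> \<in> Maps" and K: "compact_ball c z \<rho> K" and W: "adapted_compact c' E W" and KW: "\<phi> ` K \<subseteq> W"
    and G: "openin Sp G" "\<phi> \<in> G"
  shows "\<exists>\<psi>\<in>G. \<psi> \<in> transverse_set K W"
proof -
  have \<phi>C: "\<phi> \<in> Cr_maps r M M'" by (rule foliation_maps_Cr[OF \<phi>])
  have cF: "c \<in> F" and zV: "z \<in> V" and \<rho>: "0 < \<rho>" using K by (simp_all add: compact_ball_def)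
  have c: "is_chart M c" by (rule F_chart[OF cF])
  have c'F: "c' \<in> F'" and E: "subspace E" and EV': "E \<subseteq> snd ` V'" using W by (simp_all add: adapted_compact_def)
  have c': "is_chart M' c'" by (rule F'_chart[OF c'F])
  note Kc = compact_ball_image[OF K]
  let ?Dom = "fst c \<inter> \<phi> -` fst c'"
  let ?D = "snd c ` ?Dom"
  have D: "openin (top_of_set V) ?D"
    by (rule chart_open_image[OF c Cr_maps_preimage_open[OF \<phi>C chart_openin[OF c] chart_openin[OF c']]]) simp
  have "W \<subseteq> fst c'" using W by (simp add: adapted_compact_def)
  then have KDom: "K \<subseteq> ?Dom" using Kc(2) KW by blast
  have sub: "cball z \<rho> \<inter> V \<subseteq> ?D" unfolding Kc(1)[symmetric] using KDom by (rule image_mono)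
  obtain R where R: "\<rho> < R" "cball z R \<inter> V \<subseteq> ?D" by (rule cball_enlarge[OF V zV \<rho> D sub])
  \<comment> \<open>Equally spaced radii \<rho> < a < b < \<rho>2 < R: the bump is 1 up to a and 0
    from b on, the smoothing is defined up to \<rho>2, and f up to R. Because \<rho> < a, the
    perturbed map is known on a neighbourhood of each point of the compact ball, hence its
    derivatives are known as well.\<close>
  define h where "h = (R - \<rho>) / 4"
  define a where "a = \<rho> + h"
  define b where "b = \<rho> + 2 * h"
  define \<rho>2 where "\<rho>2 = \<rho> + 3 * h"
  have rad: "0 \<le> a" "\<rho> < a" "a < b" "b < \<rho>2" "0 < \<rho>2" "\<rho>2 < R" "0 \<le> b"
    using R(1) \<rho> by (simp_all add: a_def b_def \<rho>2_def h_def field_simps)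
  let ?B = "ball z \<rho>2 \<inter> V"
  have B: "openin (top_of_set V) ?B" by (simp add: Int_commute openin_open_Int)
  have BD: "?B \<subseteq> ?D" using R(2) rad(6) by auto
  let ?rep = "local_rep c \<phi> c'"
  define f where "f y = snd (?rep y)" for y
  have repk: "pCk k V (\<lambda>_::real \<times> (('t \<times> 'b) ^ 'd basis_index) \<times> 'd. ?rep) (UNIV \<times> ?D)" if "enat k \<le> r" for k
    by (rule Ck_on_imp_pCk[OF Cr_maps_local_rep[OF \<phi>C F_atlas[OF cF] F'_atlas[OF c'F] that] openin_imp_subset[OF D]]) auto
  have fk: "pCk k V (\<lambda>_::real \<times> (('t \<times> 'b) ^ 'd basis_index) \<times> 'd. f) (UNIV \<times> ?D)" if "enat k \<le> r" for k
    unfolding f_def by (rule pCk_linear[OF V secs_open_Times[OF D] linear_snd repk[OF that]])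
  have "Cr_on r V f ?D"
    unfolding Cr_on_def using pCk_imp_Ck_on[OF fk] by simp
  then obtain g where gk: "\<And>k. enat k \<le> r \<Longrightarrow> pCk k V g ((UNIV::real set) \<times> ?B)"
    and g0: "\<And>x. x \<in> ?B \<Longrightarrow> g 0 x = f x" and g2: "\<And>\<epsilon>. \<epsilon> \<noteq> 0 \<Longrightarrow> Ck_on (Suc (Suc 0)) V (g \<epsilon>) ?B"
    using Cr_smoothing_family[OF V D rad(5,6) R(2) r] by metis
  let ?Z = "cball z b \<inter> V"
  have Z: "compact ?Z" by (intro compact_Int_closed compact_cball closed_subspace[OF V])
  have ZB: "?Z \<subseteq> ?B" using rad(4) by auto
  \<comment> \<open>Where the bump is 1, this moves the E-component of f to that of g + L + v and
    leaves the other components alone. The case distinction makes q vanish off \<open>?Z\<close>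
    also at points outside V, where the bump need not vanish and \<open>g 0\<close> need not be
    f.\<close>
  define q where "q p x = (if x \<in> ?Z then bump z a b x *\<^sub>R
      oproj E (g (fst p) x - f x + (rows_apply (fst (snd p)) x + snd (snd p))) else 0)"
    for p :: "real \<times> (('t \<times> 'b) ^ 'd basis_index) \<times> 'd" and x
  let ?p0 = "(0, 0, 0) :: real \<times> (('t \<times> 'b) ^ 'd basis_index) \<times> 'd"
  have q0: "q ?p0 x = 0" for x
    using g0[of x] ZB linear_0[OF linear_oproj[OF E]] by (auto simp: q_def)
  have qE: "q p x \<in> E" for p x
    unfolding q_def using oproj_in[OF E] subspace_scale[OF E] subspace_0[OF E] by auto
  have qk: "pCk k V q (UNIV \<times> ?D)" if k: "enat k \<le> r" for k
  proof (rule pCk_local)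
    fix y assume y: "y \<in> (UNIV :: (real \<times> (('t \<times> 'b) ^ 'd basis_index) \<times> 'd) set) \<times> ?D"
    let ?TB = "(UNIV :: (real \<times> (('t \<times> 'b) ^ 'd basis_index) \<times> 'd) set) \<times> ?B"
    let ?D' = "?D \<inter> - cball z b"
    let ?TD = "(UNIV :: (real \<times> (('t \<times> 'b) ^ 'd basis_index) \<times> 'd) set) \<times> ?D'"
    have so: "secs_open V ?TB" by (rule secs_open_Times[OF B])
    have D': "openin (top_of_set V) ?D'" by (intro openin_Int_open D open_Compl closed_cball)
    have soD: "secs_open V ?TD" by (rule secs_open_Times[OF D'])
    have "pCk k V (\<lambda>p. g (fst p)) ?TB"
      by (rule pCk_reparam[OF continuous_on_fst[OF continuous_on_id] gk[OF k]]) auto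
    moreover have "pCk k V (\<lambda>_. f) ?TB" by (rule pCk_subset[OF fk[OF k]]) (use BD in auto)
    moreover have "pCk k V (\<lambda>p. rows_apply (fst (snd p))) ?TB"
      unfolding rows_apply_def
      by (intro pCk_sum pCk_scaleR pCk_inner pCk_ident pCk_const pCk_param V so)
        (auto intro!: continuous_intros)
    moreover have "pCk k V (\<lambda>p x. snd (snd p)) ?TB"
      by (rule pCk_param[OF V so]) (auto intro!: continuous_intros)
    ultimately have "pCk k V (\<lambda>p x. g (fst p) x - f x + (rows_apply (fst (snd p)) x + snd (snd p))) ?TB"
      by (intro pCk_add pCk_diff V so)
    then have 1: "pCk k V (\<lambda>p x. bump z a b x *\<^sub>R
        oproj E (g (fst p) x - f x + (rows_apply (fst (snd p)) x + snd (snd p)))) ?TB"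
      by (intro pCk_scaleR pCk_bump pCk_linear[OF V so linear_oproj[OF E]] V so rad)
    \<comment> \<open>The open pieces are \<open>?B\<close>, where the formula for q remains valid
      beyond radius b since the bump is 0 there, and the part of the domain outside
      \<open>cball z b\<close>, where q is 0.\<close>
    have qB: "pCk k V q ?TB"
    proof (rule pCk_cong[OF V so 1])
      fix y assume "y \<in> ?TB"
      then show "bump z a b (snd y) *\<^sub>R oproj E (g (fst (fst y)) (snd y) - f (snd y) +
          (rows_apply (fst (snd (fst y))) (snd y) + snd (snd (fst y)))) = q (fst y) (snd y)"
        using bump_eq_0[OF rad(7), of "snd y" z a] by (auto simp: q_def dist_commute)
    qed
    have qD: "pCk k V q ?TD"
      by (rule pCk_cong[OF V soD pCk_const[OF V soD, of k 0]]) (auto simp: q_def)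
    have T: "?TB \<subseteq> UNIV \<times> ?D" using BD by auto
    have UD: "UNIV \<times> ?D \<subseteq> UNIV \<times> V" using openin_imp_subset[OF D] by auto
    show "\<exists>T'. y \<in> T' \<and> openin (top_of_set (UNIV \<times> ?D)) T' \<and> pCk k V q T'"
    proof (cases "snd y \<in> cball z b")
      case True
      then have "y \<in> ?TB" using y openin_imp_subset[OF D] rad(4) by (cases y) auto
      moreover have "openin (top_of_set (UNIV \<times> ?D)) ?TB"
        by (rule openin_Times) (use openin_subset_trans[OF B BD openin_imp_subset[OF D]] in auto)
      ultimately show ?thesis using qB by (intro exI[of _ ?TB] conjI)
    next
      case False
      then have "y \<in> ?TD" using y by (cases y) auto
      moreover have "openin (top_of_set (UNIV \<times> ?D)) ?TD"
        by (rule openin_Times) (use openin_open_Int[OF open_Compl[OF closed_cball]] in auto)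
      ultimately show ?thesis using qD by (intro exI[of _ ?TD] conjI)
    qed
  qed
  have so: "secs_open V ((UNIV :: (real \<times> (('t \<times> 'b) ^ 'd basis_index) \<times> 'd) set) \<times> ?D)" by (rule secs_open_Times[OF D])
  obtain Q P where Q: "subspace Q" and QP: "V' = Q \<times> P"
    using Cr_foliation_model[OF fol'] by blast
  have EP: "e \<in> E \<Longrightarrow> (0, e) \<in> V'" for e using EV' QP subspace_0[OF Q] by (auto split: if_splits)
  have "enat 0 \<le> r" by (simp add: zero_enat_def[symmetric])
  note k0 = this
  have lp: "linear (\<lambda>b::'d. (0::'u, b))" by (rule linearI) simp_all
  have "pCk 0 V (\<lambda>p x. ?rep x + (0, q p x)) (UNIV \<times> ?D)"
    by (rule pCk_add[OF V so repk[OF k0] pCk_linear[OF V so lp qk[OF k0]]])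
  then have cont: "continuous_on (UNIV \<times> ?D) (\<lambda>y. ?rep (snd y) + (0, q (fst y) (snd y)))"
    by (rule pCk_continuous)
  have repD: "?rep (snd c x) = snd c' (\<phi> x)" if "x \<in> ?Dom" for x using that by (simp add: local_rep_chart[OF c])
  have maps: "(\<lambda>y. ?rep (snd y) + (0, q (fst y) (snd y))) \<in> UNIV \<times> ?D \<rightarrow> V'"
  proof
    fix y assume "y \<in> (UNIV :: (real \<times> (('t \<times> 'b) ^ 'd basis_index) \<times> 'd) set) \<times> ?D"
    then obtain x where x: "x \<in> ?Dom" "snd y = snd c x" by auto
    then have "?rep (snd y) \<in> V'" using chart_in_model[OF c', of "\<phi> x"] repD[OF x(1)] by simp
    then show "?rep (snd y) + (0, q (fst y) (snd y)) \<in> V'" by (rule subspace_add[OF V' _ EP[OF qE]])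
  qed
  \<comment> \<open>The pairs (p, x) whose displaced point remains in the image of
    \<open>c'\<close>. The set is open and contains all (?p0, x) with x in the compact
    \<open>?Z\<close>, so one neighbourhood P0 of \<open>?p0\<close> serves all these x; off
    \<open>?Z\<close> nothing is displaced.\<close>
  let ?T = "(UNIV \<times> ?D) \<inter> (\<lambda>y. ?rep (snd y) + (0, q (fst y) (snd y))) -` (snd c' ` fst c')"
  have "openin (top_of_set (UNIV \<times> ?D)) ?T"
    by (rule continuous_openin_preimage[OF cont maps chart_image_openin[OF c']])
  moreover have "openin (top_of_set (UNIV \<times> V)) ((UNIV :: (real \<times> (('t \<times> 'b) ^ 'd basis_index) \<times> 'd) set) \<times> ?D)"
    by (rule openin_Times[OF _ D]) simp
  ultimately have T: "openin (top_of_set (UNIV \<times> V)) ?T" by (rule openin_trans)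
  have "eventually (\<lambda>p. \<forall>x\<in>?Z. (p, x) \<in> ?T) (nhds ?p0)"
  proof (rule eventually_compact_section[OF Z Int_lower2 T])
    fix x assume "x \<in> ?Z"
    then have "x \<in> ?D" using ZB BD by blast
    then obtain w where "w \<in> ?Dom" "x = snd c w" by blast
    then show "(?p0, x) \<in> ?T" using repD[of w] q0 by (auto simp: zero_prod_def[symmetric])
  qed
  then obtain P0 where P0: "open P0" "?p0 \<in> P0" "\<And>p. p \<in> P0 \<Longrightarrow> \<forall>x\<in>?Z. (p, x) \<in> ?T"
    unfolding eventually_nhds by blast
  have P0': "?rep x + (0, q p x) \<in> snd c' ` fst c'" if p: "p \<in> P0" and x: "x \<in> ?D" for p x
  proof (cases "x \<in> ?Z")
    case True
    then show ?thesis using P0(3)[OF p] by auto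
  next
    case False
    then have "q p x = 0" by (auto simp: q_def)
    then show ?thesis using x repD by (auto simp: zero_prod_def[symmetric])
  qed
  have pert: "perturbation r M F M' F' \<phi> c c' ?Z q ?p0 P0"
  proof
    show "?Z \<subseteq> ?D" using ZB BD by (rule order_trans)
    show "q p x = 0" if "x \<notin> ?Z" for p x using that by (simp only: q_def if_False)
  qed (fact fol fol' \<phi> cF c'F Z q0 qk P0(1) P0(2) P0')+
  interpret P: perturbation r M F M' F' \<phi> c c' ?Z q ?p0 P0 by (rule pert)
  have "eventually (\<lambda>p. p \<in> P0 \<and> P.Psi p \<in> G) (nhds ?p0)"
    using eventually_nhds_in_open[OF P0(1,2)] P.eventually_sp_open[OF G] by (rule eventually_conj)
  then obtain \<delta> where \<delta>: "\<delta> > 0" "\<And>p. dist p ?p0 < \<delta> \<Longrightarrow> p \<in> P0 \<and> P.Psi p \<in> G"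
    unfolding eventually_nhds_metric by blast
  \<comment> \<open>The smoothing parameter must be nonzero for \<open>g \<epsilon>\<close> to be
    C^2. With (L, v) of norm less than \<epsilon>, the parameter (\<epsilon>, L, v) has norm less
    than 2 \<epsilon>, hence less than \<delta>.\<close>
  define \<epsilon> where "\<epsilon> = \<delta> / 3"
  have \<epsilon>: "\<epsilon> > 0" "\<epsilon> + \<epsilon> < \<delta>" using \<delta>(1) by (simp_all add: \<epsilon>_def)
  let ?Bad = "{(L, v). \<exists>x\<in>?B. (\<forall>w\<in>E. (g \<epsilon> x + (rows_apply L x + v)) \<bullet> w = 0) \<and>
    (\<exists>w\<in>E. w \<noteq> 0 \<and> (\<forall>u\<in>V. (frechet_derivative (g \<epsilon>) (at x within V) u + rows_apply L u) \<bullet> w = 0))}"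
  have g2\<epsilon>: "Ck_on (Suc (Suc 0)) V (g \<epsilon>) ?B" using g2 \<epsilon>(1) by simp
  have neg: "negligible ?Bad" by (rule negligible_irregular_affine[OF V E Int_lower2 g2\<epsilon>])
  have "\<not> negligible (ball 0 \<epsilon> :: ((('t \<times> 'b) ^ 'd basis_index) \<times> 'd) set)"
    by (rule open_not_negligible[OF open_ball]) (use \<epsilon>(1) in simp)
  then have "\<not> ball 0 \<epsilon> \<subseteq> ?Bad" using negligible_subset[OF neg] by blast
  then obtain y where y: "y \<in> ball 0 \<epsilon>" "y \<notin> ?Bad" by blast
  obtain L v where yLv: "y = (L, v)" by (cases y)
  note Lv = y[unfolded yLv]
  note good = Lv(2)[unfolded mem_Collect_eq case_prod_conv]
  define p where "p = (\<epsilon>, L, v)"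
  have "norm p \<le> norm \<epsilon> + norm (L, v)" unfolding p_def by (rule norm_Pair_le)
  also have "\<dots> < \<delta>" using Lv(1) \<epsilon> by simp
  finally have "dist p ?p0 < \<delta>" by (simp add: dist_norm zero_prod_def[symmetric])
  from \<delta>(2)[OF this] have pP0: "p \<in> P0" and pG: "P.Psi p \<in> G" by auto
  have \<psi>: "P.Psi p \<in> Maps" by (rule P.Psi_foliation_maps[OF pP0])
  have "transverse_at M M' (P.Psi p) A x" if x: "x \<in> K" for x
  proof -
    let ?F = "\<lambda>y. snd (local_rep c (P.Psi p) c' y)"
    define y where "y = snd c x"
    have xDom: "x \<in> P.Dom" using x KDom by (auto simp: P.Dom_def)
    have yK: "y \<in> cball z \<rho> \<inter> V" unfolding y_def using x Kc(1) by blast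
    have yB: "y \<in> ?B" and yV: "y \<in> V" using yK rad by auto
    have near: "?F y' \<bullet> w = (g \<epsilon> y' + (rows_apply L y' + v)) \<bullet> w"
      if y': "y' \<in> ball z a \<inter> V" and w: "w \<in> E" for y' w
    proof -
      have y'Z: "y' \<in> ?Z" and b1: "bump z a b y' = 1"
        using y' rad bump_eq_1[OF rad(1,3), of y' z] by (auto simp: dist_commute)
      then have "y' \<in> ?D" using ZB BD by blast
      then obtain x' where x': "x' \<in> P.Dom" "y' = snd c x'" unfolding P.Dom_def by blast
      have "local_rep c (P.Psi p) c' y' = snd c' (P.Psi p x')"
        using x' by (simp add: local_rep_chart[OF c] P.Dom_def)
      also have "\<dots> = ?rep y' + (0, q p y')"
        using P.Psi_chart(2)[OF pP0 x'(1)] repD[of x'] x' by (simp add: P.Dom_def)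
      finally have "?F y' = f y' + q p y'" by (simp add: f_def)
      also have "q p y' = oproj E (g \<epsilon> y' - f y' + (rows_apply L y' + v))"
        using y'Z b1 by (simp add: q_def p_def)
      finally have "?F y' \<bullet> w = f y' \<bullet> w + (g \<epsilon> y' - f y' + (rows_apply L y' + v)) \<bullet> w"
        using oproj_inner[OF E w] by (simp add: inner_add_left)
      then show ?thesis by (simp add: inner_add_left inner_diff_left)
    qed
    have ya: "y \<in> ball z a \<inter> V" using yK rad(2) by auto
    have oa: "openin (top_of_set V) (ball z a \<inter> V)" by (simp add: Int_commute openin_open_Int)
    have cc: "c \<in> charts_at M x" and cc': "c' \<in> charts_at M' (P.Psi p x)"
      using xDom P.Psi_chart(1)[OF pP0 xDom] F_atlas[OF cF] F'_atlas[OF c'F]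
      by (simp_all add: charts_at_def P.Dom_def)
    have Fd: "(?F has_derivative frechet_derivative ?F (at y within V)) (at y within V)"
      using differentiableI[OF bounded_linear.has_derivative[OF bounded_linear_snd
          local_rep_derivative[OF r foliation_maps_Cr[OF \<psi>] cc cc']]]
      unfolding frechet_derivative_works y_def .
    have gd: "(g \<epsilon> has_derivative frechet_derivative (g \<epsilon>) (at y within V)) (at y within V)"
      using g2\<epsilon> yB unfolding Ck_on.simps frechet_derivative_works by blast
    have deriv: "frechet_derivative ?F (at y within V) u \<bullet> w =
        (frechet_derivative (g \<epsilon>) (at y within V) u + rows_apply L u) \<bullet> w" if w: "w \<in> E" and u: "u \<in> V" for w u
    proof -
      have bl: "bounded_linear (rows_apply L)" using linear_rows_apply linear_conv_bounded_linear by blast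
      have "((\<lambda>y. (g \<epsilon> y + (rows_apply L y + v)) \<bullet> w) has_derivative
          (\<lambda>u. (frechet_derivative (g \<epsilon>) (at y within V) u + (rows_apply L u + 0)) \<bullet> w)) (at y within V)"
        by (intro has_derivative_inner_left has_derivative_add gd has_derivative_const
            bounded_linear_imp_has_derivative[OF bl])
      moreover have "((\<lambda>y. (g \<epsilon> y + (rows_apply L y + v)) \<bullet> w) has_derivative D) (at y within V) =
          ((\<lambda>y. ?F y \<bullet> w) has_derivative D) (at y within V)" for D
        by (rule has_derivative_cong_section[OF V secs_open_Times[OF oa, of "UNIV::real set"], of 0])
          (use ya near[OF _ w] in auto)
      ultimately have "((\<lambda>y. ?F y \<bullet> w) has_derivative
          (\<lambda>u. (frechet_derivative (g \<epsilon>) (at y within V) u + (rows_apply L u + 0)) \<bullet> w)) (at y within V)" by simp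
      from frechet_unique_subspace[OF V has_derivative_inner_left[OF Fd] this yV u] show ?thesis by simp
    qed
    have "regular_at E V ?F y"
      unfolding regular_at_def
    proof (intro impI ballI)
      fix w assume 0: "\<forall>w\<in>E. ?F y \<bullet> w = 0" and w: "w \<in> E" "w \<noteq> 0"
      then have "\<forall>w\<in>E. (g \<epsilon> y + (rows_apply L y + v)) \<bullet> w = 0" using near[OF ya] by simp
      then have "\<not> (\<forall>u\<in>V. (frechet_derivative (g \<epsilon>) (at y within V) u + rows_apply L u) \<bullet> w = 0)"
        using good yB w by blast
      then show "\<exists>u\<in>V. frechet_derivative ?F (at y within V) u \<bullet> w \<noteq> 0" using deriv[OF w(1)] by auto
    qed
    then show ?thesis
      using transverse_iff[OF \<psi> cF _ W P.Psi_chart(1)[OF pP0 xDom]] xDom by (simp add: y_def P.Dom_def)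
  qed
  then have "P.Psi p \<in> transverse_set K W" using \<psi> by (simp add: transverse_set_def)
  then show ?thesis using pG by blast
qed

section \<open>Residuality from countably many dense open sets\<close>

lemma topspace_Sp: "topspace Sp = Maps"
proof
  obtain s where s: "r = enat s \<or> r = \<infinity>" "1 \<le> s" "enat s \<le> r" by (rule class_cases)
  show "Maps \<subseteq> topspace Sp"
  proof
    fix \<phi> assume \<phi>: "\<phi> \<in> Maps"
    then have \<phi>s: "\<phi> \<in> foliation_maps (enat s) M F M' F'" using foliation_maps_mono[OF s(3)] by blast
    \<comment> \<open>With no index there is no condition, so this subbasic set contains all of
      \<open>Maps\<close>.\<close>
    let ?N = "sp_nbhd s M F M' F' \<phi> {} undefined undefined undefined undefined"
    have "?N \<in> sp_base s M F M' F'"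
      unfolding sp_base_def
      by (rule CollectI, rule exI[of _ \<phi>], rule exI[of _ "{}"], rule exI[of _ undefined], rule exI[of _ undefined],
          rule exI[of _ undefined], rule exI[of _ undefined]) (use \<phi>s openin_topspace in auto)
    then have "openin Sp (Maps \<inter> ?N)" by (rule sp_subbasis[OF s(1)])
    moreover have "\<phi> \<in> Maps \<inter> ?N" using \<phi> \<phi>s by (simp add: sp_nbhd_def)
    ultimately show "\<phi> \<in> topspace Sp" using openin_subset by blast
  qed
  have N: "N \<subseteq> foliation_maps (enat s) M F M' F'" if "N \<in> sp_base s M F M' F'" for s N
    using that unfolding sp_base_def sp_nbhd_def by auto
  show "topspace Sp \<subseteq> Maps"
  proof (cases r)
    case (enat s)
    then show ?thesis unfolding sp_topology_def by (simp add: topology_generated_by_topspace) (use N in blast)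
  next
    case infinity
    then show ?thesis unfolding sp_topology_def by (auto simp: topology_generated_by_topspace)
  qed
qed

lemma transverse_set_dense:
  assumes K: "compact_ball c z \<rho> K" and W: "adapted_compact c' E W"
  shows "Sp closure_of (transverse_set K W) = topspace Sp"
  unfolding dense_intersects_open
proof (intro allI impI)
  fix G assume G: "openin Sp G \<and> G \<noteq> {}"
  then obtain \<phi> where \<phi>: "\<phi> \<in> G" by blast
  then have \<phi>M: "\<phi> \<in> Maps" using openin_subset[of Sp G] G topspace_Sp by blast
  show "transverse_set K W \<inter> G \<noteq> {}"
  proof (cases "\<phi> ` K \<subseteq> W")
    case True
    then show ?thesis using perturb_to_transverse[OF \<phi>M K W True _ \<phi>] G by blast
  next
    case False
    then show ?thesis using \<phi> \<phi>M unfolding transverse_set_def by blast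
  qed
qed

lemma compact_ball_nhd:
  assumes O: "openin (mf_top M) U" "x \<in> U"
  shows "\<exists>c z \<rho> K B. compact_ball c z \<rho> K \<and> K \<subseteq> U \<and> openin (mf_top M) B \<and> x \<in> B \<and> B \<subseteq> K"
proof -
  have "x \<in> topspace (mf_top M)" using O openin_subset by blast
  then obtain c where c: "c \<in> F" "x \<in> fst c" using Cr_foliation_covers[OF fol] by blast
  have ch: "is_chart M c" by (rule F_chart[OF c(1)])
  have "openin (top_of_set V) (snd c ` (fst c \<inter> U))"
    by (rule chart_open_image[OF ch openin_Int[OF chart_openin[OF ch] O(1)]]) simp
  moreover have "snd c x \<in> snd c ` (fst c \<inter> U)" using c O by blast
  ultimately obtain e where e: "e > 0" "ball (snd c x) e \<inter> V \<subseteq> snd c ` (fst c \<inter> U)"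
    unfolding openin_contains_ball by blast
  let ?z = "snd c x" and ?K = "{y \<in> fst c. snd c y \<in> cball (snd c x) (e / 2)}"
  let ?B = "{y \<in> fst c. snd c y \<in> ball (snd c x) (e / 2) \<inter> V}"
  have zV: "?z \<in> V" by (rule chart_in_model[OF ch c(2)])
  have sub: "cball ?z (e / 2) \<inter> V \<subseteq> snd c ` (fst c \<inter> U)" using e by auto
  have K: "compact_ball c ?z (e / 2) ?K"
    unfolding compact_ball_def using c(1) zV e(1) sub by auto
  have KU: "?K \<subseteq> U"
  proof
    fix y assume y: "y \<in> ?K"
    then have "snd c y \<in> snd c ` (fst c \<inter> U)" using sub chart_in_model[OF ch, of y] by auto
    then show "y \<in> U" using inj_on_image_mem_iff[OF chart_inj[OF ch], of y "fst c \<inter> U"] y by auto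
  qed
  have "openin (top_of_set V) (ball ?z (e / 2) \<inter> V)" by (simp add: Int_commute openin_open_Int)
  then have B: "openin (mf_top M) ?B" by (rule chart_open_preimage[OF ch])
  have "x \<in> ?B" "?B \<subseteq> ?K" using c zV e(1) by auto
  with K KU B show ?thesis
    by (intro exI[of _ c] exI[of _ ?z] exI[of _ "e / 2"] exI[of _ ?K] exI[of _ ?B] conjI)
qed

lemma adapted_compact_nhd:
  assumes A: "embedded_submanifold M' A" "submanifold_transverse_to_foliation M' F' A" and y: "y \<in> A"
  shows "\<exists>c' E W B. adapted_compact c' E W \<and> openin (mf_top M') B \<and> y \<in> B \<and> B \<subseteq> W"
proof -
  obtain c' E where c': "c' \<in> F'" "y \<in> fst c'" and E: "subspace E" "E \<subseteq> snd ` V'" "adapted A c' E"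
    by (rule adapted_chart_exists[OF r fol' A y])
  have ch: "is_chart M' c'" by (rule F'_chart[OF c'(1)])
  have "snd c' y \<in> snd c' ` fst c'" using c' by blast
  then obtain e where e: "e > 0" "ball (snd c' y) e \<inter> V' \<subseteq> snd c' ` fst c'"
    using chart_image_openin[OF ch] unfolding openin_contains_ball by blast
  let ?Z = "cball (snd c' y) (e / 2) \<inter> V'"
  let ?W = "{x \<in> fst c'. snd c' x \<in> ?Z}" and ?B = "{x \<in> fst c'. snd c' x \<in> ball (snd c' y) (e / 2) \<inter> V'}"
  have "compact ?Z" by (intro compact_Int_closed compact_cball closed_subspace[OF V'])
  moreover have "?Z \<subseteq> snd c' ` fst c'" using e by auto
  ultimately have "compactin (mf_top M') ?W" by (rule chart_compact_preimage[OF ch])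
  then have W: "adapted_compact c' E ?W" using c'(1) E by (auto simp: adapted_compact_def)
  have "openin (top_of_set V') (ball (snd c' y) (e / 2) \<inter> V')" by (simp add: Int_commute openin_open_Int)
  then have B: "openin (mf_top M') ?B" by (rule chart_open_preimage[OF ch])
  have "y \<in> ?B" "?B \<subseteq> ?W" using c' chart_in_model[OF ch c'(2)] e(1) by auto
  with W B show ?thesis
    by (intro exI[of _ c'] exI[of _ E] exI[of _ ?W] exI[of _ ?B] conjI)
qed

text \<open>Balls are selected from a countable family by enclosing them between two base sets: for
  every pair that has some compact ball in between, one such ball is kept. Likewise one adapted
  compact set is kept above each base set that lies in one. The two-sided control is essential: the
  ball must contain the given x, and must be small enough to be sent into the selected compact
  set.\<close>

lemma residual_transverse:
  assumes A: "embedded_submanifold M' A" "submanifold_transverse_to_foliation M' F' A"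
  shows "residual_in Sp {\<phi> \<in> Maps. map_transverse_to M M' \<phi> A}"
proof -
  have "second_countable (mf_top M)" "second_countable (mf_top M')"
    using mfd mfd' unfolding Cr_manifold_def by blast+
  then obtain \<B> \<B>' where cB: "countable \<B>" "countable \<B>'"
    and opB: "\<forall>U\<in>\<B>. openin (mf_top M) U" "\<forall>U\<in>\<B>'. openin (mf_top M') U"
    and base: "\<forall>U x. openin (mf_top M) U \<and> x \<in> U \<longrightarrow> (\<exists>B\<in>\<B>. x \<in> B \<and> B \<subseteq> U)"
    and base': "\<forall>U x. openin (mf_top M') U \<and> x \<in> U \<longrightarrow> (\<exists>B\<in>\<B>'. x \<in> B \<and> B \<subseteq> U)"
    unfolding second_countable_def by (elim exE conjE)
  define isK where "isK K \<longleftrightarrow> (\<exists>c z \<rho>. compact_ball c z \<rho> K)" for K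
  define isW where "isW W \<longleftrightarrow> (\<exists>c' E. adapted_compact c' E W)" for W
  define selK where "selK U = (SOME K. isK K \<and> fst U \<subseteq> K \<and> K \<subseteq> snd U)" for U
  define selW where "selW U = (SOME W. isW W \<and> U \<subseteq> W)" for U
  define \<K> where "\<K> = selK ` {U \<in> \<B> \<times> \<B>. \<exists>K. isK K \<and> fst U \<subseteq> K \<and> K \<subseteq> snd U}"
  define \<W> where "\<W> = selW ` {U \<in> \<B>'. \<exists>W. isW W \<and> U \<subseteq> W}"
  have cK: "countable \<K>" unfolding \<K>_def
    by (intro countable_image countable_subset[OF _ countable_SIGMA[OF cB(1) cB(1)]]) blast
  have cW: "countable \<W>" unfolding \<W>_def by (intro countable_image countable_subset[OF _ cB(2)]) blast
  have selK: "isK (selK U) \<and> fst U \<subseteq> selK U \<and> selK U \<subseteq> snd U" if "\<exists>K. isK K \<and> fst U \<subseteq> K \<and> K \<subseteq> snd U" for U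
    unfolding selK_def using that by (rule someI_ex)
  have selW: "isW (selW U) \<and> U \<subseteq> selW U" if "\<exists>W. isW W \<and> U \<subseteq> W" for U
    unfolding selW_def using that by (rule someI_ex)
  have isK: "isK K" if "K \<in> \<K>" for K using that selK unfolding \<K>_def by blast
  have isW: "isW W" if "W \<in> \<W>" for W using that selW unfolding \<W>_def by blast
  define \<G> where "\<G> = (\<lambda>(K, W). transverse_set K W) ` (\<K> \<times> \<W>)"
  have "countable \<G>" unfolding \<G>_def by (intro countable_image countable_SIGMA cK cW)
  moreover have "openin Sp G \<and> Sp closure_of G = topspace Sp" if G: "G \<in> \<G>" for G
  proof -
    obtain K W where KW: "K \<in> \<K>" "W \<in> \<W>" "G = transverse_set K W" using G unfolding \<G>_def by auto
    obtain c z \<rho> where K: "compact_ball c z \<rho> K" using isK[OF KW(1)] unfolding isK_def by blast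
    obtain c' E where W: "adapted_compact c' E W" using isW[OF KW(2)] unfolding isW_def by blast
    show ?thesis unfolding KW(3) using transverse_set_open[OF K W] transverse_set_dense[OF K W] by blast
  qed
  moreover have "topspace Sp \<inter> \<Inter>\<G> \<subseteq> {\<phi> \<in> Maps. map_transverse_to M M' \<phi> A}"
  proof
    fix \<phi> assume \<phi>: "\<phi> \<in> topspace Sp \<inter> \<Inter>\<G>"
    then have \<phi>M: "\<phi> \<in> Maps" using topspace_Sp by blast
    have "transverse_at M M' \<phi> A x" if x: "x \<in> topspace (mf_top M)" for x
    proof (cases "\<phi> x \<in> A")
      case True
      obtain c' E W B where W: "adapted_compact c' E W" and B: "openin (mf_top M') B" "\<phi> x \<in> B" "B \<subseteq> W"
        using adapted_compact_nhd[OF A True] by blast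
      obtain B1 where B1: "B1 \<in> \<B>'" "\<phi> x \<in> B1" "B1 \<subseteq> B" using base' B(1,2) by blast
      have "\<exists>W. isW W \<and> B1 \<subseteq> W" using W B(3) B1(3) unfolding isW_def by blast
      then have W': "selW B1 \<in> \<W>" "B1 \<subseteq> selW B1" using selW[of B1] B1(1) unfolding \<W>_def by blast+
      \<comment> \<open>The outer base set \<open>U2\<close> is chosen inside the preimage of
        \<open>B1\<close>, so that any ball inside it is sent into the selected compact set; the
        inner one, \<open>U1\<close>, contains x, so that any ball around it does.\<close>
      have "openin (mf_top M) (topspace (mf_top M) \<inter> \<phi> -` B1)"
        by (rule Cr_maps_preimage_open[OF foliation_maps_Cr[OF \<phi>M] openin_topspace opB(2)[rule_format, OF B1(1)]])
      moreover have "x \<in> topspace (mf_top M) \<inter> \<phi> -` B1" using x B1 by blast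
      ultimately obtain U2 where U2: "U2 \<in> \<B>" "x \<in> U2" "U2 \<subseteq> topspace (mf_top M) \<inter> \<phi> -` B1"
        using base by blast
      obtain c z \<rho> K B2 where K: "compact_ball c z \<rho> K" "K \<subseteq> U2" and B2: "openin (mf_top M) B2" "x \<in> B2" "B2 \<subseteq> K"
        using compact_ball_nhd[OF opB(1)[rule_format, OF U2(1)] U2(2)] by blast
      obtain U1 where U1: "U1 \<in> \<B>" "x \<in> U1" "U1 \<subseteq> B2" using base B2(1,2) by blast
      have "isK K" using K(1) unfolding isK_def by blast
      moreover have "fst (U1, U2) \<subseteq> K" "K \<subseteq> snd (U1, U2)" using K(2) B2(3) U1(3) by auto
      ultimately have ex: "\<exists>K. isK K \<and> fst (U1, U2) \<subseteq> K \<and> K \<subseteq> snd (U1, U2)" by blast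
      let ?K = "selK (U1, U2)"
      have "?K \<in> \<K>" unfolding \<K>_def using ex U1(1) U2(1) by blast
      then have "transverse_set ?K (selW B1) \<in> \<G>" unfolding \<G>_def using W'(1) by auto
      then have tr: "\<phi> \<in> transverse_set ?K (selW B1)" using \<phi> by blast
      have sK: "U1 \<subseteq> ?K" "?K \<subseteq> U2" using selK[OF ex] by auto
      have "\<phi> ` ?K \<subseteq> selW B1" using sK(2) U2(3) W'(2) by blast
      moreover have "x \<in> ?K" using U1(2) sK(1) by blast
      ultimately show ?thesis using tr unfolding transverse_set_def by blast
    qed (simp add: transverse_at_def)
    then show "\<phi> \<in> {\<phi> \<in> Maps. map_transverse_to M M' \<phi> A}" using \<phi>M by (simp add: map_transverse_to_iff)
  qed
  ultimately show ?thesis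
    unfolding residual_in_def using topspace_Sp by (intro conjI exI[of _ \<G>]) auto
qed

end

theorem theorem5p1:
  fixes r :: enat
    and M :: "('a, 't::euclidean_space \<times> 'b::euclidean_space) mfd"
    and F :: "('a, 't \<times> 'b) chart set"
    and M' :: "('c, 'u::euclidean_space \<times> 'd::euclidean_space) mfd"
    and F' :: "('c, 'u \<times> 'd) chart set"
    and A :: "'c set"
  assumes "1 \<le> r"
    and "Cr_foliation r M F"
    and "Cr_foliation r M' F'"
    and "embedded_submanifold M' A"
    and "submanifold_transverse_to_foliation M' F' A"
  shows "residual_in (sp_topology r M F M' F')
           {\<phi> \<in> foliation_maps r M F M' F'. map_transverse_to M M' \<phi> A}"
proof -
  interpret transverse_setting r M F M' F' A
    using assms(1-3) by unfold_locales
  show ?thesis by (rule residual_transverse[OF assms(4,5)])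
qed

end
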